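(* Let $\mathcal V$ be a (semi-strict) braided monoidal bicategory and let $\mathcal C$ be a $\mathcal V$-bicategory with multiplication $m$, units $u$, associator $\alpha$ and unitors $\lambda,\rho$. Let $\mathcal C^{\mathsf{op}}$ be the following data: the objects of $\mathcal C$; hom-objects $\mathcal C^{\mathsf{op}}(a,b):=\mathcal C(b,a)$; multiplication $$\underline m\colon \mathcal C^{\mathsf{op}}(d,e)\otimes\mathcal C^{\mathsf{op}}(c,d)=\mathcal C(e,d)\otimes\mathcal C(d,c)\xrightarrow{\ \beta\ }\mathcal C(d,c)\otimes\mathcal C(e,d)\xrightarrow{\ m\ }\mathcal C(e,c)=\mathcal C^{\mathsf{op}}(c,e);$$ units $\underline u_c:=u_c\colon\mathbb 1\to\mathcal C(c,c)$; and the associator $\underline\alpha\colon\underline m(\underline m\otimes 1)\Rightarrow\underline m(1\otimes\underline m)$ and unitors $\underline\lambda\colon\underline m(\underline u\otimes1)\Rightarrow1$, $\underline\rho\colon\underline m(1\otimes\underline u)\Rightarrow1$ described in the context. Then $\mathcal C^{\mathsf{op}}$ is a $\mathcal V$-bicategory.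
   Context: **Gray monoids.** A Gray monoid is a monoid in the category of 2-categories and 2-functors with the Gray tensor product. So its tensor product is strictly associative and unital (unit $\mathbb 1$), and for 1-cells $f\colon A\to A'$, $g\colon B\to B'$ there is an invertible interchanger $\Sigma_{f,g}\colon (f\otimes B')(A\otimes g)\Rightarrow (A'\otimes g)(f\otimes B)$ satisfying the usual axioms. Juxtaposition denotes tensor product of objects and cells (interchangers being inserted where needed); $1$ denotes an identity. **Semi-strict braided monoidal bicategory.** A Gray monoid $\mathcal V$ with a pseudonatural equivalence $\beta_{A,B}\colon A\otimes B\to B\otimes A$ (from $\otimes$ to $\otimes$ precomposed with the symmetry of the Gray tensor product) and invertible modifications $$R_{A,B,C}\colon\beta_{A,BC}\Rightarrow(1_B\,\beta_{A,C})(\beta_{A,B}\,1_C),\qquad S_{A,B,C}\colon\beta_{AB,C}\Rightarrow(\beta_{A,C}\,1_B)(1_A\,\beta_{B,C}),$$ satisfying four braiding axioms: - the two composites from $\beta_{A,BCD}$ to $(1\,1\,\beta_{A,D})(1\,\beta_{A,C}\,1)(\beta_{A,B}\,1\,1)$ built from two instances of $R$ agree; - the two composites from $\beta_{ABC,D}$ to $(\beta_{A,D}\,1\,1)(1\,\beta_{B,D}\,1)(1\,1\,\beta_{C,D})$ built from two instances of $S$ agree; - the two ways of decomposing $\beta_{AB,CD}$ into four elementary braidings (first $R_{AB,C,D}$ and then two instances of $S$, or first $S_{A,B,CD}$ and then two instances of $R$) agree up to the interchanger of $\beta_{A,C}$ and $\beta_{B,D}$; - (Yang–Baxter) the two 2-isomorphisms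 $(\beta_{B,C}1)(1\beta_{A,C})(\beta_{A,B}1)\Rightarrow(1\beta_{A,B})(\beta_{A,C}1)(1\beta_{B,C})$, one obtained from $R^{-1}_{A,B,C}$, pseudonaturality of $\beta_{A,-}$ at $\beta_{B,C}$ and $R_{A,C,B}$, the other from $S^{-1}_{B,A,C}$, pseudonaturality of $\beta_{-,C}$ at $\beta_{A,B}$ and $S_{A,B,C}$, agree. Semi-strictness means moreover that $\beta_{A,\mathbb 1}$ and $\beta_{\mathbb 1,A}$ are identities, and that $R_{A,B,C}$ and $S_{A,B,C}$ are identities whenever at least one of $A,B,C$ is $\mathbb 1$. **$\mathcal V$-bicategories.** A $\mathcal V$-bicategory $\mathcal C$ over a Gray monoid $\mathcal V$ consists of a class of objects; hom-objects $\mathcal C(c,d)\in\mathcal V$; 1-cells $m\colon\mathcal C(d,e)\otimes\mathcal C(c,d)\to\mathcal C(c,e)$ and $u_c\colon\mathbb 1\to\mathcal C(c,c)$; and invertible 2-cells $\alpha\colon m(m1)\Rightarrow m(1m)$, $\lambda\colon m(u1)\Rightarrow 1$, $\rho\colon m(1u)\Rightarrow1$, such that - (IC) the composite $m(m1)(1u1)\xRightarrow{\alpha}m(1m)(1u1)\xRightarrow{1\lambda}m$ equals $\rho1\colon m(m1)(1u1)\Rightarrow m$; - (AC) the composite $m(m1)(m11)\xRightarrow{\alpha1}m(m1)(1m1)\xRightarrow{\alpha}m(1m)(1m1)\xRightarrow{1\alpha}m(1m)(11m)$ equals $m(m1)(m11)\xRightarrow{\alpha}m(1m)(m11)\cong m(m1)(11m)\xRightarrow{\alpha}m(1m)(11m)$,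 the middle isomorphism being the interchanger $\Sigma_{m,m}^{-1}$. **Structural 2-cells of $\mathcal C^{\mathsf{op}}$.** Write $X=\mathcal C^{\mathsf{op}}(e,f)=\mathcal C(f,e)$, $Y=\mathcal C^{\mathsf{op}}(d,e)=\mathcal C(e,d)$, $Z=\mathcal C^{\mathsf{op}}(c,d)=\mathcal C(d,c)$. Then $\underline\alpha$ is the composite $$m\,\beta\,(m1)(\beta_{X,Y}1)\ \cong\ m(1m)\,\beta_{YX,Z}(\beta_{X,Y}1)\ \xRightarrow{\alpha^{-1}}\ m(m1)\,\beta_{YX,Z}(\beta_{X,Y}1)\ \xRightarrow{S}\ m(m1)(\beta_{Y,Z}1)(1\beta_{X,Z})(\beta_{X,Y}1)$$ $$\xRightarrow{R^{-1}}\ m(m1)(\beta_{Y,Z}1)\,\beta_{X,YZ}\ \cong\ m(m1)\,\beta_{X,ZY}(1\beta_{Y,Z})\ \cong\ m\,\beta\,(1m)(1\beta_{Y,Z}),$$ where the unnamed isomorphisms are pseudonaturality cells of $\beta$ (with respect to $m$, $\beta_{Y,Z}$ and $m$ respectively). The unitor $\underline\lambda$ is $m\beta(u1)\cong m(1u)\beta_{\mathbb 1,-}=m(1u)\xRightarrow{\rho}1$, and $\underline\rho$ is $m\beta(1u)\cong m(u1)\beta_{-,\mathbb 1}=m(u1)\xRightarrow{\lambda}1$, where the isomorphisms are pseudonaturality cells of $\beta$ with respect to $u$. *)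

theory Defs
  imports Main
begin

section \<open>Strict 2-categories\<close>

text \<open>
  1-cells compose in the usual (applicative) order: \<open>g \<cdot> f\<close> is \<open>f\<close> followed by \<open>g\<close>;
  \<open>y \<bullet> x\<close> is vertical composition (\<open>x\<close> first) and \<open>y \<star> x\<close> is horizontal composition.
  Only the values of the operations on the carriers (and on composable cells) matter.
\<close>

record ('o, 'm, 'c) two_cat =
  Obj :: "'o set"
  Arr :: "'m set"
  Cell :: "'c set"
  dom1 :: "'m \<Rightarrow> 'o"
  cod1 :: "'m \<Rightarrow> 'o"
  src2 :: "'c \<Rightarrow> 'm"
  trg2 :: "'c \<Rightarrow> 'm"
  id1 :: "'o \<Rightarrow> 'm"
  comp1 :: "'m \<Rightarrow> 'm \<Rightarrow> 'm" (infixr "\<cdot>\<index>" 70)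
  id2 :: "'m \<Rightarrow> 'c"
  vcomp :: "'c \<Rightarrow> 'c \<Rightarrow> 'c" (infixr "\<bullet>\<index>" 60)
  hcomp :: "'c \<Rightarrow> 'c \<Rightarrow> 'c" (infixr "\<star>\<index>" 65)

definition hom :: "('o, 'm, 'c, 'z) two_cat_scheme \<Rightarrow> 'o \<Rightarrow> 'o \<Rightarrow> 'm set" where
  "hom V A B = {f \<in> Arr V. dom1 V f = A \<and> cod1 V f = B}"

definition cells :: "('o, 'm, 'c, 'z) two_cat_scheme \<Rightarrow> 'm \<Rightarrow> 'm \<Rightarrow> 'c set" where
  "cells V f g = {x \<in> Cell V. src2 V x = f \<and> trg2 V x = g}"

definition lwhisk :: "('o, 'm, 'c, 'z) two_cat_scheme \<Rightarrow> 'm \<Rightarrow> 'c \<Rightarrow> 'c" (infix "\<cdot>\<^sub>l\<index>" 65) where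
  "g \<cdot>\<^sub>l\<^bsub>V\<^esub> x = id2 V g \<star>\<^bsub>V\<^esub> x"

definition rwhisk :: "('o, 'm, 'c, 'z) two_cat_scheme \<Rightarrow> 'c \<Rightarrow> 'm \<Rightarrow> 'c" (infix "\<cdot>\<^sub>r\<index>" 65) where
  "x \<cdot>\<^sub>r\<^bsub>V\<^esub> f = x \<star>\<^bsub>V\<^esub> id2 V f"

definition is_inverse2 :: "('o, 'm, 'c, 'z) two_cat_scheme \<Rightarrow> 'c \<Rightarrow> 'c \<Rightarrow> bool" where
  "is_inverse2 V x y \<longleftrightarrow>
     x \<in> Cell V \<and> y \<in> cells V (trg2 V x) (src2 V x) \<and>
     y \<bullet>\<^bsub>V\<^esub> x = id2 V (src2 V x) \<and> x \<bullet>\<^bsub>V\<^esub> y = id2 V (trg2 V x)"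

definition invertible2 :: "('o, 'm, 'c, 'z) two_cat_scheme \<Rightarrow> 'c \<Rightarrow> bool" where
  "invertible2 V x \<longleftrightarrow> (\<exists>y. is_inverse2 V x y)"

definition inv2 :: "('o, 'm, 'c, 'z) two_cat_scheme \<Rightarrow> 'c \<Rightarrow> 'c" where
  "inv2 V x = (THE y. is_inverse2 V x y)"

definition iso_cells :: "('o, 'm, 'c, 'z) two_cat_scheme \<Rightarrow> 'm \<Rightarrow> 'm \<Rightarrow> 'c set" where
  "iso_cells V f g = {x \<in> cells V f g. invertible2 V x}"

definition equivalence1 :: "('o, 'm, 'c, 'z) two_cat_scheme \<Rightarrow> 'm \<Rightarrow> bool" where
  "equivalence1 V f \<longleftrightarrow> f \<in> Arr V \<and>
     (\<exists>g \<in> hom V (cod1 V f) (dom1 V f).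
        iso_cells V (id1 V (dom1 V f)) (g \<cdot>\<^bsub>V\<^esub> f) \<noteq> {} \<and>
        iso_cells V (f \<cdot>\<^bsub>V\<^esub> g) (id1 V (cod1 V f)) \<noteq> {})"

locale two_category =
  fixes V :: "('o, 'm, 'c, 'z) two_cat_scheme" (structure)
  assumes dom1_Obj: "f \<in> Arr V \<Longrightarrow> dom1 V f \<in> Obj V"
    and cod1_Obj: "f \<in> Arr V \<Longrightarrow> cod1 V f \<in> Obj V"
    and src2_Arr: "x \<in> Cell V \<Longrightarrow> src2 V x \<in> Arr V"
    and trg2_hom: "x \<in> Cell V \<Longrightarrow> trg2 V x \<in> hom V (dom1 V (src2 V x)) (cod1 V (src2 V x))"
    and id1_hom: "A \<in> Obj V \<Longrightarrow> id1 V A \<in> hom V A A"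
    and comp1_hom: "\<lbrakk>f \<in> hom V A B; g \<in> hom V B C\<rbrakk> \<Longrightarrow> g \<cdot> f \<in> hom V A C"
    and comp1_assoc: "\<lbrakk>f \<in> hom V A B; g \<in> hom V B C; h \<in> hom V C D\<rbrakk>
      \<Longrightarrow> (h \<cdot> g) \<cdot> f = h \<cdot> (g \<cdot> f)"
    and comp1_id_right: "f \<in> hom V A B \<Longrightarrow> f \<cdot> id1 V A = f"
    and comp1_id_left: "f \<in> hom V A B \<Longrightarrow> id1 V B \<cdot> f = f"
    and id2_cells: "f \<in> Arr V \<Longrightarrow> id2 V f \<in> cells V f f"
    and vcomp_cells: "\<lbrakk>x \<in> cells V f g; y \<in> cells V g h\<rbrakk> \<Longrightarrow> y \<bullet> x \<in> cells V f h"
    and vcomp_assoc: "\<lbrakk>x \<in> cells V f g; y \<in> cells V g h; z \<in> cells V h k\<rbrakk>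
      \<Longrightarrow> (z \<bullet> y) \<bullet> x = z \<bullet> (y \<bullet> x)"
    and vcomp_id_right: "x \<in> cells V f g \<Longrightarrow> x \<bullet> id2 V f = x"
    and vcomp_id_left: "x \<in> cells V f g \<Longrightarrow> id2 V g \<bullet> x = x"
    and hcomp_cells: "\<lbrakk>f \<in> hom V A B; g \<in> hom V B C; x \<in> cells V f f'; y \<in> cells V g g'\<rbrakk>
      \<Longrightarrow> y \<star> x \<in> cells V (g \<cdot> f) (g' \<cdot> f')"
    and hcomp_assoc: "\<lbrakk>f \<in> hom V A B; g \<in> hom V B C; h \<in> hom V C D;
        x \<in> cells V f f'; y \<in> cells V g g'; z \<in> cells V h h'\<rbrakk>
      \<Longrightarrow> (z \<star> y) \<star> x = z \<star> (y \<star> x)"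
    and hcomp_id_right: "\<lbrakk>f \<in> hom V A B; x \<in> cells V f f'\<rbrakk> \<Longrightarrow> x \<star> id2 V (id1 V A) = x"
    and hcomp_id_left: "\<lbrakk>f \<in> hom V A B; x \<in> cells V f f'\<rbrakk> \<Longrightarrow> id2 V (id1 V B) \<star> x = x"
    and hcomp_id2: "\<lbrakk>f \<in> hom V A B; g \<in> hom V B C\<rbrakk> \<Longrightarrow> id2 V g \<star> id2 V f = id2 V (g \<cdot> f)"
    and interchange: "\<lbrakk>f \<in> hom V A B; g \<in> hom V B C;
        x \<in> cells V f f'; x' \<in> cells V f' f''; y \<in> cells V g g'; y' \<in> cells V g' g''\<rbrakk>
      \<Longrightarrow> (y' \<bullet> y) \<star> (x' \<bullet> x) = (y' \<star> x') \<bullet> (y \<star> x)"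

locale two_endofunctor = two_category V
  for V :: "('o, 'm, 'c, 'z) two_cat_scheme" (structure) +
  fixes F0 :: "'o \<Rightarrow> 'o" and F1 :: "'m \<Rightarrow> 'm" and F2 :: "'c \<Rightarrow> 'c"
  assumes F0_Obj: "A \<in> Obj V \<Longrightarrow> F0 A \<in> Obj V"
    and F1_hom: "f \<in> hom V A B \<Longrightarrow> F1 f \<in> hom V (F0 A) (F0 B)"
    and F2_cells: "x \<in> cells V f g \<Longrightarrow> F2 x \<in> cells V (F1 f) (F1 g)"
    and F1_id1: "A \<in> Obj V \<Longrightarrow> F1 (id1 V A) = id1 V (F0 A)"
    and F1_comp1: "\<lbrakk>f \<in> hom V A B; g \<in> hom V B C\<rbrakk> \<Longrightarrow> F1 (g \<cdot> f) = F1 g \<cdot> F1 f"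
    and F2_id2: "f \<in> Arr V \<Longrightarrow> F2 (id2 V f) = id2 V (F1 f)"
    and F2_vcomp: "\<lbrakk>x \<in> cells V f g; y \<in> cells V g h\<rbrakk> \<Longrightarrow> F2 (y \<bullet> x) = F2 y \<bullet> F2 x"
    and F2_hcomp: "\<lbrakk>f \<in> hom V A B; g \<in> hom V B C; x \<in> cells V f f'; y \<in> cells V g g'\<rbrakk>
      \<Longrightarrow> F2 (y \<star> x) = F2 y \<star> F2 x"

text \<open>
  Pseudonatural transformations from \<open>F\<close> to \<open>G\<close>; the naturality cell at \<open>f : A \<rightarrow> B\<close> is
  oriented as \<open>t2 f : t B \<cdot> F f \<Rightarrow> G f \<cdot> t A\<close>.
\<close>

locale pseudonatural_transformation =
  F: two_endofunctor V F0 F1 F2 + G: two_endofunctor V G0 G1 G2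
  for V :: "('o, 'm, 'c, 'z) two_cat_scheme" (structure)
    and F0 F1 F2 G0 G1 G2 +
  fixes t :: "'o \<Rightarrow> 'm" and t2 :: "'m \<Rightarrow> 'c"
  assumes comp_hom: "A \<in> Obj V \<Longrightarrow> t A \<in> hom V (F0 A) (G0 A)"
    and comp_cells: "f \<in> hom V A B \<Longrightarrow> t2 f \<in> iso_cells V (t B \<cdot> F1 f) (G1 f \<cdot> t A)"
    and comp_natural: "\<lbrakk>f \<in> hom V A B; x \<in> cells V f f'\<rbrakk>
      \<Longrightarrow> (G2 x \<cdot>\<^sub>r t A) \<bullet> t2 f = t2 f' \<bullet> (t B \<cdot>\<^sub>l F2 x)"
    and comp_id1: "A \<in> Obj V \<Longrightarrow> t2 (id1 V A) = id2 V (t A)"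
    and comp_comp1: "\<lbrakk>f \<in> hom V A B; g \<in> hom V B C\<rbrakk>
      \<Longrightarrow> t2 (g \<cdot> f) = (G1 g \<cdot>\<^sub>l t2 f) \<bullet> (t2 g \<cdot>\<^sub>r F1 f)"

text \<open>
  Modifications between transformations \<open>(s, s2)\<close> and \<open>(t, t2)\<close> from \<open>F\<close> to \<open>G\<close>;
  of \<open>F\<close> and \<open>G\<close> only the action on 1-cells enters.
\<close>

definition modification ::
  "('o, 'm, 'c, 'z) two_cat_scheme \<Rightarrow> ('m \<Rightarrow> 'm) \<Rightarrow> ('m \<Rightarrow> 'm) \<Rightarrow>
   ('o \<Rightarrow> 'm) \<Rightarrow> ('m \<Rightarrow> 'c) \<Rightarrow> ('o \<Rightarrow> 'm) \<Rightarrow> ('m \<Rightarrow> 'c) \<Rightarrow> ('o \<Rightarrow> 'c) \<Rightarrow> bool" where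
  "modification V F1 G1 s s2 t t2 M \<longleftrightarrow>
     (\<forall>A \<in> Obj V. M A \<in> cells V (s A) (t A)) \<and>
     (\<forall>A B. \<forall>f \<in> hom V A B.
        (G1 f \<cdot>\<^sub>l\<^bsub>V\<^esub> M A) \<bullet>\<^bsub>V\<^esub> s2 f = t2 f \<bullet>\<^bsub>V\<^esub> (M B \<cdot>\<^sub>r\<^bsub>V\<^esub> F1 f))"


section \<open>Gray monoids\<close>

text \<open>
  By the universal property of the Gray tensor product, a 2-functor out of it is a cubical
  functor: a family of 2-functors in each variable (here \<open>A \<otimes> -\<close> and \<open>- \<otimes> B\<close>, written
  \<open>\<lhd>\<close>, \<open>\<rhd>\<close> on 1-cells and \<open>\<unlhd>\<close>, \<open>\<unrhd>\<close> on 2-cells) that agree on objects, together with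
  interchangers satisfying the cubical axioms. A Gray monoid is a 2-category with such a
  tensor product that is strictly associative and unital.
\<close>

record ('o, 'm, 'c) gray = "('o, 'm, 'c) two_cat" +
  unit_obj :: "'o" ("\<one>\<index>")
  tens :: "'o \<Rightarrow> 'o \<Rightarrow> 'o" (infixr "\<otimes>\<index>" 80)
  ltens1 :: "'o \<Rightarrow> 'm \<Rightarrow> 'm" (infix "\<lhd>\<index>" 75)
  rtens1 :: "'m \<Rightarrow> 'o \<Rightarrow> 'm" (infix "\<rhd>\<index>" 75)
  ltens2 :: "'o \<Rightarrow> 'c \<Rightarrow> 'c" (infix "\<unlhd>\<index>" 75)
  rtens2 :: "'c \<Rightarrow> 'o \<Rightarrow> 'c" (infix "\<unrhd>\<index>" 75)
  interchanger :: "'m \<Rightarrow> 'm \<Rightarrow> 'c" ("\<Sigma>\<index>")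

locale gray_monoid = two_category V
  for V :: "('o, 'm, 'c, 'z) gray_scheme" (structure) +
  assumes unit_Obj: "\<one> \<in> Obj V"
    and ltens_functor: "A \<in> Obj V \<Longrightarrow> two_endofunctor V (\<lambda>B. A \<otimes> B) (\<lambda>f. A \<lhd> f) (\<lambda>x. A \<unlhd> x)"
    and rtens_functor: "B \<in> Obj V \<Longrightarrow> two_endofunctor V (\<lambda>A. A \<otimes> B) (\<lambda>f. f \<rhd> B) (\<lambda>x. x \<unrhd> B)"
    and interch_cells: "\<lbrakk>f \<in> hom V A A'; g \<in> hom V B B'\<rbrakk>
      \<Longrightarrow> \<Sigma> f g \<in> iso_cells V ((f \<rhd> B') \<cdot> (A \<lhd> g)) ((A' \<lhd> g) \<cdot> (f \<rhd> B))"
    and interch_natural: "\<lbrakk>f \<in> hom V A A'; g \<in> hom V B B'; x \<in> cells V f f'; y \<in> cells V g g'\<rbrakk>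
      \<Longrightarrow> ((A' \<unlhd> y) \<star> (x \<unrhd> B)) \<bullet> \<Sigma> f g = \<Sigma> f' g' \<bullet> ((x \<unrhd> B') \<star> (A \<unlhd> y))"
    and interch_id_left: "\<lbrakk>A \<in> Obj V; g \<in> hom V B B'\<rbrakk> \<Longrightarrow> \<Sigma> (id1 V A) g = id2 V (A \<lhd> g)"
    and interch_id_right: "\<lbrakk>f \<in> hom V A A'; B \<in> Obj V\<rbrakk> \<Longrightarrow> \<Sigma> f (id1 V B) = id2 V (f \<rhd> B)"
    and interch_comp_left: "\<lbrakk>f \<in> hom V A A'; f' \<in> hom V A' A''; g \<in> hom V B B'\<rbrakk>
      \<Longrightarrow> \<Sigma> (f' \<cdot> f) g = (\<Sigma> f' g \<cdot>\<^sub>r (f \<rhd> B)) \<bullet> ((f' \<rhd> B') \<cdot>\<^sub>l \<Sigma> f g)"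
    and interch_comp_right: "\<lbrakk>f \<in> hom V A A'; g \<in> hom V B B'; g' \<in> hom V B' B''\<rbrakk>
      \<Longrightarrow> \<Sigma> f (g' \<cdot> g) = ((A' \<lhd> g') \<cdot>\<^sub>l \<Sigma> f g) \<bullet> (\<Sigma> f g' \<cdot>\<^sub>r (A \<lhd> g))"
    and unit_left0: "A \<in> Obj V \<Longrightarrow> \<one> \<otimes> A = A"
    and unit_right0: "A \<in> Obj V \<Longrightarrow> A \<otimes> \<one> = A"
    and unit_left1: "f \<in> Arr V \<Longrightarrow> \<one> \<lhd> f = f"
    and unit_right1: "f \<in> Arr V \<Longrightarrow> f \<rhd> \<one> = f"
    and unit_left2: "x \<in> Cell V \<Longrightarrow> \<one> \<unlhd> x = x"
    and unit_right2: "x \<in> Cell V \<Longrightarrow> x \<unrhd> \<one> = x"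
    and assoc0: "\<lbrakk>A \<in> Obj V; B \<in> Obj V; C \<in> Obj V\<rbrakk> \<Longrightarrow> (A \<otimes> B) \<otimes> C = A \<otimes> (B \<otimes> C)"
    and assoc1_right: "\<lbrakk>A \<in> Obj V; B \<in> Obj V; f \<in> Arr V\<rbrakk> \<Longrightarrow> (A \<otimes> B) \<lhd> f = A \<lhd> (B \<lhd> f)"
    and assoc1_mid: "\<lbrakk>A \<in> Obj V; B \<in> Obj V; f \<in> Arr V\<rbrakk> \<Longrightarrow> (A \<lhd> f) \<rhd> B = A \<lhd> (f \<rhd> B)"
    and assoc1_left: "\<lbrakk>A \<in> Obj V; B \<in> Obj V; f \<in> Arr V\<rbrakk> \<Longrightarrow> (f \<rhd> A) \<rhd> B = f \<rhd> (A \<otimes> B)"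
    and assoc2_right: "\<lbrakk>A \<in> Obj V; B \<in> Obj V; x \<in> Cell V\<rbrakk> \<Longrightarrow> (A \<otimes> B) \<unlhd> x = A \<unlhd> (B \<unlhd> x)"
    and assoc2_mid: "\<lbrakk>A \<in> Obj V; B \<in> Obj V; x \<in> Cell V\<rbrakk> \<Longrightarrow> (A \<unlhd> x) \<unrhd> B = A \<unlhd> (x \<unrhd> B)"
    and assoc2_left: "\<lbrakk>A \<in> Obj V; B \<in> Obj V; x \<in> Cell V\<rbrakk> \<Longrightarrow> (x \<unrhd> A) \<unrhd> B = x \<unrhd> (A \<otimes> B)"
    and interch_assoc_right: "\<lbrakk>f \<in> Arr V; g \<in> Arr V; C \<in> Obj V\<rbrakk> \<Longrightarrow> \<Sigma> f (g \<rhd> C) = \<Sigma> f g \<unrhd> C"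
    and interch_assoc_mid: "\<lbrakk>f \<in> Arr V; g \<in> Arr V; C \<in> Obj V\<rbrakk> \<Longrightarrow> \<Sigma> (f \<rhd> C) g = \<Sigma> f (C \<lhd> g)"
    and interch_assoc_left: "\<lbrakk>f \<in> Arr V; g \<in> Arr V; C \<in> Obj V\<rbrakk> \<Longrightarrow> \<Sigma> (C \<lhd> f) g = C \<unlhd> \<Sigma> f g"


section \<open>Semi-strict braided monoidal bicategories\<close>

text \<open>
  A pseudonatural transformation \<open>\<otimes> \<rightarrow> \<otimes> \<circ> symmetry\<close> between 2-functors on the Gray tensor
  square is given by its components on the generating 1-cells \<open>(f, B)\<close> and \<open>(A, g)\<close>:
  \<open>braid1 f B\<close> is the cell of \<open>\<beta>\<^bsub>-,B\<^esub>\<close> at \<open>f\<close> and \<open>braid2 A g\<close> that of \<open>\<beta>\<^bsub>A,-\<^esub>\<close> at \<open>g\<close>,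
  subject to naturality with respect to the generating 2-cells, i.e. 2-cells in either
  variable and the interchangers (\<open>braid_interch\<close>). The symmetry of the Gray tensor product
  takes the interchanger of \<open>(f, g)\<close> to the inverse interchanger of \<open>(g, f)\<close>.
\<close>

record ('o, 'm, 'c) braided_gray = "('o, 'm, 'c) gray" +
  braid :: "'o \<Rightarrow> 'o \<Rightarrow> 'm"
  braid1 :: "'m \<Rightarrow> 'o \<Rightarrow> 'c"
  braid2 :: "'o \<Rightarrow> 'm \<Rightarrow> 'c"
  braidR :: "'o \<Rightarrow> 'o \<Rightarrow> 'o \<Rightarrow> 'c"
  braidS :: "'o \<Rightarrow> 'o \<Rightarrow> 'o \<Rightarrow> 'c"

locale semistrict_braided_monoidal_bicategory = gray_monoid V
  for V :: "('o, 'm, 'c, 'z) braided_gray_scheme" (structure) +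
  assumes braid_equivalence: "\<lbrakk>A \<in> Obj V; B \<in> Obj V\<rbrakk> \<Longrightarrow> equivalence1 V (braid V A B)"
    and braid1_pseudonatural: "B \<in> Obj V \<Longrightarrow>
      pseudonatural_transformation V
        (\<lambda>A. A \<otimes> B) (\<lambda>f. f \<rhd> B) (\<lambda>x. x \<unrhd> B) (\<lambda>A. B \<otimes> A) (\<lambda>f. B \<lhd> f) (\<lambda>x. B \<unlhd> x)
        (\<lambda>A. braid V A B) (\<lambda>f. braid1 V f B)"
    and braid2_pseudonatural: "A \<in> Obj V \<Longrightarrow>
      pseudonatural_transformation V
        (\<lambda>B. A \<otimes> B) (\<lambda>g. A \<lhd> g) (\<lambda>x. A \<unlhd> x) (\<lambda>B. B \<otimes> A) (\<lambda>g. g \<rhd> A) (\<lambda>x. x \<unrhd> A)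
        (\<lambda>B. braid V A B) (\<lambda>g. braid2 V A g)"
    and braid_interch: "\<lbrakk>f \<in> hom V A A'; g \<in> hom V B B'\<rbrakk> \<Longrightarrow>
      (inv2 V (\<Sigma> g f) \<cdot>\<^sub>r braid V A B)
        \<bullet> ((B' \<lhd> f) \<cdot>\<^sub>l braid2 V A g) \<bullet> (braid1 V f B' \<cdot>\<^sub>r (A \<lhd> g))
      = ((g \<rhd> A') \<cdot>\<^sub>l braid1 V f B) \<bullet> (braid2 V A' g \<cdot>\<^sub>r (f \<rhd> B))
        \<bullet> (braid V A' B' \<cdot>\<^sub>l \<Sigma> f g)"
    and R_iso: "\<lbrakk>A \<in> Obj V; B \<in> Obj V; C \<in> Obj V\<rbrakk> \<Longrightarrow> braidR V A B C \<in>
      iso_cells V (braid V A (B \<otimes> C)) ((B \<lhd> braid V A C) \<cdot> (braid V A B \<rhd> C))"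
    and S_iso: "\<lbrakk>A \<in> Obj V; B \<in> Obj V; C \<in> Obj V\<rbrakk> \<Longrightarrow> braidS V A B C \<in>
      iso_cells V (braid V (A \<otimes> B) C) ((braid V A C \<rhd> B) \<cdot> (A \<lhd> braid V B C))"
    \<comment> \<open>A modification between transformations of three variables is one in each variable separately.\<close>
    and R_modification_1: "\<lbrakk>B \<in> Obj V; C \<in> Obj V\<rbrakk> \<Longrightarrow>
      modification V (\<lambda>f. f \<rhd> (B \<otimes> C)) (\<lambda>f. (B \<otimes> C) \<lhd> f)
        (\<lambda>A. braid V A (B \<otimes> C)) (\<lambda>f. braid1 V f (B \<otimes> C))
        (\<lambda>A. (B \<lhd> braid V A C) \<cdot> (braid V A B \<rhd> C))
        (\<lambda>f. ((B \<unlhd> braid1 V f C) \<cdot>\<^sub>r (braid V (dom1 V f) B \<rhd> C))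
             \<bullet> ((B \<lhd> braid V (cod1 V f) C) \<cdot>\<^sub>l (braid1 V f B \<unrhd> C)))
        (\<lambda>A. braidR V A B C)"
    and R_modification_2: "\<lbrakk>A \<in> Obj V; C \<in> Obj V\<rbrakk> \<Longrightarrow>
      modification V (\<lambda>g. A \<lhd> (g \<rhd> C)) (\<lambda>g. g \<rhd> (C \<otimes> A))
        (\<lambda>B. braid V A (B \<otimes> C)) (\<lambda>g. braid2 V A (g \<rhd> C))
        (\<lambda>B. (B \<lhd> braid V A C) \<cdot> (braid V A B \<rhd> C))
        (\<lambda>g. (inv2 V (\<Sigma> g (braid V A C)) \<cdot>\<^sub>r (braid V A (dom1 V g) \<rhd> C))
             \<bullet> ((cod1 V g \<lhd> braid V A C) \<cdot>\<^sub>l (braid2 V A g \<unrhd> C)))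
        (\<lambda>B. braidR V A B C)"
    and R_modification_3: "\<lbrakk>A \<in> Obj V; B \<in> Obj V\<rbrakk> \<Longrightarrow>
      modification V (\<lambda>h. (A \<otimes> B) \<lhd> h) (\<lambda>h. B \<lhd> (h \<rhd> A))
        (\<lambda>C. braid V A (B \<otimes> C)) (\<lambda>h. braid2 V A (B \<lhd> h))
        (\<lambda>C. (B \<lhd> braid V A C) \<cdot> (braid V A B \<rhd> C))
        (\<lambda>h. ((B \<unlhd> braid2 V A h) \<cdot>\<^sub>r (braid V A B \<rhd> dom1 V h))
             \<bullet> ((B \<lhd> braid V A (cod1 V h)) \<cdot>\<^sub>l \<Sigma> (braid V A B) h))
        (\<lambda>C. braidR V A B C)"
    and S_modification_1: "\<lbrakk>B \<in> Obj V; C \<in> Obj V\<rbrakk> \<Longrightarrow>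
      modification V (\<lambda>f. f \<rhd> (B \<otimes> C)) (\<lambda>f. C \<lhd> (f \<rhd> B))
        (\<lambda>A. braid V (A \<otimes> B) C) (\<lambda>f. braid1 V (f \<rhd> B) C)
        (\<lambda>A. (braid V A C \<rhd> B) \<cdot> (A \<lhd> braid V B C))
        (\<lambda>f. ((braid1 V f C \<unrhd> B) \<cdot>\<^sub>r (dom1 V f \<lhd> braid V B C))
             \<bullet> ((braid V (cod1 V f) C \<rhd> B) \<cdot>\<^sub>l inv2 V (\<Sigma> f (braid V B C))))
        (\<lambda>A. braidS V A B C)"
    and S_modification_2: "\<lbrakk>A \<in> Obj V; C \<in> Obj V\<rbrakk> \<Longrightarrow>
      modification V (\<lambda>g. A \<lhd> (g \<rhd> C)) (\<lambda>g. (C \<otimes> A) \<lhd> g)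
        (\<lambda>B. braid V (A \<otimes> B) C) (\<lambda>g. braid1 V (A \<lhd> g) C)
        (\<lambda>B. (braid V A C \<rhd> B) \<cdot> (A \<lhd> braid V B C))
        (\<lambda>g. (\<Sigma> (braid V A C) g \<cdot>\<^sub>r (A \<lhd> braid V (dom1 V g) C))
             \<bullet> ((braid V A C \<rhd> cod1 V g) \<cdot>\<^sub>l (A \<unlhd> braid1 V g C)))
        (\<lambda>B. braidS V A B C)"
    and S_modification_3: "\<lbrakk>A \<in> Obj V; B \<in> Obj V\<rbrakk> \<Longrightarrow>
      modification V (\<lambda>h. (A \<otimes> B) \<lhd> h) (\<lambda>h. h \<rhd> (A \<otimes> B))
        (\<lambda>C. braid V (A \<otimes> B) C) (\<lambda>h. braid2 V (A \<otimes> B) h)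
        (\<lambda>C. (braid V A C \<rhd> B) \<cdot> (A \<lhd> braid V B C))
        (\<lambda>h. ((braid2 V A h \<unrhd> B) \<cdot>\<^sub>r (A \<lhd> braid V B (dom1 V h)))
             \<bullet> ((braid V A (cod1 V h) \<rhd> B) \<cdot>\<^sub>l (A \<unlhd> braid2 V B h)))
        (\<lambda>C. braidS V A B C)"
    and braiding_R: "\<lbrakk>A \<in> Obj V; B \<in> Obj V; C \<in> Obj V; D \<in> Obj V\<rbrakk> \<Longrightarrow>
      (((B \<otimes> C) \<lhd> braid V A D) \<cdot>\<^sub>l (braidR V A B C \<unrhd> D)) \<bullet> braidR V A (B \<otimes> C) D
      = ((B \<unlhd> braidR V A C D) \<cdot>\<^sub>r (braid V A B \<rhd> (C \<otimes> D))) \<bullet> braidR V A B (C \<otimes> D)"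
    and braiding_S: "\<lbrakk>A \<in> Obj V; B \<in> Obj V; C \<in> Obj V; D \<in> Obj V\<rbrakk> \<Longrightarrow>
      ((braidS V A B D \<unrhd> C) \<cdot>\<^sub>r ((A \<otimes> B) \<lhd> braid V C D)) \<bullet> braidS V (A \<otimes> B) C D
      = ((braid V A D \<rhd> (B \<otimes> C)) \<cdot>\<^sub>l (A \<unlhd> braidS V B C D)) \<bullet> braidS V A (B \<otimes> C) D"
    and braiding_RS: "\<lbrakk>A \<in> Obj V; B \<in> Obj V; C \<in> Obj V; D \<in> Obj V\<rbrakk> \<Longrightarrow>
      ((C \<unlhd> braidS V A B D) \<star> (braidS V A B C \<unrhd> D)) \<bullet> braidR V (A \<otimes> B) C D
      = ((C \<lhd> (braid V A D \<rhd> B))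
           \<cdot>\<^sub>l (\<Sigma> (braid V A C) (braid V B D) \<cdot>\<^sub>r (A \<lhd> (braid V B C \<rhd> D))))
        \<bullet> ((braidR V A C D \<unrhd> B) \<star> (A \<unlhd> braidR V B C D)) \<bullet> braidS V A B (C \<otimes> D)"
    and yang_baxter: "\<lbrakk>A \<in> Obj V; B \<in> Obj V; C \<in> Obj V\<rbrakk> \<Longrightarrow>
      (braidR V A C B \<cdot>\<^sub>r (A \<lhd> braid V B C))
        \<bullet> inv2 V (braid2 V A (braid V B C))
        \<bullet> ((braid V B C \<rhd> A) \<cdot>\<^sub>l inv2 V (braidR V A B C))
      = ((C \<lhd> braid V A B) \<cdot>\<^sub>l braidS V A B C)
        \<bullet> braid1 V (braid V A B) C
        \<bullet> (inv2 V (braidS V B A C) \<cdot>\<^sub>r (braid V A B \<rhd> C))"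
    and braid_unit_right: "A \<in> Obj V \<Longrightarrow> braid V A \<one> = id1 V A"
    and braid_unit_left: "A \<in> Obj V \<Longrightarrow> braid V \<one> A = id1 V A"
    and R_unit: "\<lbrakk>A \<in> Obj V; B \<in> Obj V; C \<in> Obj V; A = \<one> \<or> B = \<one> \<or> C = \<one>\<rbrakk>
      \<Longrightarrow> braidR V A B C = id2 V (braid V A (B \<otimes> C))"
    and S_unit: "\<lbrakk>A \<in> Obj V; B \<in> Obj V; C \<in> Obj V; A = \<one> \<or> B = \<one> \<or> C = \<one>\<rbrakk>
      \<Longrightarrow> braidS V A B C = id2 V (braid V (A \<otimes> B) C)"


section \<open>Bicategories enriched in a Gray monoid\<close>

text \<open>
  \<open>mult c d e : C(d,e) \<otimes> C(c,d) \<rightarrow> C(c,e)\<close>; the remaining structure cells are indexed by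
  their sequence of objects in the same order, e.g. \<open>assoc c d e f\<close> has domain
  \<open>C(e,f) \<otimes> C(d,e) \<otimes> C(c,d)\<close>.
\<close>

record ('a, 'o, 'm, 'c) v_bicat =
  objs :: "'a set"
  homobj :: "'a \<Rightarrow> 'a \<Rightarrow> 'o"
  mult :: "'a \<Rightarrow> 'a \<Rightarrow> 'a \<Rightarrow> 'm"
  unit :: "'a \<Rightarrow> 'm"
  assoc :: "'a \<Rightarrow> 'a \<Rightarrow> 'a \<Rightarrow> 'a \<Rightarrow> 'c"
  lunitor :: "'a \<Rightarrow> 'a \<Rightarrow> 'c"
  runitor :: "'a \<Rightarrow> 'a \<Rightarrow> 'c"

locale v_bicategory = gray_monoid V
  for V :: "('o, 'm, 'c, 'z) gray_scheme" (structure) +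
  fixes C :: "('a, 'o, 'm, 'c) v_bicat"
  assumes homobj_Obj: "\<lbrakk>c \<in> objs C; d \<in> objs C\<rbrakk> \<Longrightarrow> homobj C c d \<in> Obj V"
    and mult_hom: "\<lbrakk>c \<in> objs C; d \<in> objs C; e \<in> objs C\<rbrakk>
      \<Longrightarrow> mult C c d e \<in> hom V (homobj C d e \<otimes> homobj C c d) (homobj C c e)"
    and unit_hom: "c \<in> objs C \<Longrightarrow> unit C c \<in> hom V \<one> (homobj C c c)"
    and assoc_iso: "\<lbrakk>c \<in> objs C; d \<in> objs C; e \<in> objs C; f \<in> objs C\<rbrakk>
      \<Longrightarrow> assoc C c d e f \<in> iso_cells V
            (mult C c d f \<cdot> (mult C d e f \<rhd> homobj C c d))
            (mult C c e f \<cdot> (homobj C e f \<lhd> mult C c d e))"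
    and lunitor_iso: "\<lbrakk>c \<in> objs C; d \<in> objs C\<rbrakk>
      \<Longrightarrow> lunitor C c d \<in> iso_cells V
            (mult C c d d \<cdot> (unit C d \<rhd> homobj C c d)) (id1 V (homobj C c d))"
    and runitor_iso: "\<lbrakk>c \<in> objs C; d \<in> objs C\<rbrakk>
      \<Longrightarrow> runitor C c d \<in> iso_cells V
            (mult C c c d \<cdot> (homobj C c d \<lhd> unit C c)) (id1 V (homobj C c d))"
    and IC: "\<lbrakk>c \<in> objs C; d \<in> objs C; e \<in> objs C\<rbrakk>
      \<Longrightarrow> (mult C c d e \<cdot>\<^sub>l (homobj C d e \<unlhd> lunitor C c d))
            \<bullet> (assoc C c d d e \<cdot>\<^sub>r (homobj C d e \<lhd> (unit C d \<rhd> homobj C c d)))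
          = mult C c d e \<cdot>\<^sub>l (runitor C d e \<unrhd> homobj C c d)"
    and AC: "\<lbrakk>b \<in> objs C; c \<in> objs C; d \<in> objs C; e \<in> objs C; f \<in> objs C\<rbrakk>
      \<Longrightarrow> (mult C b e f \<cdot>\<^sub>l (homobj C e f \<unlhd> assoc C b c d e))
            \<bullet> (assoc C b c e f \<cdot>\<^sub>r (homobj C e f \<lhd> (mult C c d e \<rhd> homobj C b c)))
            \<bullet> (mult C b c f \<cdot>\<^sub>l (assoc C c d e f \<unrhd> homobj C b c))
          = (assoc C b d e f \<cdot>\<^sub>r ((homobj C e f \<otimes> homobj C d e) \<lhd> mult C b c d))
            \<bullet> (mult C b d f \<cdot>\<^sub>l inv2 V (\<Sigma> (mult C d e f) (mult C b c d)))
            \<bullet> (assoc C b c d f \<cdot>\<^sub>r (mult C d e f \<rhd> (homobj C c d \<otimes> homobj C b c)))"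


section \<open>The opposite\<close>

definition op_mult ::
  "('o, 'm, 'c, 'z) braided_gray_scheme \<Rightarrow> ('a, 'o, 'm, 'c) v_bicat \<Rightarrow> 'a \<Rightarrow> 'a \<Rightarrow> 'a \<Rightarrow> 'm" where
  "op_mult V C c d e = mult C e d c \<cdot>\<^bsub>V\<^esub> braid V (homobj C e d) (homobj C d c)"

text \<open>
  The composite below is to be read from bottom to top: \<open>\<beta>\<close> is moved past \<open>m\<close>, then come
  \<open>\<alpha>\<^sup>-\<^sup>1\<close>, \<open>S\<close>, \<open>R\<^sup>-\<^sup>1\<close>, and \<open>\<beta>\<close> is moved past \<open>\<beta>\<^bsub>Y,Z\<^esub>\<close> and past \<open>m\<close>.
\<close>

definition op_assoc ::
  "('o, 'm, 'c, 'z) braided_gray_scheme \<Rightarrow> ('a, 'o, 'm, 'c) v_bicat \<Rightarrow> 'a \<Rightarrow> 'a \<Rightarrow> 'a \<Rightarrow> 'a \<Rightarrow> 'c" where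
  "op_assoc V C c d e f =
    (let X = homobj C f e; Y = homobj C e d; Z = homobj C d c in
      (mult C f e c
         \<cdot>\<^sub>l\<^bsub>V\<^esub> (inv2 V (braid2 V X (mult C e d c)) \<cdot>\<^sub>r\<^bsub>V\<^esub> (X \<lhd>\<^bsub>V\<^esub> braid V Y Z)))
      \<bullet>\<^bsub>V\<^esub> ((mult C f e c \<cdot>\<^bsub>V\<^esub> (mult C e d c \<rhd>\<^bsub>V\<^esub> X))
             \<cdot>\<^sub>l\<^bsub>V\<^esub> inv2 V (braid2 V X (braid V Y Z)))
      \<bullet>\<^bsub>V\<^esub> ((mult C f e c \<cdot>\<^bsub>V\<^esub> (mult C e d c \<rhd>\<^bsub>V\<^esub> X) \<cdot>\<^bsub>V\<^esub> (braid V Y Z \<rhd>\<^bsub>V\<^esub> X))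
             \<cdot>\<^sub>l\<^bsub>V\<^esub> inv2 V (braidR V X Y Z))
      \<bullet>\<^bsub>V\<^esub> ((mult C f e c \<cdot>\<^bsub>V\<^esub> (mult C e d c \<rhd>\<^bsub>V\<^esub> X))
             \<cdot>\<^sub>l\<^bsub>V\<^esub> (braidS V Y X Z \<cdot>\<^sub>r\<^bsub>V\<^esub> (braid V X Y \<rhd>\<^bsub>V\<^esub> Z)))
      \<bullet>\<^bsub>V\<^esub> (inv2 V (assoc C f e d c)
             \<cdot>\<^sub>r\<^bsub>V\<^esub> (braid V (Y \<otimes>\<^bsub>V\<^esub> X) Z \<cdot>\<^bsub>V\<^esub> (braid V X Y \<rhd>\<^bsub>V\<^esub> Z)))
      \<bullet>\<^bsub>V\<^esub> (mult C f d c
             \<cdot>\<^sub>l\<^bsub>V\<^esub> (braid1 V (mult C f e d) Z \<cdot>\<^sub>r\<^bsub>V\<^esub> (braid V X Y \<rhd>\<^bsub>V\<^esub> Z))))"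

text \<open>In the unitors, \<open>\<beta>\<^bsub>\<one>,-\<^esub>\<close> and \<open>\<beta>\<^bsub>-,\<one>\<^esub>\<close> are identities and are omitted.\<close>

definition op_lunitor ::
  "('o, 'm, 'c, 'z) braided_gray_scheme \<Rightarrow> ('a, 'o, 'm, 'c) v_bicat \<Rightarrow> 'a \<Rightarrow> 'a \<Rightarrow> 'c" where
  "op_lunitor V C c d =
     runitor C d c \<bullet>\<^bsub>V\<^esub> (mult C d d c \<cdot>\<^sub>l\<^bsub>V\<^esub> braid1 V (unit C d) (homobj C d c))"

definition op_runitor ::
  "('o, 'm, 'c, 'z) braided_gray_scheme \<Rightarrow> ('a, 'o, 'm, 'c) v_bicat \<Rightarrow> 'a \<Rightarrow> 'a \<Rightarrow> 'c" where
  "op_runitor V C c d =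
     lunitor C d c \<bullet>\<^bsub>V\<^esub> (mult C d c c \<cdot>\<^sub>l\<^bsub>V\<^esub> braid2 V (homobj C d c) (unit C c))"

definition op_bicat ::
  "('o, 'm, 'c, 'z) braided_gray_scheme \<Rightarrow> ('a, 'o, 'm, 'c) v_bicat \<Rightarrow> ('a, 'o, 'm, 'c) v_bicat" where
  "op_bicat V C =
    \<lparr> objs = objs C,
      homobj = (\<lambda>a b. homobj C b a),
      mult = op_mult V C,
      unit = unit C,
      assoc = op_assoc V C,
      lunitor = op_lunitor V C,
      runitor = op_runitor V C \<rparr>"

end

theory Submission
  imports Defs
begin

text \<open>
  All structural 2-cells are invertible, so the axioms for \<open>C\<^sup>o\<^sup>p\<close> are equations between pasting
  composites of invertible cells. Reversing three letters has two normal forms,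
  \<open>\<beta>\<^bsub>YX,Z\<^esub>(\<beta>\<^bsub>X,Y\<^esub>1)\<close> and \<open>\<beta>\<^bsub>X,ZY\<^esub>(1\<beta>\<^bsub>Y,Z\<^esub>)\<close>, and \<open>S\<close>, \<open>R\<^sup>-\<^sup>1\<close> and the naturality of \<open>\<beta>\<close> at
  \<open>\<beta>\<^bsub>Y,Z\<^esub>\<close> compose to a cell \<open>\<theta>\<close> from the first to the second. The cell \<open>\<theta>\<close> is natural in
  each letter (modification axioms for \<open>R\<close> and \<open>S\<close>) and satisfies a pentagon for four letters (the
  braiding axioms for \<open>R\<close>, for \<open>S\<close>, and for both together). Hence the braiding is a lax
  monoidal constraint for the identity from the reversed tensor product, and \<open>C\<^sup>o\<^sup>p\<close> is a change of
  base: moving every multiplication past every braiding splits the axiom (AC) for \<open>C\<^sup>o\<^sup>p\<close> into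
  (AC) for \<open>C\<close> and the pentagon for \<open>\<theta>\<close>, and (IC) into (IC) for \<open>C\<close> and the triviality
  of \<open>\<theta>\<close> at the unit.

  Pasting composites are handled as formal movies: lists of generating cells with their positions.
  An equation of movies is then certified by a list of elementary moves, and checking a certificate
  is plain list computation.
\<close>

section \<open>Paths and movies\<close>

text \<open>The laws of a 2-category hold on carriers and for composable cells only, so each
  associativity or unit law applied to a pasting composite first needs the boundaries of its
  factors. Movies remove this obstacle: strict associativity and unitality become equations between
  lists, and moves preserve well-formedness, so it is checked only for the movies from which a
  computation starts. What remains is the exchange of independent steps and the genuine relations.
  Soundness of one move is the only metatheorem. No normal form or confluence is claimed; the
  certificate says what to do. Comparison is purely syntactic, which is why each cell gets one
  canonical expression, for example a single form of interchanger with an explicit gap. Since all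
  generators are invertible, an axiom can be read as a trivial loop, and any arc of the loop may be
  traded for the reversed complementary arc. A relation thus applies even where the movie shows only
  part of one of its sides, without inserting cancelling pairs by hand.\<close>

text \<open>
  A list of objects stands for their tensor product. A layer \<open>(A, f, B)\<close> stands for \<open>A \<lhd> f \<rhd> B\<close>,
  and a path is a list of layers in order of application (so reversed with respect to \<open>\<cdot>\<close>). The step
  \<open>(i, A, g, B)\<close> applies \<open>A \<unlhd> g \<unrhd> B\<close> to the layers of a path starting with number \<open>i\<close>, counted
  from 0. Generators carry their boundary words and paths, since these cannot be recovered from the cell.
\<close>

datatype ('o, 'm) gen1 = Gen1 (arr1: 'm) (gdom: "'o list") (gcod: "'o list")

type_synonym ('o, 'm) layer = "'o list \<times> ('o, 'm) gen1 \<times> 'o list"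

datatype ('o, 'm, 'c) gen2 =
  Gen2 (cell2: 'c) (gword: "'o list") (gsrc: "('o, 'm) layer list") (gtrg: "('o, 'm) layer list")

type_synonym ('o, 'm, 'c) step = "nat \<times> 'o list \<times> ('o, 'm, 'c) gen2 \<times> 'o list"

fun ldom :: "('o, 'm) layer \<Rightarrow> 'o list" where "ldom (A, f, B) = A @ gdom f @ B"
fun lcod :: "('o, 'm) layer \<Rightarrow> 'o list" where "lcod (A, f, B) = A @ gcod f @ B"

fun pcod :: "'o list \<Rightarrow> ('o, 'm) layer list \<Rightarrow> 'o list" where
  "pcod w [] = w"
| "pcod w (l # p) = pcod (lcod l) p"

definition ptens :: "'o list \<Rightarrow> ('o, 'm) layer list \<Rightarrow> 'o list \<Rightarrow> ('o, 'm) layer list" where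
  "ptens A p B = map (\<lambda>(A', f, B'). (A @ A', f, B' @ B)) p"

definition shift :: "nat \<Rightarrow> 'o list \<Rightarrow> 'o list \<Rightarrow> ('o, 'm, 'c) step list \<Rightarrow> ('o, 'm, 'c) step list"
  where
  "shift i A B ss = map (\<lambda>(j, A', g, B'). (i + j, A @ A', g, B' @ B)) ss"

fun out :: "('o, 'm) layer list \<Rightarrow> ('o, 'm, 'c) step \<Rightarrow> ('o, 'm) layer list" where
  "out p (i, A, g, B) = take i p @ ptens A (gtrg g) B @ drop (i + length (gsrc g)) p"

fun outs :: "('o, 'm) layer list \<Rightarrow> ('o, 'm, 'c) step list \<Rightarrow> ('o, 'm) layer list" where
  "outs p [] = p"
| "outs p (s # ss) = outs (out p s) ss"

lemma ptens_simps [simp]: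
  "ptens A [] B = []"
  "ptens A ((A', f, B') # p) B = (A @ A', f, B' @ B) # ptens A p B"
  "ptens A (p @ q) B = ptens A p B @ ptens A q B"
  by (auto simp: ptens_def)

lemma length_ptens [simp]: "length (ptens A p B) = length p"
  by (simp add: ptens_def)

lemma ptens_Nil [simp]: "ptens [] p [] = p"
  by (auto simp: ptens_def)

lemma ptens_ptens [simp]: "ptens A (ptens A' p B') B = ptens (A @ A') p (B' @ B)"
  by (auto simp: ptens_def)

lemma pcod_append [simp]: "pcod w (p @ q) = pcod (pcod w p) q"
  by (induction p arbitrary: w) auto

lemma pcod_ptens [simp]: "pcod (A @ w @ B) (ptens A p B) = A @ pcod w p @ B"
proof (induction p arbitrary: w)
  case (Cons l p)
  then show ?case by (cases l) (simp flip: append_assoc, metis append_assoc)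
qed simp

lemma shift_simps [simp]:
  "shift i A B [] = []"
  "shift i A B ((j, A', g, B') # ss) = (i + j, A @ A', g, B' @ B) # shift i A B ss"
  by (auto simp: shift_def)

lemma outs_append [simp]: "outs p (ss @ tt) = outs (outs p ss) tt"
  by (induction ss arbitrary: p) auto

section \<open>Whiskering and inverses\<close>

context two_category
begin

lemma homD: "f \<in> hom V A B \<Longrightarrow> f \<in> Arr V" "f \<in> hom V A B \<Longrightarrow> A \<in> Obj V" "f \<in> hom V A B \<Longrightarrow> B \<in> Obj V"
  using dom1_Obj cod1_Obj by (auto simp: hom_def)

lemma cells_hom: "x \<in> cells V f g \<Longrightarrow> f \<in> hom V A B \<Longrightarrow> g \<in> hom V A B"
  using trg2_hom by (auto simp: cells_def hom_def)

lemma cells_Arr: "x \<in> cells V f g \<Longrightarrow> f \<in> Arr V" "x \<in> cells V f g \<Longrightarrow> g \<in> Arr V"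
  using trg2_hom src2_Arr by (auto simp: cells_def hom_def)

lemma lwhisk_cells: "\<lbrakk>x \<in> cells V f f'; f \<in> hom V A B; g \<in> hom V B C\<rbrakk> \<Longrightarrow> g \<cdot>\<^sub>l x
  \<in> cells V (g \<cdot> f) (g \<cdot> f')"
  unfolding lwhisk_def by (meson hcomp_cells homD id2_cells)

lemma rwhisk_cells: "\<lbrakk>y \<in> cells V g g'; f \<in> hom V A B; g \<in> hom V B C\<rbrakk> \<Longrightarrow> y \<cdot>\<^sub>r f
  \<in> cells V (g \<cdot> f) (g' \<cdot> f)"
  unfolding rwhisk_def by (meson hcomp_cells homD id2_cells)

lemma lwhisk_vcomp:
  assumes "x \<in> cells V f f'" "y \<in> cells V f' f''" "f \<in> hom V A B" "g \<in> hom V B C"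
  shows "g \<cdot>\<^sub>l (y \<bullet> x) = (g \<cdot>\<^sub>l y) \<bullet> (g \<cdot>\<^sub>l x)"
proof -
  have g: "id2 V g \<in> cells V g g" using assms homD id2_cells by blast
  then have "id2 V g = id2 V g \<bullet> id2 V g" using vcomp_id_left by simp
  then show ?thesis unfolding lwhisk_def using interchange[OF assms(3,4,1,2) g g] by simp
qed

lemma rwhisk_vcomp:
  assumes "x \<in> cells V g g'" "y \<in> cells V g' g''" "f \<in> hom V A B" "g \<in> hom V B C"
  shows "(y \<bullet> x) \<cdot>\<^sub>r f = (y \<cdot>\<^sub>r f) \<bullet> (x \<cdot>\<^sub>r f)"
proof -
  have f: "id2 V f \<in> cells V f f" using assms homD id2_cells by blast
  then have "id2 V f = id2 V f \<bullet> id2 V f" using vcomp_id_left by simp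
  then show ?thesis unfolding rwhisk_def using interchange[OF assms(3,4) f f assms(1,2)] by simp
qed

text \<open>Interchange with identity cells. Comparing the two factorisations gives the exchange of
  independent steps; the first one also turns \<open>\<star>\<close> into a movie.\<close>

lemma hcomp_whisk:
  assumes "f \<in> hom V A B" "g \<in> hom V B C" "x \<in> cells V f f'" "y \<in> cells V g g'"
  shows "y \<star> x = (y \<cdot>\<^sub>r f') \<bullet> (g \<cdot>\<^sub>l x)" and "y \<star> x = (g' \<cdot>\<^sub>l x) \<bullet> (y \<cdot>\<^sub>r f)"
proof -
  have i: "id2 V g \<in> cells V g g" "id2 V g' \<in> cells V g' g'"
    "id2 V f \<in> cells V f f" "id2 V f' \<in> cells V f' f'"
    using assms id2_cells cells_Arr by blast+
  show "y \<star> x = (y \<cdot>\<^sub>r f') \<bullet> (g \<cdot>\<^sub>l x)"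
    unfolding lwhisk_def rwhisk_def
    using interchange[OF assms(1,2,3) i(4) i(1) assms(4)] assms vcomp_id_left vcomp_id_right by simp
  show "y \<star> x = (g' \<cdot>\<^sub>l x) \<bullet> (y \<cdot>\<^sub>r f)"
    unfolding lwhisk_def rwhisk_def
    using interchange[OF assms(1,2) i(3) assms(3) assms(4) i(2)] assms vcomp_id_left vcomp_id_right
      by simp
qed

lemma whisk_exchange:
  assumes "f \<in> hom V A B" "g \<in> hom V B C" "x \<in> cells V f f'" "y \<in> cells V g g'"
  shows "(y \<cdot>\<^sub>r f') \<bullet> (g \<cdot>\<^sub>l x) = (g' \<cdot>\<^sub>l x) \<bullet> (y \<cdot>\<^sub>r f)"
  using hcomp_whisk[OF assms] by simp

lemma lwhisk_id2: "\<lbrakk>f \<in> hom V A B; g \<in> hom V B C\<rbrakk> \<Longrightarrow> g \<cdot>\<^sub>l id2 V f = id2 V (g \<cdot> f)"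
  by (simp add: lwhisk_def hcomp_id2)

lemma rwhisk_id2: "\<lbrakk>f \<in> hom V A B; g \<in> hom V B C\<rbrakk> \<Longrightarrow> id2 V g \<cdot>\<^sub>r f = id2 V (g \<cdot> f)"
  by (simp add: rwhisk_def hcomp_id2)

lemma lwhisk_lwhisk:
  assumes x: "x \<in> cells V f f'" and f: "f \<in> hom V A B" and g: "g \<in> hom V B C" and h: "h \<in> hom V C D"
  shows "h \<cdot>\<^sub>l (g \<cdot>\<^sub>l x) = (h \<cdot> g) \<cdot>\<^sub>l x"
  unfolding lwhisk_def hcomp_id2[OF g h, symmetric]
  using hcomp_assoc[OF f g h x id2_cells[OF homD(1)[OF g]] id2_cells[OF homD(1)[OF h]]] by simp

lemma rwhisk_rwhisk:
  assumes x: "x \<in> cells V h h'" and f: "f \<in> hom V A B" and g: "g \<in> hom V B C" and h: "h \<in> hom V C D"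
  shows "(x \<cdot>\<^sub>r g) \<cdot>\<^sub>r f = x \<cdot>\<^sub>r (g \<cdot> f)"
  unfolding rwhisk_def hcomp_id2[OF f g, symmetric]
  using hcomp_assoc[OF f g h id2_cells[OF homD(1)[OF f]] id2_cells[OF homD(1)[OF g]] x] by simp

lemma lwhisk_rwhisk:
  assumes x: "x \<in> cells V g g'" and f: "f \<in> hom V A B" and g: "g \<in> hom V B C" and h: "h \<in> hom V C D"
  shows "(h \<cdot>\<^sub>l x) \<cdot>\<^sub>r f = h \<cdot>\<^sub>l (x \<cdot>\<^sub>r f)"
  unfolding rwhisk_def lwhisk_def
  using hcomp_assoc[OF f g h id2_cells[OF homD(1)[OF f]] x id2_cells[OF homD(1)[OF h]]] by simp

lemma lwhisk_id1: "\<lbrakk>x \<in> cells V f f'; f \<in> hom V A B\<rbrakk> \<Longrightarrow> id1 V B \<cdot>\<^sub>l x = x"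
  by (simp add: lwhisk_def hcomp_id_left)

lemma rwhisk_id1: "\<lbrakk>x \<in> cells V f f'; f \<in> hom V A B\<rbrakk> \<Longrightarrow> x \<cdot>\<^sub>r id1 V A = x"
  by (simp add: rwhisk_def hcomp_id_right)

lemma is_inverse2_cells:
  "x \<in> cells V f g \<Longrightarrow> is_inverse2 V x y \<longleftrightarrow> y \<in> cells V g f \<and> y \<bullet> x = id2 V f \<and> x \<bullet> y = id2 V g"
  by (auto simp: is_inverse2_def cells_def)

text \<open>As usual, y = (z x) y = z (x y) = z. This is needed because \<open>inv2\<close> is a
  definite description.\<close>

lemma is_inverse2_unique:
  assumes "is_inverse2 V x y" "is_inverse2 V x z" shows "y = z"
proof -
  obtain f g where x: "x \<in> cells V f g" using assms by (auto simp: is_inverse2_def cells_def)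
  have "y = (z \<bullet> x) \<bullet> y"
    using assms x by (simp add: is_inverse2_cells[OF x] vcomp_id_left[of y g f])
  also have "\<dots> = z"
    using assms x vcomp_assoc[of y g f x g z f]
      by (simp add: is_inverse2_cells[OF x] vcomp_id_right[of z g f])
  finally show ?thesis .
qed

lemma inv2_eqI: "is_inverse2 V x y \<Longrightarrow> inv2 V x = y"
  unfolding inv2_def by (blast intro: the_equality is_inverse2_unique)

lemma inv2_is_inverse:
  assumes "x \<in> iso_cells V f g" shows "is_inverse2 V x (inv2 V x)"
  using assms inv2_eqI[of x] by (auto simp: iso_cells_def invertible2_def)

lemma iso_cellsD: "x \<in> iso_cells V f g \<Longrightarrow> x \<in> cells V f g"
  by (simp add: iso_cells_def)

lemma iso_cellsI:
  "\<lbrakk>x \<in> cells V f g; y \<in> cells V g f; y \<bullet> x = id2 V f; x \<bullet> y = id2 V g\<rbrakk> \<Longrightarrow> x \<in> iso_cells V f g"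
  unfolding iso_cells_def invertible2_def using is_inverse2_cells by blast

lemma inv2_iso:
  assumes "x \<in> iso_cells V f g" shows "inv2 V x \<in> iso_cells V g f"
  using inv2_is_inverse[OF assms] iso_cellsD[OF assms] iso_cellsI
  by (auto simp: is_inverse2_cells[OF iso_cellsD[OF assms]])

lemma inv2_vcomp:
  "x \<in> iso_cells V f g \<Longrightarrow> inv2 V x \<bullet> x = id2 V f"
  "x \<in> iso_cells V f g \<Longrightarrow> x \<bullet> inv2 V x = id2 V g"
  using inv2_is_inverse[of x f g] by (auto simp: iso_cells_def is_inverse2_cells)

lemma id2_iso: "f \<in> Arr V \<Longrightarrow> id2 V f \<in> iso_cells V f f"
  by (meson id2_cells iso_cellsI vcomp_id_left)

lemma iso_vcomp:
  assumes x: "x \<in> iso_cells V f g" and y: "y \<in> iso_cells V g h"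
  shows "y \<bullet> x \<in> iso_cells V f h" and "inv2 V (y \<bullet> x) = inv2 V x \<bullet> inv2 V y"
proof -
  note c = iso_cellsD[OF x] iso_cellsD[OF y] iso_cellsD[OF inv2_iso[OF x]]
    iso_cellsD[OF inv2_iso[OF y]]
  have 1: "(inv2 V x \<bullet> inv2 V y) \<bullet> (y \<bullet> x) = id2 V f"
    using vcomp_assoc[OF vcomp_cells[OF c(1,2)] c(4,3)] vcomp_assoc[OF c(1,2,4)]
      vcomp_id_left[OF c(1)]
      inv2_vcomp[OF x] inv2_vcomp[OF y] by simp
  have 2: "(y \<bullet> x) \<bullet> (inv2 V x \<bullet> inv2 V y) = id2 V h"
    using vcomp_assoc[OF vcomp_cells[OF c(4,3)] c(1,2)] vcomp_assoc[OF c(4,3,1)]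
      vcomp_id_left[OF c(4)]
      inv2_vcomp[OF x] inv2_vcomp[OF y] by simp
  show "y \<bullet> x \<in> iso_cells V f h" using c 1 2 by (meson iso_cellsI vcomp_cells)
  show "inv2 V (y \<bullet> x) = inv2 V x \<bullet> inv2 V y"
    by (rule inv2_eqI) (use c 1 2 in \<open>auto simp: is_inverse2_cells[OF vcomp_cells[OF c(1,2)]] intro:
      vcomp_cells\<close>)
qed

lemma lwhisk_iso:
  assumes x: "x \<in> iso_cells V f f'" and f: "f \<in> hom V A B" and g: "g \<in> hom V B C"
  shows "g \<cdot>\<^sub>l x \<in> iso_cells V (g \<cdot> f) (g \<cdot> f')"
proof -
  note c = iso_cellsD[OF x] iso_cellsD[OF inv2_iso[OF x]]
  have f': "f' \<in> hom V A B" using cells_hom c(1) f by blast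
  show ?thesis
    by (rule iso_cellsI[of _ _ _ "g \<cdot>\<^sub>l inv2 V x"])
      (use lwhisk_vcomp[OF c f g] lwhisk_vcomp[OF c(2,1) f' g] inv2_vcomp[OF x] lwhisk_cells c f f'
        g
        in \<open>auto simp: lwhisk_id2\<close>)
qed

lemma rwhisk_iso:
  assumes x: "x \<in> iso_cells V g g'" and f: "f \<in> hom V A B" and g: "g \<in> hom V B C"
  shows "x \<cdot>\<^sub>r f \<in> iso_cells V (g \<cdot> f) (g' \<cdot> f)"
proof -
  note c = iso_cellsD[OF x] iso_cellsD[OF inv2_iso[OF x]]
  have g': "g' \<in> hom V B C" using cells_hom c(1) g by blast
  show ?thesis
    by (rule iso_cellsI[of _ _ _ "inv2 V x \<cdot>\<^sub>r f"])
      (use rwhisk_vcomp[OF c f g] rwhisk_vcomp[OF c(2,1) f g'] inv2_vcomp[OF x] rwhisk_cells c f g'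
        g
        in \<open>auto simp: rwhisk_id2\<close>)
qed

end

lemma (in two_endofunctor) F2_iso:
  assumes x: "x \<in> iso_cells V f g" shows "F2 x \<in> iso_cells V (F1 f) (F1 g)"
proof -
  note c = iso_cellsD[OF x] iso_cellsD[OF inv2_iso[OF x]]
  show ?thesis
    by (rule iso_cellsI[of _ _ _ "F2 (inv2 V x)"])
      (use F2_vcomp[OF c] F2_vcomp[OF c(2,1)] inv2_vcomp[OF x] F2_cells c cells_Arr[OF c(1)]
        in \<open>auto simp: F2_id2\<close>)
qed

section \<open>Evaluation of movies\<close>

lemma two_endofunctor_comp:
  assumes F: "two_endofunctor V F0 F1 F2" and G: "two_endofunctor V G0 G1 G2"
  shows "two_endofunctor V (\<lambda>A. G0 (F0 A)) (\<lambda>f. G1 (F1 f)) (\<lambda>x. G2 (F2 x))"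
proof -
  interpret F: two_endofunctor V F0 F1 F2 by (rule F)
  interpret G: two_endofunctor V G0 G1 G2 by (rule G)
  show ?thesis
  proof
    fix f g x y A B C f' g'
    assume "f \<in> hom V A B" "g \<in> hom V B C" "x \<in> cells V f f'" "y \<in> cells V g g'"
    then show "G2 (F2 (hcomp V y x)) = hcomp V (G2 (F2 y)) (G2 (F2 x))"
      using F.F2_hcomp[of f A B g C x f' y g']
        G.F2_hcomp[OF F.F1_hom F.F1_hom F.F2_cells F.F2_cells, of f A B g C x f' y g'] by simp
  next
    fix f g A B C
    assume "f \<in> hom V A B" "g \<in> hom V B C"
    then show "G1 (F1 (comp1 V g f)) = comp1 V (G1 (F1 g)) (G1 (F1 f))"
      using F.F1_comp1[of f A B g C] G.F1_comp1[OF F.F1_hom F.F1_hom, of f A B g C] by simp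
  next
    fix x f g y h
    assume "x \<in> cells V f g" "y \<in> cells V g h"
    then show "G2 (F2 (vcomp V y x)) = vcomp V (G2 (F2 y)) (G2 (F2 x))"
      using F.F2_vcomp[of x f g y h] G.F2_vcomp[OF F.F2_cells F.F2_cells, of x f g y h] by simp
  next
    fix f assume f: "f \<in> Arr V"
    then have "F1 f \<in> Arr V" using F.F1_hom[of f "dom1 V f" "cod1 V f"] by (simp add: hom_def)
    then show "G2 (F2 (id2 V f)) = id2 V (G1 (F1 f))" using f by (simp add: F.F2_id2 G.F2_id2)
  qed (use F.F0_Obj F.F1_hom F.F2_cells F.F1_id1 G.F0_Obj G.F1_hom G.F2_cells G.F1_id1 in auto)
qed

context gray_monoid
begin

text \<open>By \<open>assoc1_mid\<close> the bracketing does not matter. Tensoring on both sides at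
  once is a 2-functor, and two such functors compose to one of the same form, so nested contexts
  need no convention about the order of left and right tensoring.\<close>

definition tn1 where "tn1 A f B = A \<lhd> (f \<rhd> B)"
definition tn2 where "tn2 A x B = A \<unlhd> (x \<unrhd> B)"

lemma tens_Obj: "\<lbrakk>A \<in> Obj V; B \<in> Obj V\<rbrakk> \<Longrightarrow> A \<otimes> B \<in> Obj V"
  using two_endofunctor.F0_Obj[OF ltens_functor] by blast

lemma tn_functor:
  assumes "A \<in> Obj V" "B \<in> Obj V"
  shows "two_endofunctor V (\<lambda>P. A \<otimes> (P \<otimes> B)) (\<lambda>f. tn1 A f B) (\<lambda>x. tn2 A x B)"
  unfolding tn1_def tn2_def using two_endofunctor_comp[OF rtens_functor ltens_functor] assms
    by blast

lemmas tn1_hom = two_endofunctor.F1_hom[OF tn_functor]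
  and tn2_cells = two_endofunctor.F2_cells[OF tn_functor]
  and tn1_id1 = two_endofunctor.F1_id1[OF tn_functor]
  and tn1_comp1 = two_endofunctor.F1_comp1[OF tn_functor]
  and tn2_id2 = two_endofunctor.F2_id2[OF tn_functor]
  and tn2_vcomp = two_endofunctor.F2_vcomp[OF tn_functor]
  and tn2_hcomp = two_endofunctor.F2_hcomp[OF tn_functor]
  and tn2_iso = two_endofunctor.F2_iso[OF tn_functor]

lemma tn1_tn1:
  assumes "A \<in> Obj V" "B \<in> Obj V" "A' \<in> Obj V" "B' \<in> Obj V" "f \<in> Arr V"
  shows "tn1 A (tn1 A' f B') B = tn1 (A \<otimes> A') f (B' \<otimes> B)"
proof -
  have f: "f \<in> hom V (dom1 V f) (cod1 V f)" using assms by (simp add: hom_def)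
  have 1: "f \<rhd> B' \<in> Arr V" using two_endofunctor.F1_hom[OF rtens_functor[OF assms(4)] f] homD
    by blast
  have 2: "(f \<rhd> B') \<rhd> B \<in> Arr V" using two_endofunctor.F1_hom[OF rtens_functor[OF assms(2)]] 1 homD
    by (metis (mono_tags, lifting) hom_def mem_Collect_eq)
  show ?thesis unfolding tn1_def using assms 1 2 by (simp add: assoc1_mid assoc1_left assoc1_right)
qed

lemma tn2_tn2:
  assumes "A \<in> Obj V" "B \<in> Obj V" "A' \<in> Obj V" "B' \<in> Obj V" "x \<in> Cell V"
  shows "tn2 A (tn2 A' x B') B = tn2 (A \<otimes> A') x (B' \<otimes> B)"
proof -
  have x: "x \<in> cells V (src2 V x) (trg2 V x)" using assms by (simp add: cells_def)
  have 1: "x \<unrhd> B' \<in> Cell V" using two_endofunctor.F2_cells[OF rtens_functor[OF assms(4)] x]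
    by (simp add: cells_def)
  have 2: "(x \<unrhd> B') \<unrhd> B \<in> Cell V" using two_endofunctor.F2_cells[OF rtens_functor[OF assms(2)]] 1
    by (metis (mono_tags, lifting) cells_def mem_Collect_eq)
  show ?thesis unfolding tn2_def using assms 1 2 by (simp add: assoc2_mid assoc2_left assoc2_right)
qed

lemma tn1_unit: "f \<in> Arr V \<Longrightarrow> tn1 \<one> f \<one> = f"
  by (simp add: tn1_def unit_right1 unit_left1)

lemma tn2_unit: "x \<in> Cell V \<Longrightarrow> tn2 \<one> x \<one> = x"
  by (simp add: tn2_def unit_right2 unit_left2)

lemma tn2_lwhisk:
  assumes "x \<in> cells V f f'" "f \<in> hom V P Q" "g \<in> hom V Q R" "A \<in> Obj V" "B \<in> Obj V"
  shows "tn2 A (g \<cdot>\<^sub>l x) B = tn1 A g B \<cdot>\<^sub>l tn2 A x B"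
  unfolding lwhisk_def using tn2_hcomp[OF assms(4,5,2,3,1) id2_cells] assms homD tn2_id2 by simp

lemma tn2_rwhisk:
  assumes "x \<in> cells V g g'" "f \<in> hom V P Q" "g \<in> hom V Q R" "A \<in> Obj V" "B \<in> Obj V"
  shows "tn2 A (x \<cdot>\<^sub>r f) B = tn2 A x B \<cdot>\<^sub>r tn1 A f B"
  unfolding rwhisk_def using tn2_hcomp[OF assms(4,5,2,3) id2_cells assms(1)] assms homD tn2_id2
    by simp

text \<open>The recursion ends in \<one>, so a one-letter word has the value
  \<open>A \<otimes> \<one>\<close>; strict unitality is what identifies it with
  \<open>A\<close>.\<close>

fun word_obj :: "'o list \<Rightarrow> 'o" where
  "word_obj [] = \<one>"
| "word_obj (A # w) = A \<otimes> word_obj w"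

definition wf_word :: "'o list \<Rightarrow> bool" where "wf_word w \<longleftrightarrow> set w \<subseteq> Obj V"

lemma wf_word_simps [simp]: "wf_word []" "wf_word (A # w) \<longleftrightarrow> A \<in> Obj V \<and> wf_word w"
  "wf_word (v @ w) \<longleftrightarrow> wf_word v \<and> wf_word w"
  by (auto simp: wf_word_def)

lemma word_obj_Obj: "wf_word w \<Longrightarrow> word_obj w \<in> Obj V"
  by (induction w) (auto simp: unit_Obj tens_Obj)

lemma word_obj_append: "wf_word v \<Longrightarrow> wf_word w \<Longrightarrow> word_obj (v @ w) = word_obj v \<otimes> word_obj w"
  by (induction v) (auto simp: unit_left0 assoc0 word_obj_Obj)

definition wf_gen1 :: "('o, 'm) gen1 \<Rightarrow> bool" where
  "wf_gen1 f \<longleftrightarrow> wf_word (gdom f) \<and> wf_word (gcod f) \<and> arr1 f \<in> hom V (word_obj (gdom f))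
    (word_obj (gcod f))"

fun wf_layer :: "('o, 'm) layer \<Rightarrow> bool" where
  "wf_layer (A, f, B) \<longleftrightarrow> wf_word A \<and> wf_gen1 f \<and> wf_word B"

fun eval_layer :: "('o, 'm) layer \<Rightarrow> 'm" where
  "eval_layer (A, f, B) = tn1 (word_obj A) (arr1 f) (word_obj B)"

fun wf_path :: "'o list \<Rightarrow> ('o, 'm) layer list \<Rightarrow> bool" where
  "wf_path w [] \<longleftrightarrow> wf_word w"
| "wf_path w (l # p) \<longleftrightarrow> wf_layer l \<and> ldom l = w \<and> wf_path (lcod l) p"

text \<open>The starting word is an argument because an empty path stands for an identity and has no
  layer from which the object could be read.\<close>

fun eval_path :: "'o list \<Rightarrow> ('o, 'm) layer list \<Rightarrow> 'm" where
  "eval_path w [] = id1 V (word_obj w)"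
| "eval_path w (l # p) = eval_path (lcod l) p \<cdot> eval_layer l"

lemma eval_layer_hom: "wf_layer l \<Longrightarrow> eval_layer l \<in> hom V (word_obj (ldom l)) (word_obj (lcod l))"
proof (cases l)
  case (fields A f B)
  assume "wf_layer l"
  then show ?thesis
    using fields tn1_hom[of "word_obj A" "word_obj B" "arr1 f" "word_obj (gdom f)"
      "word_obj (gcod f)"]
    by (simp add: wf_gen1_def word_obj_append word_obj_Obj)
qed

lemma wf_path_wf_word: "wf_path w p \<Longrightarrow> wf_word w" "wf_path w p \<Longrightarrow> wf_word (pcod w p)"
proof (induction p arbitrary: w)
  case (Cons l p)
  { case 1 then show ?case by (cases l) (auto simp: wf_gen1_def) }
  { case 2 then show ?case using Cons by auto }
qed auto

lemma wf_path_append [simp]: "wf_path w (p @ q) \<longleftrightarrow> wf_path w p \<and> wf_path (pcod w p) q"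
  by (induction p arbitrary: w) (auto dest: wf_path_wf_word)

lemma eval_path_hom: "wf_path w p \<Longrightarrow> eval_path w p \<in> hom V (word_obj w) (word_obj (pcod w p))"
proof (induction p arbitrary: w)
  case (Cons l p)
  then show ?case using eval_layer_hom[of l] comp1_hom by auto
qed (auto simp: id1_hom word_obj_Obj)

lemma eval_path_Arr: "wf_path w p \<Longrightarrow> eval_path w p \<in> Arr V"
  using eval_path_hom homD by blast

lemma eval_path_append: "wf_path w (p @ q) \<Longrightarrow> eval_path w (p @ q) = eval_path (pcod w p) q \<cdot>
  eval_path w p"
proof (induction p arbitrary: w)
  case Nil
  then show ?case using eval_path_hom comp1_id_right by fastforce
next
  case (Cons l p)
  then have "wf_layer l" "ldom l = w" "wf_path (lcod l) p" "wf_path (pcod (lcod l) p) q" by auto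
  then show ?case
    using Cons.IH[of "lcod l"] comp1_assoc[OF eval_layer_hom eval_path_hom eval_path_hom] by simp
qed

lemma eval_path_single: "wf_layer l \<Longrightarrow> ldom l = w \<Longrightarrow> eval_path w [l] = eval_layer l"
  using eval_layer_hom[of l] comp1_id_left by simp

lemma wf_path_ptens [simp]: "wf_word A \<Longrightarrow> wf_word B \<Longrightarrow> wf_path w p \<Longrightarrow> wf_path (A @ w @ B)
  (ptens A p B)"
proof (induction p arbitrary: w)
  case (Cons l p)
  obtain A' f B' where l: "l = (A', f, B')" by (cases l)
  with Cons show ?case using Cons.IH[of "lcod l"] by auto
qed auto

lemma eval_path_ptens:
  "wf_word A \<Longrightarrow> wf_word B \<Longrightarrow> wf_path w p \<Longrightarrow> eval_path (A @ w @ B) (ptens A p B) = tn1 (word_obj A)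
    (eval_path w p) (word_obj B)"
proof (induction p arbitrary: w)
  case Nil
  then show ?case by (simp add: tn1_id1 word_obj_Obj word_obj_append)
next
  case (Cons l p)
  obtain A' f B' where l: "l = (A', f, B')" by (cases l)
  have wl: "wf_layer l" and wp: "wf_path (lcod l) p" and AB: "word_obj A \<in> Obj V"
    "word_obj B \<in> Obj V"
    using Cons word_obj_Obj by auto
  have "eval_layer (A @ A', f, B' @ B) = tn1 (word_obj A) (eval_layer l) (word_obj B)"
    using Cons.prems l
      by (auto simp: wf_gen1_def word_obj_append word_obj_Obj tn1_tn1 dest: homD(1))
  moreover have "eval_path (A @ lcod l @ B) (ptens A p B) = tn1 (word_obj A) (eval_path (lcod l) p)
    (word_obj B)"
    using Cons by simp
  ultimately show ?case
    using l tn1_comp1[OF AB eval_layer_hom[OF wl] eval_path_hom[OF wp]] by simp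
qed

text \<open>Invertibility is part of well-formedness. Hence every step and every movie has an
  invertible value and can be run backwards.\<close>

fun wf_gen2 :: "('o, 'm, 'c) gen2 \<Rightarrow> bool" where
  "wf_gen2 (Gen2 x w p q) \<longleftrightarrow> wf_path w p \<and> wf_path w q \<and> pcod w p = pcod w q \<and> x
    \<in> iso_cells V (eval_path w p) (eval_path w q)"

text \<open>The general one-hole context of a 2-cell. Such contexts are closed under composition
  (\<open>whisk_whisk\<close>), which is what allows a whole movie to be placed inside a larger
  one.\<close>

definition whisk :: "'m \<Rightarrow> 'o \<Rightarrow> 'o \<Rightarrow> 'm \<Rightarrow> 'c \<Rightarrow> 'c" where
  "whisk h A B k x = h \<cdot>\<^sub>l (tn2 A x B \<cdot>\<^sub>r k)"

lemma whisk_iso: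
  assumes "x \<in> iso_cells V f f'" "f \<in> hom V P Q" "A \<in> Obj V" "B \<in> Obj V"
    and "k \<in> hom V D (A \<otimes> P \<otimes> B)" "h \<in> hom V (A \<otimes> Q \<otimes> B) E"
  shows "whisk h A B k x \<in> iso_cells V (h \<cdot> tn1 A f B \<cdot> k) (h \<cdot> tn1 A f' B \<cdot> k)"
  unfolding whisk_def
  by (meson assms comp1_hom lwhisk_iso rwhisk_iso tn1_hom tn2_iso)

lemma whisk_vcomp:
  assumes x: "x \<in> cells V f f'" and y: "y \<in> cells V f' f''"
    and f: "f \<in> hom V P Q" and AB: "A \<in> Obj V" "B \<in> Obj V"
    and k: "k \<in> hom V D (A \<otimes> P \<otimes> B)" and h: "h \<in> hom V (A \<otimes> Q \<otimes> B) E"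
  shows "whisk h A B k (y \<bullet> x) = whisk h A B k y \<bullet> whisk h A B k x"
proof -
  have f': "f' \<in> hom V P Q" using cells_hom x f by blast
  note t = tn2_cells[OF AB x] tn2_cells[OF AB y] tn1_hom[OF AB f] tn1_hom[OF AB f']
  show ?thesis unfolding whisk_def
    using tn2_vcomp[OF AB x y] rwhisk_vcomp[OF t(1,2) k t(3)]
      lwhisk_vcomp[OF rwhisk_cells[OF t(1) k t(3)] rwhisk_cells[OF t(2) k t(4)] comp1_hom[OF k t(3)]
        h] by simp
qed

lemma whisk_id2:
  assumes "f \<in> hom V P Q" "A \<in> Obj V" "B \<in> Obj V"
    and "k \<in> hom V D (A \<otimes> P \<otimes> B)" "h \<in> hom V (A \<otimes> Q \<otimes> B) E"
  shows "whisk h A B k (id2 V f) = id2 V (h \<cdot> tn1 A f B \<cdot> k)"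
  unfolding whisk_def
  using assms tn1_hom[OF assms(2,3,1)] tn2_id2[OF assms(2,3)] homD[OF assms(1)]
    rwhisk_id2[OF assms(4)] lwhisk_id2[OF _ assms(5)] comp1_hom[OF assms(4)] by metis

text \<open>Tensoring is 2-functorial, so it distributes over the inner whiskerings; the tensored
  \<open>h'\<close> and \<open>k'\<close> are then absorbed by \<open>h\<close> and
  \<open>k\<close>.\<close>

lemma whisk_whisk:
  assumes x: "x \<in> cells V f f'" and f: "f \<in> hom V P Q"
    and AB: "A \<in> Obj V" "B \<in> Obj V" and AB': "A' \<in> Obj V" "B' \<in> Obj V"
    and k': "k' \<in> hom V D (A' \<otimes> P \<otimes> B')" and h': "h' \<in> hom V (A' \<otimes> Q \<otimes> B') E"
    and k: "k \<in> hom V D' (A \<otimes> D \<otimes> B)" and h: "h \<in> hom V (A \<otimes> E \<otimes> B) E'"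
  shows "whisk h A B k (whisk h' A' B' k' x)
    = whisk (h \<cdot> tn1 A h' B) (A \<otimes> A') (B' \<otimes> B) (tn1 A k' B \<cdot> k) x"
proof -
  note t = tn2_cells[OF AB' x] and tf = tn1_hom[OF AB' f]
  note r = rwhisk_cells[OF t k' tf] and rf = comp1_hom[OF k' tf]
  note T = tn2_cells[OF AB t] and Tf = tn1_hom[OF AB tf]
  note K = tn1_hom[OF AB k'] and H = tn1_hom[OF AB h']
  have X: "tn2 A (tn2 A' x B') B = tn2 (A \<otimes> A') x (B' \<otimes> B)"
    using tn2_tn2 AB AB' x by (simp add: cells_def)
  have "tn2 A (whisk h' A' B' k' x) B = tn1 A h' B \<cdot>\<^sub>l (tn2 A (tn2 A' x B') B \<cdot>\<^sub>r tn1 A k' B)"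
    unfolding whisk_def using tn2_lwhisk[OF r rf h' AB] tn2_rwhisk[OF t k' tf AB] by simp
  then have "whisk h A B k (whisk h' A' B' k' x)
      = h \<cdot>\<^sub>l ((tn1 A h' B \<cdot>\<^sub>l (tn2 A (tn2 A' x B') B \<cdot>\<^sub>r tn1 A k' B)) \<cdot>\<^sub>r k)"
    by (simp add: whisk_def[of h])
  also have "\<dots> = h \<cdot>\<^sub>l (tn1 A h' B \<cdot>\<^sub>l ((tn2 A (tn2 A' x B') B \<cdot>\<^sub>r tn1 A k' B) \<cdot>\<^sub>r k))"
    using lwhisk_rwhisk[OF rwhisk_cells[OF T K Tf] k comp1_hom[OF K Tf] H] by simp
  also have "\<dots> = h \<cdot>\<^sub>l (tn1 A h' B \<cdot>\<^sub>l (tn2 A (tn2 A' x B') B \<cdot>\<^sub>r (tn1 A k' B \<cdot> k)))"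
    using rwhisk_rwhisk[OF T k K Tf] by simp
  also have "\<dots> = (h \<cdot> tn1 A h' B) \<cdot>\<^sub>l (tn2 A (tn2 A' x B') B \<cdot>\<^sub>r (tn1 A k' B \<cdot> k))"
    using lwhisk_lwhisk[OF rwhisk_cells[OF T comp1_hom[OF k K] Tf]
      comp1_hom[OF comp1_hom[OF k K] Tf] H h] by simp
  finally show ?thesis using X by (simp add: whisk_def)
qed

section \<open>Steps and movies, and their values as 2-cells\<close>

fun wf_step :: "'o list \<Rightarrow> ('o, 'm) layer list \<Rightarrow> ('o, 'm, 'c) step \<Rightarrow> bool" where
  "wf_step w p (i, A, g, B) \<longleftrightarrow> wf_gen2 g \<and> wf_word A \<and> wf_word B \<and> i \<le> length p \<and>
     take (length (gsrc g)) (drop i p) = ptens A (gsrc g) B \<and> pcod w (take i p) = A @ gword g @ B"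

fun eval_step :: "'o list \<Rightarrow> ('o, 'm) layer list \<Rightarrow> ('o, 'm, 'c) step \<Rightarrow> 'c" where
  "eval_step w p (i, A, g, B) =
     whisk (eval_path (A @ pcod (gword g) (gsrc g) @ B) (drop (i + length (gsrc g)) p)) (word_obj A)
       (word_obj B)
       (eval_path w (take i p)) (cell2 g)"

fun eval_movie :: "'o list \<Rightarrow> ('o, 'm) layer list \<Rightarrow> ('o, 'm, 'c) step list \<Rightarrow> 'c" where
  "eval_movie w p [] = id2 V (eval_path w p)"
| "eval_movie w p (s # ss) = eval_movie w (out p s) ss \<bullet> eval_step w p s"

fun wf_movie :: "'o list \<Rightarrow> ('o, 'm) layer list \<Rightarrow> ('o, 'm, 'c) step list \<Rightarrow> bool" where
  "wf_movie w p [] \<longleftrightarrow> wf_path w p"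
| "wf_movie w p (s # ss) \<longleftrightarrow> wf_path w p \<and> wf_step w p s \<and> wf_movie w (out p s) ss"

declare out.simps [simp del] wf_step.simps [simp del] eval_step.simps [simp del]

lemma wf_gen2_iff:
  "wf_gen2 g \<longleftrightarrow> wf_path (gword g) (gsrc g) \<and> wf_path (gword g) (gtrg g)
    \<and> pcod (gword g) (gsrc g) = pcod (gword g) (gtrg g)
    \<and> cell2 g \<in> iso_cells V (eval_path (gword g) (gsrc g)) (eval_path (gword g) (gtrg g))"
  by (cases g) auto

text \<open>Replaces the numerical position by a splitting of the path. The splitting is used for
  reasoning, the form with \<open>take\<close> and \<open>drop\<close> for computing.\<close>

lemma wf_step_E:
  assumes "wf_step w p (i, A, g, B)"
  obtains pre post where "p = pre @ ptens A (gsrc g) B @ post" "length pre = i"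
    "pcod w pre = A @ gword g @ B" "wf_gen2 g" "wf_word A" "wf_word B"
proof
  show "p = take i p @ ptens A (gsrc g) B @ drop (i + length (gsrc g)) p"
    using assms by (simp add: wf_step.simps) (metis add.commute append_take_drop_id drop_drop)
qed (use assms in \<open>auto simp: wf_step.simps\<close>)

lemma wf_step_iff:
  "wf_step w (pre @ ptens A (gsrc g) B @ post) (length pre, A, g, B)
    \<longleftrightarrow> wf_gen2 g \<and> wf_word A \<and> wf_word B \<and> pcod w pre = A @ gword g @ B"
  by (auto simp: wf_step.simps)

lemma out_iff: "out (pre @ ptens A (gsrc g) B @ post) (length pre, A, g, B) = pre @ ptens A (gtrg g)
  B @ post"
  by (simp add: out.simps)

lemma eval_step_iff:
  "eval_step w (pre @ ptens A (gsrc g) B @ post) (length pre, A, g, B)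
    = whisk (eval_path (A @ pcod (gword g) (gsrc g) @ B) post) (word_obj A) (word_obj B)
      (eval_path w pre) (cell2 g)"
  by (simp add: eval_step.simps)

lemma step_facts:
  assumes p: "wf_path w p" and s: "wf_step w p s"
  shows "wf_path w (out p s)" "pcod w (out p s) = pcod w p"
    "eval_step w p s \<in> iso_cells V (eval_path w p) (eval_path w (out p s))"
proof -
  obtain i A g B where S: "s = (i, A, g, B)" by (cases s)
  obtain pre post where *: "p = pre @ ptens A (gsrc g) B @ post" "length pre = i"
    "pcod w pre = A @ gword g @ B" "wf_gen2 g" "wf_word A" "wf_word B"
    using s S wf_step_E by metis
  have o: "out p s = pre @ ptens A (gtrg g) B @ post"
    using out_iff[of pre A g B post] * S by simp
  have g: "wf_path (gword g) (gsrc g)" "wf_path (gword g) (gtrg g)" "pcod (gword g) (gtrg g)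
    = pcod (gword g) (gsrc g)"
    "cell2 g \<in> iso_cells V (eval_path (gword g) (gsrc g)) (eval_path (gword g) (gtrg g))"
    using *(4) wf_gen2_iff by auto
  have AB: "word_obj A \<in> Obj V" "word_obj B \<in> Obj V" using * word_obj_Obj by auto
  show 1: "wf_path w (out p s)" "pcod w (out p s) = pcod w p"
    using p g unfolding o by (auto simp: *)
  have k: "eval_path w pre \<in> hom V (word_obj w) (word_obj A \<otimes> word_obj (gword g) \<otimes> word_obj B)"
    using eval_path_hom[of w pre] p wf_path_wf_word[OF g(1)] by (simp add: * word_obj_append)
  have h: "eval_path (A @ pcod (gword g) (gsrc g) @ B) post
    \<in> hom V (word_obj A \<otimes> word_obj (pcod (gword g) (gsrc g)) \<otimes> word_obj B) (word_obj (pcod w p))"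
    using eval_path_hom[of "A @ pcod (gword g) (gsrc g) @ B" post] p wf_path_wf_word[OF g(1)]
      by (simp add: * word_obj_append)
  \<comment> \<open>Stated for an arbitrary middle path \<open>q\<close>, since the same context
    surrounds both the source and the target of the generator.\<close>
  have e: "eval_path w (pre @ ptens A q B @ post)
     = eval_path (A @ pcod (gword g) (gsrc g) @ B) post \<cdot> tn1 (word_obj A) (eval_path (gword g) q)
       (word_obj B) \<cdot> eval_path w pre"
    if q: "wf_path (gword g) q" "pcod (gword g) q = pcod (gword g) (gsrc g)" for q
  proof -
    have w: "wf_path w pre" "wf_path (A @ pcod (gword g) (gsrc g) @ B) post" using p
      by (auto simp: *)
    have wp: "wf_path w (pre @ ptens A q B @ post)"
      using w q * by auto
    have t: "tn1 (word_obj A) (eval_path (gword g) q) (word_obj B)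
      \<in> hom V (word_obj A \<otimes> word_obj (gword g) \<otimes> word_obj B)
      (word_obj A \<otimes> word_obj (pcod (gword g) q) \<otimes> word_obj B)"
      using tn1_hom[OF AB eval_path_hom[OF q(1)]] .
    have "eval_path w (pre @ ptens A q B @ post) = eval_path (pcod w pre) (ptens A q B @ post) \<cdot>
      eval_path w pre"
      using eval_path_append wp by blast
    also have "eval_path (pcod w pre) (ptens A q B @ post) = eval_path (A @ pcod (gword g) q @ B)
      post \<cdot> eval_path (pcod w pre) (ptens A q B)"
      using eval_path_append[of "pcod w pre" "ptens A q B" post] wp by (simp add: *)
    also have "eval_path (pcod w pre) (ptens A q B) = tn1 (word_obj A) (eval_path (gword g) q)
      (word_obj B)"
      using eval_path_ptens q * by simp
    finally show ?thesis
      using comp1_assoc[OF k t] h q(2) by simp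
  qed
  show "eval_step w p s \<in> iso_cells V (eval_path w p) (eval_path w (out p s))"
    using whisk_iso[OF g(4) eval_path_hom[OF g(1)] AB k h] eval_step_iff[of w pre A g B post]
    unfolding o using e[OF g(1)] e[OF g(2,3)] by (simp add: * S)
qed

lemma wf_movie_wf_path: "wf_movie w p ss \<Longrightarrow> wf_path w p"
  by (cases ss) auto

lemma eval_movie_facts:
  assumes "wf_movie w p ss"
  shows "wf_path w (outs p ss)" "pcod w (outs p ss) = pcod w p"
    "eval_movie w p ss \<in> iso_cells V (eval_path w p) (eval_path w (outs p ss))"
  using assms
proof (induction ss arbitrary: p)
  case Nil
  { case 1 then show ?case by simp }
  { case 2 then show ?case by simp }
  { case 3 then show ?case by (simp add: id2_iso eval_path_Arr) }
next
  case (Cons s ss)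
  { case 1 then show ?case using Cons by simp }
  { case 2 then show ?case using Cons step_facts by simp }
  { case 3 then show ?case using Cons.IH(3)[of "out p s"] step_facts[of w p s] iso_vcomp by auto }
qed

lemma wf_movie_append [simp]: "wf_movie w p (ss @ tt) \<longleftrightarrow> wf_movie w p ss \<and> wf_movie w (outs p ss) tt"
  by (induction ss arbitrary: p) (auto dest: wf_movie_wf_path)

lemma eval_movie_append:
  "wf_movie w p (ss @ tt) \<Longrightarrow> eval_movie w p (ss @ tt) = eval_movie w (outs p ss) tt
    \<bullet> eval_movie w p ss"
proof (induction ss arbitrary: p)
  case Nil
  then show ?case using eval_movie_facts[of w p tt] vcomp_id_right iso_cellsD by fastforce
next
  case (Cons s ss)
  then have 1: "wf_path w p" "wf_step w p s" "wf_movie w (out p s) ss"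
    "wf_movie w (outs (out p s) ss) tt" by auto
  show ?case
    using vcomp_assoc[OF iso_cellsD[OF step_facts(3)[OF 1(1,2)]]
      iso_cellsD[OF eval_movie_facts(3)[OF 1(3)]]
        iso_cellsD[OF eval_movie_facts(3)[OF 1(4)]]] Cons 1 by simp
qed

lemma eval_movie_single: "wf_movie w p [s] \<Longrightarrow> eval_movie w p [s] = eval_step w p s"
  using step_facts[of w p s] vcomp_id_left iso_cellsD by fastforce

text \<open>Well-formedness and equality of the final paths are included, so that transitivity and
  replacement inside a longer movie need no conditions on the new side.\<close>

definition movie_eq :: "'o list \<Rightarrow> ('o, 'm) layer list \<Rightarrow> ('o, 'm, 'c) step list \<Rightarrow> ('o, 'm, 'c) step
  list \<Rightarrow> bool" where
  "movie_eq w p ss tt \<longleftrightarrow> wf_movie w p ss \<and> wf_movie w p tt \<and> outs p ss = outs p tt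
    \<and> eval_movie w p ss = eval_movie w p tt"

lemma movie_eq_refl: "wf_movie w p ss \<Longrightarrow> movie_eq w p ss ss"
  by (simp add: movie_eq_def)

lemma movie_eq_sym: "movie_eq w p ss tt \<Longrightarrow> movie_eq w p tt ss"
  by (simp add: movie_eq_def)

lemma movie_eq_trans [trans]: "movie_eq w p ss tt \<Longrightarrow> movie_eq w p tt uu \<Longrightarrow> movie_eq w p ss uu"
  by (simp add: movie_eq_def)

lemma movie_eq_append:
  assumes "wf_movie w p ss" "movie_eq w (outs p ss) l r" "wf_movie w (outs (outs p ss) l) tt"
  shows "movie_eq w p (ss @ l @ tt) (ss @ r @ tt)"
  using assms by (auto simp: movie_eq_def eval_movie_append)

text \<open>Middle four interchange: once the path \<open>mid\<close> between the two places is
  absorbed into the later cell, the two cells are horizontally composable and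
  \<open>whisk_exchange\<close> applies. The position of \<open>h\<close> is counted past
  \<open>gtrg g\<close> if \<open>g\<close> acts first, and past \<open>gsrc g\<close>
  otherwise.\<close>

lemma movie_eq_swap2:
  assumes p: "wf_path w p" and d: "p = pre @ ptens A (gsrc g) B @ mid @ ptens A' (gsrc h) B' @ post"
    and g: "wf_gen2 g" "wf_word A" "wf_word B" "pcod w pre = A @ gword g @ B"
    and h: "wf_gen2 h" "wf_word A'" "wf_word B'" "pcod w (pre @ ptens A (gsrc g) B @ mid) = A'
      @ gword h @ B'"
  shows "movie_eq w p [(length pre, A, g, B), (length pre + length (gtrg g) + length mid, A', h,
    B')]
    [(length pre + length (gsrc g) + length mid, A', h, B'), (length pre, A, g, B)]"
proof -
  let ?s = "(length pre, A, g, B)" and ?t = "(length pre + length (gtrg g) + length mid, A', h, B')"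
    and ?t' = "(length pre + length (gsrc g) + length mid, A', h, B')"
  let ?G = "ptens A (gsrc g) B" and ?G' = "ptens A (gtrg g) B" and ?H = "ptens A' (gsrc h) B'"
    and ?H' = "ptens A' (gtrg h) B'"
  let ?w1 = "A @ gword g @ B" and ?w2 = "A @ pcod (gword g) (gsrc g) @ B"
  let ?w3 = "A' @ gword h @ B'" and ?w4 = "A' @ pcod (gword h) (gsrc h) @ B'"
  have G: "wf_path (gword g) (gsrc g)" "wf_path (gword g) (gtrg g)" "pcod (gword g) (gtrg g)
    = pcod (gword g) (gsrc g)"
    "cell2 g \<in> iso_cells V (eval_path (gword g) (gsrc g)) (eval_path (gword g) (gtrg g))"
    using g(1) wf_gen2_iff by auto
  have H: "wf_path (gword h) (gsrc h)" "wf_path (gword h) (gtrg h)" "pcod (gword h) (gtrg h)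
    = pcod (gword h) (gsrc h)"
    "cell2 h \<in> iso_cells V (eval_path (gword h) (gsrc h)) (eval_path (gword h) (gtrg h))"
    using h(1) wf_gen2_iff by auto
  have AB: "word_obj A \<in> Obj V" "word_obj B \<in> Obj V" "word_obj A' \<in> Obj V" "word_obj B' \<in> Obj V"
    using g h word_obj_Obj by auto
  have m: "pcod ?w2 mid = ?w3" using h(4) g(4) by simp
  have pd: "wf_path w (pre @ ?G @ mid @ ?H @ post)" using p d by simp
  have w: "wf_path w pre" "wf_path ?w2 mid" "wf_path ?w4 post"
    using pd m g(4) by auto
  have gw: "wf_word (gword g)" "wf_word (pcod (gword g) (gsrc g))" "wf_word (gword h)"
    "wf_word (pcod (gword h) (gsrc h))"
    using wf_path_wf_word G H by auto
  have s: "wf_step w p ?s" unfolding d using wf_step_iff[of w pre A g B "mid @ ?H @ post"] g by simp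
  have o: "out p ?s = pre @ ?G' @ mid @ ?H @ post" unfolding d by (rule out_iff)
  have t: "wf_step w (out p ?s) ?t"
    unfolding o using wf_step_iff[of w "pre @ ?G' @ mid" A' h B' post] h g G m
      by (simp add: add.assoc)
  have t': "wf_step w p ?t'"
    unfolding d using wf_step_iff[of w "pre @ ?G @ mid" A' h B' post] h g G m
      by (simp add: add.assoc)
  have o': "out p ?t' = pre @ ?G @ mid @ ?H' @ post"
    unfolding d using out_iff[of "pre @ ?G @ mid" A' h B' post] by (simp add: add.assoc)
  have s': "wf_step w (out p ?t') ?s"
    unfolding o' using wf_step_iff[of w pre A g B "mid @ ?H' @ post"] g by simp
  have oo: "out (out p ?s) ?t = pre @ ?G' @ mid @ ?H' @ post"
    unfolding o using out_iff[of "pre @ ?G' @ mid" A' h B' post] by (simp add: add.assoc)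
  have oo': "out (out p ?t') ?s = pre @ ?G' @ mid @ ?H' @ post"
    unfolding o' by (rule out_iff)
  have W: "wf_movie w p [?s, ?t]" "wf_movie w p [?t', ?s]"
    using p s t s' t' step_facts by auto
  define K where "K = eval_path w pre"
  define P where "P = eval_path ?w4 post"
  define M where "M = eval_path ?w2 mid"
  define F where "F = tn1 (word_obj A) (eval_path (gword g) (gsrc g)) (word_obj B)"
  define F' where "F' = tn1 (word_obj A) (eval_path (gword g) (gtrg g)) (word_obj B)"
  define E where "E = tn1 (word_obj A') (eval_path (gword h) (gsrc h)) (word_obj B')"
  define E' where "E' = tn1 (word_obj A') (eval_path (gword h) (gtrg h)) (word_obj B')"
  have K: "K \<in> hom V (word_obj w) (word_obj ?w1)" using eval_path_hom[OF w(1)] g K_def by simp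
  have M: "M \<in> hom V (word_obj ?w2) (word_obj ?w3)" using eval_path_hom[OF w(2)] m M_def by simp
  have P: "P \<in> hom V (word_obj ?w4) (word_obj (pcod ?w4 post))" using eval_path_hom[OF w(3)] P_def
    by simp
  have F: "F \<in> hom V (word_obj ?w1) (word_obj ?w2)" "F' \<in> hom V (word_obj ?w1) (word_obj ?w2)"
    using tn1_hom[OF AB(1,2) eval_path_hom[OF G(1)]] tn1_hom[OF AB(1,2) eval_path_hom[OF G(2)]] G(3)
      gw g
    by (auto simp: F_def F'_def word_obj_append)
  have E: "E \<in> hom V (word_obj ?w3) (word_obj ?w4)" "E' \<in> hom V (word_obj ?w3) (word_obj ?w4)"
    using tn1_hom[OF AB(3,4) eval_path_hom[OF H(1)]] tn1_hom[OF AB(3,4) eval_path_hom[OF H(2)]] H(3)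
      gw h
    by (auto simp: E_def E'_def word_obj_append)
  have x: "tn2 (word_obj A) (cell2 g) (word_obj B) \<in> cells V F F'"
    "tn2 (word_obj A') (cell2 h) (word_obj B') \<in> cells V E E'"
    using tn2_cells[OF AB(1,2)] tn2_cells[OF AB(3,4)] iso_cellsD G(4) H(4)
      unfolding F_def F'_def E_def E'_def by blast+
  have gp: "eval_path ?w1 ?G = F" "eval_path ?w1 ?G' = F'" "eval_path ?w3 ?H = E" "eval_path ?w3 ?H'
    = E'"
    using eval_path_ptens g h G H by (auto simp: F_def F'_def E_def E'_def)
  have pp: "eval_path ?w2 (mid @ q @ post) = P \<cdot> eval_path ?w3 q \<cdot> M" if "wf_path ?w3 q"
    "pcod ?w3 q = ?w4" for q
    using eval_path_append[of ?w2 mid "q @ post"] eval_path_append[of ?w3 q post] that w m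
      comp1_assoc[OF M eval_path_hom[OF that(1)]] P unfolding M_def P_def by simp
  have q1: "wf_path ?w3 ?H" "pcod ?w3 ?H = ?w4" "wf_path ?w3 ?H'" "pcod ?w3 ?H' = ?w4" using h H
    by auto
  have q0: "eval_path w (pre @ q @ mid) = M \<cdot> eval_path ?w1 q \<cdot> K" if "wf_path ?w1 q"
    "pcod ?w1 q = ?w2" for q
    using eval_path_append[of w pre "q @ mid"] eval_path_append[of ?w1 q mid] that w m g
      comp1_assoc[OF K eval_path_hom[OF that(1)]] M unfolding M_def K_def by simp
  have q2: "wf_path ?w1 ?G" "pcod ?w1 ?G = ?w2" "wf_path ?w1 ?G'" "pcod ?w1 ?G' = ?w2" using g G
    by auto
  \<comment> \<open>\<open>x0\<close> is the cell of \<open>g\<close> with everything before it,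
    \<open>y0\<close> the cell of \<open>h\<close> with the path between the two; they are
    composable at the word where \<open>g\<close> ends.\<close>
  define x0 where "x0 = tn2 (word_obj A) (cell2 g) (word_obj B) \<cdot>\<^sub>r K"
  define y0 where "y0 = tn2 (word_obj A') (cell2 h) (word_obj B') \<cdot>\<^sub>r M"
  have x0: "x0 \<in> cells V (F \<cdot> K) (F' \<cdot> K)" using rwhisk_cells[OF x(1) K F(1)] x0_def by simp
  have y0: "y0 \<in> cells V (E \<cdot> M) (E' \<cdot> M)" using rwhisk_cells[OF x(2) M E(1)] y0_def by simp
  note FK = comp1_hom[OF K F(1)] comp1_hom[OF K F(2)]
    and EM = comp1_hom[OF M E(1)] comp1_hom[OF M E(2)]
  have e1: "eval_step w p ?s = P \<cdot>\<^sub>l ((E \<cdot> M) \<cdot>\<^sub>l x0)"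
    unfolding d using eval_step_iff[of w pre A g B "mid @ ?H @ post"] pp[OF q1(1,2)] gp
      lwhisk_lwhisk[OF x0 FK(1) EM(1) P]
    by (simp add: whisk_def x0_def K_def)
  have e4: "eval_step w (out p ?t') ?s = P \<cdot>\<^sub>l ((E' \<cdot> M) \<cdot>\<^sub>l x0)"
    using eval_step_iff[of w pre A g B "mid @ ?H' @ post"] pp[OF q1(3,4)] gp
      lwhisk_lwhisk[OF x0 FK(1) EM(2) P]
    unfolding o' by (simp add: whisk_def x0_def K_def)
  have e2: "eval_step w (out p ?s) ?t = P \<cdot>\<^sub>l (y0 \<cdot>\<^sub>r (F' \<cdot> K))"
    using eval_step_iff[of w "pre @ ?G' @ mid" A' h B' post] q0[OF q2(3,4)] gp
      rwhisk_rwhisk[OF x(2) FK(2) M E(1)]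
    unfolding o by (simp add: whisk_def y0_def P_def add.assoc)
  have e3: "eval_step w p ?t' = P \<cdot>\<^sub>l (y0 \<cdot>\<^sub>r (F \<cdot> K))"
    using eval_step_iff[of w "pre @ ?G @ mid" A' h B' post] q0[OF q2(1,2)] gp
      rwhisk_rwhisk[OF x(2) FK(1) M E(1)]
    unfolding d by (simp add: whisk_def y0_def P_def add.assoc)
  note L = lwhisk_cells[OF x0 FK(1) EM(1)] lwhisk_cells[OF x0 FK(1) EM(2)]
    rwhisk_cells[OF y0 FK(1) EM(1)] rwhisk_cells[OF y0 FK(2) EM(1)]
  have "eval_step w (out p ?s) ?t \<bullet> eval_step w p ?s = eval_step w (out p ?t') ?s
    \<bullet> eval_step w p ?t'"
    unfolding e1 e2 e3 e4
    using lwhisk_vcomp[OF L(1,4) comp1_hom[OF FK(1) EM(1)] P]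
      lwhisk_vcomp[OF L(3,2) comp1_hom[OF FK(1) EM(1)] P]
      whisk_exchange[OF FK(1) EM(1) x0 y0] by simp
  moreover have "eval_movie w p [?s, ?t] = eval_step w (out p ?s) ?t \<bullet> eval_step w p ?s"
    "eval_movie w p [?t', ?s] = eval_step w (out p ?t') ?s \<bullet> eval_step w p ?t'"
    using eval_movie_append[of w p "[?s]" "[?t]"] eval_movie_append[of w p "[?t']" "[?s]"] W
      eval_movie_single by auto
  ultimately show ?thesis
    unfolding movie_eq_def using W oo oo' by simp
qed

end

section \<open>Rewriting movies\<close>

text \<open>
  \<open>Swap k\<close> exchanges steps \<open>k\<close> and \<open>k + 1\<close> if they act on disjoint parts of the path.
  \<open>Rel k i A B r\<close> rewrites with the relation \<open>r\<close> at step \<open>k\<close>, the relation being whiskered with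
  the words \<open>A\<close>, \<open>B\<close> and applied to the layers from number \<open>i\<close> on. A relation is given by a
  word, a path and two movies starting from it.
\<close>

type_synonym ('o, 'm, 'c) relation =
  "'o list \<times> ('o, 'm) layer list \<times> ('o, 'm, 'c) step list \<times> ('o, 'm, 'c) step list"

datatype ('o, 'm, 'c) move = Swap nat | Rel nat nat "'o list" "'o list" "('o, 'm, 'c) relation"

text \<open>Either the second step acts further along the path or it acts nearer to the start. The
  step that lies further along is renumbered by the change of length that the other one causes; the
  guards make the truncated subtractions exact.\<close>

fun swap :: "('o, 'm, 'c) step list \<Rightarrow> ('o, 'm, 'c) step list option" where
  "swap ((i, A, g, B) # (j, A', h, B') # ss) =
    (if i + length (gtrg g) \<le> j
     then Some ((j - length (gtrg g) + length (gsrc g), A', h, B') # (i, A, g, B) # ss)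
     else if j + length (gsrc h) \<le> i
     then Some ((j, A', h, B') # (i - length (gsrc h) + length (gtrg h), A, g, B) # ss)
     else None)"
| "swap ss = None"

text \<open>All tests are syntactic, and a certificate that does not fit yields \<open>None\<close>.
  Well-formedness of the movie is not tested here; it is a hypothesis of
  \<open>move_sound\<close>.\<close>

fun do_move :: "'o list \<Rightarrow> ('o, 'm) layer list \<Rightarrow> ('o, 'm, 'c) step list \<Rightarrow> ('o, 'm, 'c) move
    \<Rightarrow> ('o, 'm, 'c) step list option" where
  "do_move w p ss (Swap k) = map_option (\<lambda>tt. take k ss @ tt) (swap (drop k ss))"
| "do_move w p ss (Rel k i A B (w', p', l, r)) =
    (let q = outs p (take k ss) in
      if i \<le> length q \<and> take (length p') (drop i q) = ptens A p' B \<and> pcod w (take i q) = A @ w' @ B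
        \<and> take (length l) (drop k ss) = shift i A B l
      then Some (take k ss @ shift i A B r @ drop (k + length l) ss) else None)"

fun run :: "'o list \<Rightarrow> ('o, 'm) layer list \<Rightarrow> ('o, 'm, 'c) step list \<Rightarrow> ('o, 'm, 'c) move list
    \<Rightarrow> ('o, 'm, 'c) step list option" where
  "run w p ss [] = Some ss"
| "run w p ss (m # ms) = (case do_move w p ss m of None \<Rightarrow> None | Some tt \<Rightarrow> run w p tt ms)"

context gray_monoid
begin

text \<open>Positions add up and words concatenate because contexts compose: the step inside
  \<open>p'\<close> has its own context, which \<open>whisk_whisk\<close> merges with the context
  given by \<open>pre\<close>, \<open>A\<close>, \<open>B\<close> and \<open>post\<close>.\<close>

lemma shift_step:
  assumes p: "wf_path w (pre @ ptens A p' B @ post)" and w: "pcod w pre = A @ w' @ B"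
    and A: "wf_word A" "wf_word B" and s: "wf_path w' p'" "wf_step w' p' (i, A', g, B')"
  defines "q \<equiv> pre @ ptens A p' B @ post" and "t \<equiv> (length pre + i, A @ A', g, B' @ B)"
  shows "wf_step w q t" "out q t = pre @ ptens A (out p' (i, A', g, B')) B @ post"
    "eval_step w q t = whisk (eval_path (A @ pcod w' p' @ B) post) (word_obj A) (word_obj B)
      (eval_path w pre) (eval_step w' p' (i, A', g, B'))"
proof -
  obtain pre' post' where *: "p' = pre' @ ptens A' (gsrc g) B' @ post'" "length pre' = i"
    "pcod w' pre' = A' @ gword g @ B'" "wf_gen2 g" "wf_word A'" "wf_word B'"
    using s wf_step_E by metis
  have g: "wf_path (gword g) (gsrc g)" "pcod (gword g) (gtrg g) = pcod (gword g) (gsrc g)"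
    "cell2 g \<in> iso_cells V (eval_path (gword g) (gsrc g)) (eval_path (gword g) (gtrg g))"
    using *(4) wf_gen2_iff by auto
  let ?pre = "pre @ ptens A pre' B" and ?post = "ptens A post' B @ post"
  have q: "q = ?pre @ ptens (A @ A') (gsrc g) (B' @ B) @ ?post" "length ?pre = length pre + i"
    using * by (auto simp: q_def)
  have c: "pcod w ?pre = (A @ A') @ gword g @ B' @ B" using w * by simp
  show "wf_step w q t"
    unfolding q(1) t_def q(2)[symmetric] wf_step_iff using * A c by simp
  show "out q t = pre @ ptens A (out p' (i, A', g, B')) B @ post"
    unfolding q(1) t_def q(2)[symmetric] out_iff using out_iff[of pre' A' g B' post'] * by simp
  have wp: "wf_path w pre" "wf_path w' pre'" "wf_path (A' @ pcod (gword g) (gsrc g) @ B') post'"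
      "wf_path (A @ pcod w' p' @ B) post"
    using p s(1) w pcod_ptens[of A w' B p'] by (simp_all add: *(1,3))
  have AB: "word_obj A \<in> Obj V" "word_obj B \<in> Obj V" "word_obj A' \<in> Obj V" "word_obj B' \<in> Obj V"
    using A * word_obj_Obj by auto
  have gw: "wf_word (gword g)" "wf_word (pcod (gword g) (gsrc g))" "wf_word w'"
    "wf_word (pcod w' p')"
    using wf_path_wf_word g(1) s(1) by auto
  have k': "eval_path w' pre' \<in> hom V (word_obj w') (word_obj A' \<otimes> word_obj (gword g) \<otimes> word_obj
    B')"
    using eval_path_hom[OF wp(2)] gw * by (simp add: word_obj_append)
  have h': "eval_path (A' @ pcod (gword g) (gsrc g) @ B') post'
    \<in> hom V (word_obj A' \<otimes> word_obj (pcod (gword g) (gsrc g)) \<otimes> word_obj B')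
    (word_obj (pcod w' p'))"
    using eval_path_hom[OF wp(3)] gw * by (simp add: word_obj_append)
  have k: "eval_path w pre \<in> hom V (word_obj w) (word_obj A \<otimes> word_obj w' \<otimes> word_obj B)"
    using eval_path_hom[OF wp(1)] gw A w by (simp add: word_obj_append)
  have h: "eval_path (A @ pcod w' p' @ B) post
    \<in> hom V (word_obj A \<otimes> word_obj (pcod w' p') \<otimes> word_obj B)
    (word_obj (pcod (A @ pcod w' p' @ B) post))"
    using eval_path_hom[OF wp(4)] gw A by (simp add: word_obj_append)
  have e1: "eval_path w ?pre = tn1 (word_obj A) (eval_path w' pre') (word_obj B) \<cdot> eval_path w pre"
    using eval_path_append[of w pre "ptens A pre' B"] eval_path_ptens[OF A wp(2)] wp A w by simp
  have e2: "eval_path (A @ (A' @ pcod (gword g) (gsrc g) @ B') @ B) ?post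
      = eval_path (A @ pcod w' p' @ B) post \<cdot> tn1 (word_obj A)
        (eval_path (A' @ pcod (gword g) (gsrc g) @ B') post') (word_obj B)"
    using eval_path_append[of "A @ (A' @ pcod (gword g) (gsrc g) @ B') @ B" "ptens A post' B" post]
      eval_path_ptens[OF A wp(3)] wf_path_ptens[OF A wp(3)] pcod_ptens[of A "A'
        @ pcod (gword g) (gsrc g) @ B'" B post'] wp *
    by simp
  have "eval_step w q t = whisk (eval_path ((A @ A') @ pcod (gword g) (gsrc g) @ (B' @ B)) ?post)
    (word_obj (A @ A')) (word_obj (B' @ B)) (eval_path w ?pre) (cell2 g)"
    unfolding q(1) t_def q(2)[symmetric] by (rule eval_step_iff)
  also have "\<dots> = whisk (eval_path (A @ pcod w' p' @ B) post \<cdot> tn1 (word_obj A)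
    (eval_path (A' @ pcod (gword g) (gsrc g) @ B') post') (word_obj B))
      (word_obj A \<otimes> word_obj A') (word_obj B' \<otimes> word_obj B) (tn1 (word_obj A) (eval_path w' pre')
        (word_obj B) \<cdot> eval_path w pre) (cell2 g)"
    using e1 e2 A * by (simp add: word_obj_append)
  also have "\<dots> = whisk (eval_path (A @ pcod w' p' @ B) post) (word_obj A) (word_obj B)
    (eval_path w pre)
      (whisk (eval_path (A' @ pcod (gword g) (gsrc g) @ B') post') (word_obj A') (word_obj B')
        (eval_path w' pre') (cell2 g))"
    using whisk_whisk[OF iso_cellsD[OF g(3)] eval_path_hom[OF g(1)] AB k' h' k h] by simp
  also have "whisk (eval_path (A' @ pcod (gword g) (gsrc g) @ B') post') (word_obj A') (word_obj B')
    (eval_path w' pre') (cell2 g) = eval_step w' p' (i, A', g, B')"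
    using eval_step_iff[of w' pre' A' g B' post'] * by simp
  finally show "eval_step w q t = whisk (eval_path (A @ pcod w' p' @ B) post) (word_obj A)
    (word_obj B) (eval_path w pre) (eval_step w' p' (i, A', g, B'))" .
qed

lemma shift_facts:
  assumes "wf_movie w' p' l" "wf_path w (pre @ ptens A p' B @ post)" "pcod w pre = A @ w' @ B"
    "wf_word A" "wf_word B"
  shows "wf_movie w (pre @ ptens A p' B @ post) (shift (length pre) A B l)"
    "outs (pre @ ptens A p' B @ post) (shift (length pre) A B l) = pre @ ptens A (outs p' l) B
      @ post"
    "eval_movie w (pre @ ptens A p' B @ post) (shift (length pre) A B l)
      = whisk (eval_path (A @ pcod w' p' @ B) post) (word_obj A) (word_obj B) (eval_path w pre)
        (eval_movie w' p' l)"
proof -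
  have "wf_movie w (pre @ ptens A p' B @ post) (shift (length pre) A B l) \<and>
    outs (pre @ ptens A p' B @ post) (shift (length pre) A B l) = pre @ ptens A (outs p' l) B @ post
      \<and>
    eval_movie w (pre @ ptens A p' B @ post) (shift (length pre) A B l)
      = whisk (eval_path (A @ pcod w' p' @ B) post) (word_obj A) (word_obj B) (eval_path w pre)
        (eval_movie w' p' l)"
    using assms
  proof (induction l arbitrary: p')
    case Nil
    then have p': "wf_path w' p'" and w: "wf_path w pre" "wf_path (A @ pcod w' p' @ B) post" by auto
    have AB: "word_obj A \<in> Obj V" "word_obj B \<in> Obj V" using Nil word_obj_Obj by auto
    have w': "wf_word w'" "wf_word (pcod w' p')" using wf_path_wf_word[OF p'] by auto
    have k: "eval_path w pre \<in> hom V (word_obj w) (word_obj A \<otimes> word_obj w' \<otimes> word_obj B)"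
      using eval_path_hom[OF w(1)] Nil w' by (simp add: word_obj_append)
    have h: "eval_path (A @ pcod w' p' @ B) post
      \<in> hom V (word_obj A \<otimes> word_obj (pcod w' p') \<otimes> word_obj B)
      (word_obj (pcod (A @ pcod w' p' @ B) post))"
      using eval_path_hom[OF w(2)] Nil w' by (simp add: word_obj_append)
    have "eval_path w (pre @ ptens A p' B @ post) = eval_path (A @ pcod w' p' @ B) post \<cdot> tn1
      (word_obj A) (eval_path w' p') (word_obj B) \<cdot> eval_path w pre"
      using eval_path_append[of w pre "ptens A p' B @ post"] eval_path_append[of "pcod w pre"
        "ptens A p' B" post]
        eval_path_ptens[OF Nil(4,5) p'] comp1_assoc[OF k tn1_hom[OF AB eval_path_hom[OF p']] h] Nil
          by simp
    then show ?case using Nil whisk_id2[OF eval_path_hom[OF p'] AB k h] by simp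
  next
    case (Cons s l)
    obtain i A' g B' where s: "s = (i, A', g, B')" by (cases s)
    let ?q = "pre @ ptens A p' B @ post" and ?t = "(length pre + i, A @ A', g, B' @ B)"
    have p': "wf_path w' p'" "wf_step w' p' s" "wf_movie w' (out p' s) l" using Cons by auto
    note S = shift_step[OF Cons.prems(2,3,4,5) p'(1) p'(2)[unfolded s], folded s]
    have wq: "wf_path w (out ?q ?t)" using step_facts[OF Cons.prems(2) S(1)] by simp
    note IH = Cons.IH[OF p'(3) wq[unfolded S(2)] Cons.prems(3,4,5)]
    note sf = step_facts[OF p'(1,2)] and lf = eval_movie_facts[OF p'(3)]
    have w: "wf_path w pre" "wf_path (A @ pcod w' p' @ B) post" and w': "wf_word w'"
      "wf_word (pcod w' p')"
      using Cons.prems wf_path_wf_word[OF p'(1)] by auto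
    have AB: "word_obj A \<in> Obj V" "word_obj B \<in> Obj V" using Cons.prems word_obj_Obj by auto
    have k: "eval_path w pre \<in> hom V (word_obj w) (word_obj A \<otimes> word_obj w' \<otimes> word_obj B)"
      using eval_path_hom[OF w(1)] Cons.prems w' by (simp add: word_obj_append)
    have h: "eval_path (A @ pcod w' p' @ B) post
      \<in> hom V (word_obj A \<otimes> word_obj (pcod w' p') \<otimes> word_obj B)
      (word_obj (pcod (A @ pcod w' p' @ B) post))"
      using eval_path_hom[OF w(2)] Cons.prems w' by (simp add: word_obj_append)
    show ?case
      using IH S Cons.prems sf
        whisk_vcomp[OF iso_cellsD[OF sf(3)] iso_cellsD[OF lf(3)] eval_path_hom[OF p'(1)] AB k h]
      by (simp add: s)
  qed
  then show "wf_movie w (pre @ ptens A p' B @ post) (shift (length pre) A B l)"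
    "outs (pre @ ptens A p' B @ post) (shift (length pre) A B l) = pre @ ptens A (outs p' l) B
      @ post"
    "eval_movie w (pre @ ptens A p' B @ post) (shift (length pre) A B l)
      = whisk (eval_path (A @ pcod w' p' @ B) post) (word_obj A) (word_obj B) (eval_path w pre)
        (eval_movie w' p' l)" by auto
qed

text \<open>Replacement in space, as \<open>movie_eq_append\<close> is replacement in time; the two
  together give the soundness of \<open>Rel\<close>.\<close>

lemma movie_eq_shift:
  assumes "movie_eq w' p' l r" "wf_path w (pre @ ptens A p' B @ post)" "pcod w pre = A @ w' @ B"
    "wf_word A" "wf_word B"
  shows "movie_eq w (pre @ ptens A p' B @ post) (shift (length pre) A B l)
    (shift (length pre) A B r)"
  using assms shift_facts[of w' p' l w pre A B post] shift_facts[of w' p' r w pre A B post]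
  by (simp add: movie_eq_def)

fun valid :: "('o, 'm, 'c) relation \<Rightarrow> bool" where "valid (w, p, l, r) \<longleftrightarrow> movie_eq w p l r"

fun move_ok :: "('o, 'm, 'c) move \<Rightarrow> bool" where
  "move_ok (Swap k) \<longleftrightarrow> True"
| "move_ok (Rel k i A B r) \<longleftrightarrow> valid r"

lemma movie_eq_swap:
  assumes d: "wf_movie w p [(i, A, g, B), (j, A', h, B')]" and ij: "i + length (gtrg g) \<le> j"
  shows "movie_eq w p [(i, A, g, B), (j, A', h, B')]
    [(j - length (gtrg g) + length (gsrc g), A', h, B'), (i, A, g, B)]"
proof -
  let ?s = "(i, A, g, B)" and ?t = "(j, A', h, B')"
  have p: "wf_path w p" "wf_step w p ?s" "wf_step w (out p ?s) ?t" using d by auto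
  obtain pre rest where s: "p = pre @ ptens A (gsrc g) B @ rest" "length pre = i"
    "pcod w pre = A @ gword g @ B" "wf_gen2 g" "wf_word A" "wf_word B"
    using wf_step_E[OF p(2)] by metis
  obtain pre' post where t: "out p ?s = pre' @ ptens A' (gsrc h) B' @ post" "length pre' = j"
    "pcod w pre' = A' @ gword h @ B'" "wf_gen2 h" "wf_word A'" "wf_word B'"
    using wf_step_E[OF p(3)] by metis
  have o: "out p ?s = (pre @ ptens A (gtrg g) B) @ rest"
    using out_iff[of pre A g B rest] s by simp
  \<comment> \<open>Both steps split the same intermediate path. By \<open>ij\<close> the layers of
    \<open>h\<close> begin behind those of \<open>gtrg g\<close>, so one splitting refines the other
    and \<open>mid\<close> is the gap.\<close>
  obtain mid where m: "pre' = (pre @ ptens A (gtrg g) B) @ mid" "rest = mid @ ptens A' (gsrc h) B'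
    @ post"
  proof
    have "length (pre @ ptens A (gtrg g) B) \<le> length pre'" using t(2) s(2) ij by simp
    then show "pre' = (pre @ ptens A (gtrg g) B) @ drop (length (pre @ ptens A (gtrg g) B)) pre'"
      "rest = drop (length (pre @ ptens A (gtrg g) B)) pre' @ ptens A' (gsrc h) B' @ post"
      using t(1)[unfolded o] by (metis append_eq_append_conv_if append_take_drop_id)+
  qed
  have G: "pcod (gword g) (gtrg g) = pcod (gword g) (gsrc g)" using s(4) wf_gen2_iff by auto
  have "pcod w (pre @ ptens A (gsrc g) B @ mid) = A' @ gword h @ B'" using t(3) s G by (simp add: m)
  from movie_eq_swap2[OF p(1) s(1)[unfolded m(2)] s(4,5,6,3) t(4,5,6) this]
  have "movie_eq w p [(i, A, g, B), (i + length (gtrg g) + length mid, A', h, B')]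
    [(i + length (gsrc g) + length mid, A', h, B'), (i, A, g, B)]" by (simp add: s(2))
  moreover have "j = i + length (gtrg g) + length mid" using t(2) s(2) m by simp
  ultimately show ?thesis by (simp add: add.commute add.left_commute)
qed

text \<open>This is \<open>movie_eq_swap2\<close> read from right to left, with \<open>h\<close> in
  the place nearer to the start.\<close>

lemma movie_eq_swap':
  assumes d: "wf_movie w p [(i, A, g, B), (j, A', h, B')]" and ij: "j + length (gsrc h) \<le> i"
  shows "movie_eq w p [(i, A, g, B), (j, A', h, B')]
    [(j, A', h, B'), (i - length (gsrc h) + length (gtrg h), A, g, B)]"
proof -
  let ?s = "(i, A, g, B)" and ?t = "(j, A', h, B')"
  have p: "wf_path w p" "wf_step w p ?s" "wf_step w (out p ?s) ?t" using d by auto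
  obtain pre' rest where s: "p = pre' @ ptens A (gsrc g) B @ rest" "length pre' = i"
    "pcod w pre' = A @ gword g @ B" "wf_gen2 g" "wf_word A" "wf_word B"
    using wf_step_E[OF p(2)] by metis
  obtain pre post where t: "out p ?s = pre @ ptens A' (gsrc h) B' @ post" "length pre = j"
    "pcod w pre = A' @ gword h @ B'" "wf_gen2 h" "wf_word A'" "wf_word B'"
    using wf_step_E[OF p(3)] by metis
  have o: "out p ?s = pre' @ ptens A (gtrg g) B @ rest"
    using out_iff[of pre' A g B rest] s by simp
  obtain mid where m: "pre' = (pre @ ptens A' (gsrc h) B') @ mid"
  proof
    have "length pre + length (ptens A' (gsrc h) B') \<le> length pre'" using t s ij by simp
    then have "take (length pre + length (ptens A' (gsrc h) B')) pre' = pre @ ptens A' (gsrc h) B'"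
      using t(1)[unfolded o]
        by (metis append.assoc append_eq_append_conv_if length_append take_all_iff
          append_take_drop_id)
    then show "pre' = (pre @ ptens A' (gsrc h) B')
      @ drop (length pre + length (ptens A' (gsrc h) B')) pre'"
      by (metis append_take_drop_id)
  qed
  have p': "p = pre @ ptens A' (gsrc h) B' @ mid @ ptens A (gsrc g) B @ rest" using s m by simp
  have "pcod w (pre @ ptens A' (gsrc h) B' @ mid) = A @ gword g @ B" using s m by simp
  note movie_eq_sym[OF movie_eq_swap2[OF p(1) p' t(4,5,6,3) s(4,5,6) this]]
  moreover have "length pre + length (gsrc h) + length mid = i"
    "length pre + length (gtrg h) + length mid = i - length (gsrc h) + length (gtrg h)"
    using s(2) m by auto
  ultimately show ?thesis using t(2) by simp
qed

lemma wf_path_mid: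
  assumes "wf_path w q" "i \<le> length q" "take (length p') (drop i q) = ptens A p' B"
    "pcod w (take i q) = A @ w' @ B"
  obtains pre post where "q = pre @ ptens A p' B @ post" "length pre = i" "pcod w pre = A @ w' @ B"
    "wf_word A" "wf_word B"
proof
  show q: "q = take i q @ ptens A p' B @ drop (i + length p') q"
    using assms by (metis add.commute append_take_drop_id drop_drop)
  have "wf_path w (take i q @ ptens A p' B @ drop (i + length p') q)" using q assms by simp
  then have "wf_path w (take i q)" by auto
  then have "wf_word (A @ w' @ B)" using wf_path_wf_word assms by metis
  then show "wf_word A" "wf_word B" by auto
qed (use assms in auto)

lemma move_sound:
  assumes ss: "wf_movie w p ss" and m: "do_move w p ss m = Some tt" and ok: "move_ok m"
  shows "movie_eq w p ss tt"
proof (cases m)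
  case (Swap k)
  have kss: "ss = take k ss @ drop k ss" by simp
  have "\<exists>uu. swap (drop k ss) = Some uu \<and> tt = take k ss @ uu" using m Swap by auto
  then obtain uu where uu: "swap (drop k ss) = Some uu" "tt = take k ss @ uu" by auto
  obtain i A g B j A' h B' rest where d: "drop k ss = (i, A, g, B) # (j, A', h, B') # rest"
    using uu(1) by (cases "drop k ss" rule: swap.cases) auto
  have "wf_movie w p (take k ss @ [(i, A, g, B), (j, A', h, B')] @ rest)"
    using ss kss d by (metis append.simps)
  then have w: "wf_movie w p (take k ss)"
    "wf_movie w (outs p (take k ss)) [(i, A, g, B), (j, A', h, B')]"
    "wf_movie w (outs (outs p (take k ss)) [(i, A, g, B), (j, A', h, B')]) rest"
    by (auto simp only: wf_movie_append)
  obtain s t where u: "uu = [s, t] @ rest"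
    "movie_eq w (outs p (take k ss)) [(i, A, g, B), (j, A', h, B')] [s, t]"
    using uu(1) movie_eq_swap[OF w(2)] movie_eq_swap'[OF w(2)] by (auto simp: d split: if_splits)
  have "movie_eq w p (take k ss @ [(i, A, g, B), (j, A', h, B')] @ rest) (take k ss @ [s, t]
    @ rest)"
    by (rule movie_eq_append[OF w(1) u(2) w(3)])
  moreover have "take k ss @ [(i, A, g, B), (j, A', h, B')] @ rest = ss" using kss d by simp
  ultimately show ?thesis using uu u by simp
next
  case (Rel k i A B r)
  obtain w' p' l r' where r: "r = (w', p', l, r')" by (cases r)
  define q where "q = outs p (take k ss)"
  have *: "i \<le> length q" "take (length p') (drop i q) = ptens A p' B" "pcod w (take i q) = A @ w'
    @ B"
    "take (length l) (drop k ss) = shift i A B l" "tt = take k ss @ shift i A B r'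
      @ drop (k + length l) ss"
    using m by (auto simp: Rel r Let_def q_def split: if_splits)
  have s: "ss = take k ss @ shift i A B l @ drop (k + length l) ss"
    using *(4) by (metis add.commute append_take_drop_id drop_drop)
  have "wf_movie w p (take k ss @ shift i A B l @ drop (k + length l) ss)" using s ss by simp
  then have w: "wf_movie w p (take k ss)" "wf_movie w q (shift i A B l)"
    "wf_movie w (outs q (shift i A B l)) (drop (k + length l) ss)"
    unfolding q_def by (auto simp only: wf_movie_append)
  obtain pre post where q: "q = pre @ ptens A p' B @ post" "length pre = i" "pcod w pre = A @ w'
    @ B" "wf_word A" "wf_word B"
    using wf_path_mid[OF wf_movie_wf_path[OF w(2)] *(1,2,3)] by metis
  have "movie_eq w q (shift i A B l) (shift i A B r')"
    using movie_eq_shift[of w' p' l r' w pre A B post] ok wf_movie_wf_path[OF w(2)] q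
      by (simp add: Rel r)
  from movie_eq_append[OF w(1) this[unfolded q_def] w(3)[unfolded q_def]] show ?thesis using s *(5)
    by simp
qed

lemma run_sound:
  "wf_movie w p ss \<Longrightarrow> run w p ss ms = Some tt \<Longrightarrow> list_all move_ok ms \<Longrightarrow> movie_eq w p ss tt"
proof (induction ms arbitrary: ss)
  case Nil
  then show ?case by (simp add: movie_eq_refl)
next
  case (Cons m ms)
  obtain uu where u: "do_move w p ss m = Some uu" "run w p uu ms = Some tt"
    using Cons.prems by (auto split: option.splits)
  have 1: "movie_eq w p ss uu" using move_sound[OF Cons.prems(1) u(1)] Cons.prems by simp
  then have "movie_eq w p uu tt" using Cons.IH[OF _ u(2)] Cons.prems by (simp add: movie_eq_def)
  with 1 show ?case by (rule movie_eq_trans)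
qed

section \<open>Cells represented by movies\<close>

text \<open>These predicates form a translation calculus: applied backwards, the rules that follow
  descend along a term and compute the word, path and movie that represent it, checking the typing
  on the way.\<close>

definition rep_obj where "rep_obj A w \<longleftrightarrow> wf_word w \<and> A = word_obj w"
definition rep_path where "rep_path f w p \<longleftrightarrow> wf_path w p \<and> f = eval_path w p"
definition rep_layer where "rep_layer f l \<longleftrightarrow> wf_layer l \<and> f = eval_layer l"
definition rep_cell where "rep_cell x w p ss \<longleftrightarrow> wf_movie w p ss \<and> x = eval_movie w p ss"

lemma rep_obj_word_obj: "wf_word w \<Longrightarrow> rep_obj (word_obj w) w" by (simp add: rep_obj_def)
lemma rep_obj_single: "A \<in> Obj V \<Longrightarrow> rep_obj A [A]" by (simp add: rep_obj_def unit_right0)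
lemma rep_obj_tens: "rep_obj A v \<Longrightarrow> rep_obj B w \<Longrightarrow> rep_obj (A \<otimes> B) (v @ w)"
  by (simp add: rep_obj_def word_obj_append)
lemma rep_obj_unit: "rep_obj \<one> []" by (simp add: rep_obj_def)

lemma rep_layer_arr: "wf_gen1 f \<Longrightarrow> rep_layer (arr1 f) ([], f, [])"
  by (auto simp: rep_layer_def wf_gen1_def tn1_unit dest: homD)
lemma rep_layer_eval_layer: "wf_layer l \<Longrightarrow> rep_layer (eval_layer l) l"
  by (simp add: rep_layer_def)
lemma eval_layer_tn1: "wf_layer (A', f, B') \<Longrightarrow> wf_word A \<Longrightarrow> wf_word B \<Longrightarrow>
  tn1 (word_obj A) (eval_layer (A', f, B')) (word_obj B) = eval_layer (A @ A', f, B' @ B)"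
  by (auto simp: wf_gen1_def tn1_tn1 word_obj_append word_obj_Obj dest: homD)
lemma tn1_left: "A \<in> Obj V \<Longrightarrow> f \<in> Arr V \<Longrightarrow> A \<lhd> f = tn1 A f \<one>"
  by (simp add: tn1_def unit_right1)
lemma rtens_Arr: "f \<in> Arr V \<Longrightarrow> B \<in> Obj V \<Longrightarrow> f \<rhd> B \<in> Arr V"
  using two_endofunctor.F1_hom[OF rtens_functor, of B f "dom1 V f" "cod1 V f"]
    by (auto simp: hom_def)
lemma tn1_right: "B \<in> Obj V \<Longrightarrow> f \<in> Arr V \<Longrightarrow> f \<rhd> B = tn1 \<one> f B"
  by (simp add: tn1_def unit_left1 rtens_Arr)
lemma rtens_Cell: "x \<in> Cell V \<Longrightarrow> B \<in> Obj V \<Longrightarrow> x \<unrhd> B \<in> Cell V"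
  using two_endofunctor.F2_cells[OF rtens_functor, of B x "src2 V x" "trg2 V x"]
    by (auto simp: cells_def)
lemma tn2_left: "A \<in> Obj V \<Longrightarrow> x \<in> Cell V \<Longrightarrow> A \<unlhd> x = tn2 A x \<one>"
  by (simp add: tn2_def unit_right2)
lemma tn2_right: "B \<in> Obj V \<Longrightarrow> x \<in> Cell V \<Longrightarrow> x \<unrhd> B = tn2 \<one> x B"
  by (simp add: tn2_def unit_left2 rtens_Cell)
lemma eval_layer_Arr: "wf_layer l \<Longrightarrow> eval_layer l \<in> Arr V"
  using eval_layer_hom homD by blast

lemma rep_layer_ltens: "rep_obj A v \<Longrightarrow> rep_layer f (A', g, B') \<Longrightarrow> rep_layer (A \<lhd> f) (v @ A', g, B')"
  using tn1_left[of "word_obj v" "eval_layer (A', g, B')"] eval_layer_tn1[of A' g B' v "[]"]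
    eval_layer_Arr[of "(A', g, B')"] word_obj_Obj[of v]
  by (simp add: rep_obj_def rep_layer_def)
lemma rep_layer_rtens: "rep_layer f (A', g, B') \<Longrightarrow> rep_obj B w \<Longrightarrow> rep_layer (f \<rhd> B) (A', g, B' @ w)"
  using tn1_right[of "word_obj w" "eval_layer (A', g, B')"] eval_layer_tn1[of A' g B' "[]" w]
    eval_layer_Arr[of "(A', g, B')"] word_obj_Obj[of w]
  by (simp add: rep_obj_def rep_layer_def)

lemma rep_path_layer: "rep_layer f l \<Longrightarrow> rep_path f (ldom l) [l]"
  using eval_path_single[of l "ldom l"]
    by (cases l) (auto simp: rep_layer_def rep_path_def wf_gen1_def)
lemma rep_path_comp: "rep_path f w p \<Longrightarrow> rep_path g w' q \<Longrightarrow> w' = pcod w p \<Longrightarrow> rep_path (g \<cdot> f) w (p @ q)"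
  by (simp add: rep_path_def eval_path_append)
lemma rep_path_id: "rep_obj A w \<Longrightarrow> rep_path (id1 V A) w []"
  by (simp add: rep_path_def rep_obj_def)
lemma rep_path_ltens: "rep_obj A v \<Longrightarrow> rep_path f w p \<Longrightarrow> rep_path (A \<lhd> f) (v @ w) (ptens v p [])"
  using tn1_left[of "word_obj v" f] eval_path_ptens[of v "[]" w p] wf_path_ptens[of v "[]" w p]
    eval_path_Arr[of w p] word_obj_Obj[of v]
  by (simp add: rep_obj_def rep_path_def)
lemma rep_path_rtens: "rep_path f w p \<Longrightarrow> rep_obj B v \<Longrightarrow> rep_path (f \<rhd> B) (w @ v) (ptens [] p v)"
  using tn1_right[of "word_obj v" f] eval_path_ptens[of "[]" v w p] wf_path_ptens[of "[]" v w p]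
    eval_path_Arr[of w p] word_obj_Obj[of v]
  by (simp add: rep_obj_def rep_path_def)

lemma rep_vcomp: "rep_cell x w p ss \<Longrightarrow> rep_cell y w' p' tt \<Longrightarrow> w' = w \<Longrightarrow> p' = outs p ss \<Longrightarrow>
  rep_cell (y \<bullet> x) w p (ss @ tt)"
  by (simp add: rep_cell_def eval_movie_append)

lemma rep_id2: "rep_path f w p \<Longrightarrow> rep_cell (id2 V f) w p []"
  by (simp add: rep_cell_def rep_path_def)

lemma rep_whisk:
  assumes x: "rep_cell x w p ss" and A: "wf_word A" "wf_word B" and q: "wf_path w' pre"
    "pcod w' pre = A @ w @ B"
    and h: "wf_path (A @ pcod w p @ B) post"
  shows "rep_cell (whisk (eval_path (A @ pcod w p @ B) post) (word_obj A) (word_obj B)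
    (eval_path w' pre) x) w'
    (pre @ ptens A p B @ post) (shift (length pre) A B ss)"
proof -
  have "wf_path w' (pre @ ptens A p B @ post)"
    using q h A x by (auto simp: rep_cell_def dest!: wf_movie_wf_path)
  from shift_facts[OF _ this q(2) A, of ss] x show ?thesis by (simp add: rep_cell_def)
qed

lemma rep_cells: "rep_cell x w p ss \<Longrightarrow> x \<in> cells V (eval_path w p) (eval_path w (outs p ss))"
  using eval_movie_facts(3) iso_cellsD by (auto simp: rep_cell_def)

lemma whisk_lwhisk:
  assumes "x \<in> cells V f f'" "f \<in> hom V P Q" "h \<in> hom V Q R"
  shows "whisk h \<one> \<one> (id1 V P) x = h \<cdot>\<^sub>l x"
  using assms tn2_unit[of x] rwhisk_id1[OF assms(1,2)] by (simp add: whisk_def cells_def)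

lemma whisk_rwhisk:
  assumes "x \<in> cells V f f'" "f \<in> hom V P Q" "k \<in> hom V D P"
  shows "whisk (id1 V Q) \<one> \<one> k x = x \<cdot>\<^sub>r k"
  using assms tn2_unit[of x] lwhisk_id1[OF rwhisk_cells[OF assms(1,3,2)] comp1_hom[OF assms(3,2)]]
  by (simp add: whisk_def cells_def)

lemma whisk_tens:
  assumes x: "x \<in> cells V f f'" and f: "f \<in> hom V P Q" and AB: "A \<in> Obj V" "B \<in> Obj V"
  shows "whisk (id1 V (A \<otimes> Q \<otimes> B)) A B (id1 V (A \<otimes> P \<otimes> B)) x = tn2 A x B"
  using lwhisk_id1[OF tn2_cells[OF AB x] tn1_hom[OF AB f]]
    rwhisk_id1[OF tn2_cells[OF AB x] tn1_hom[OF AB f]]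
  by (simp add: whisk_def)

lemma rep_lwhisk:
  assumes f: "rep_path f w' q" and x: "rep_cell x w p ss" and w: "w' = pcod w p"
  shows "rep_cell (f \<cdot>\<^sub>l x) w (p @ q) ss"
proof -
  have p: "wf_path w p" using x wf_movie_wf_path by (auto simp: rep_cell_def)
  have s: "shift 0 [] [] ss = ss" by (auto simp: shift_def)
  show ?thesis
    using rep_whisk[OF x, of "[]" "[]" w "[]" q] whisk_lwhisk[OF rep_cells[OF x] eval_path_hom[OF p]
      eval_path_hom[of w' q, unfolded w]] f w wf_path_wf_word[OF p]
    by (simp add: rep_path_def s)
qed

lemma rep_rwhisk:
  assumes x: "rep_cell x w p ss" and f: "rep_path f w' q" and w: "w = pcod w' q"
  shows "rep_cell (x \<cdot>\<^sub>r f) w' (q @ p) (shift (length q) [] [] ss)"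
proof -
  have p: "wf_path w p" using x wf_movie_wf_path by (auto simp: rep_cell_def)
  show ?thesis
    using rep_whisk[OF x, of "[]" "[]" w' q "[]"]
      whisk_rwhisk[OF rep_cells[OF x] eval_path_hom[OF p] eval_path_hom[of w' q, folded w]] f w
      wf_path_wf_word[OF p]
    by (simp add: rep_path_def)
qed

lemma rep_tens:
  assumes x: "rep_cell x w p ss" and A: "wf_word A" "wf_word B"
  shows "rep_cell (tn2 (word_obj A) x (word_obj B)) (A @ w @ B) (ptens A p B) (shift 0 A B ss)"
proof -
  have p: "wf_path w p" using x wf_movie_wf_path by (auto simp: rep_cell_def)
  show ?thesis
    using rep_whisk[OF x A, of "A @ w @ B" "[]" "[]"]
      whisk_tens[OF rep_cells[OF x] eval_path_hom[OF p], of "word_obj A" "word_obj B"]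
      wf_path_wf_word[OF p] A
    by (simp add: word_obj_append word_obj_Obj)
qed

lemma rep_ltens: "rep_obj A v \<Longrightarrow> rep_cell x w p ss \<Longrightarrow> rep_cell (A \<unlhd> x) (v @ w) (ptens v p [])
  (shift 0 v [] ss)"
  using rep_tens[of x w p ss v "[]"] tn2_left[of "word_obj v" x] word_obj_Obj[of v]
    rep_cells[of x w p ss]
  by (simp add: rep_obj_def cells_def)

lemma rep_rtens: "rep_cell x w p ss \<Longrightarrow> rep_obj A v \<Longrightarrow> rep_cell (x \<unrhd> A) (w @ v) (ptens [] p v)
  (shift 0 [] v ss)"
  using rep_tens[of x w p ss "[]" v] tn2_right[of "word_obj v" x] word_obj_Obj[of v]
    rep_cells[of x w p ss]
  by (simp add: rep_obj_def cells_def)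

text \<open>A movie performs one step at a time. The convention is that the right factor
  \<open>x\<close> acts first, so the layers of \<open>y\<close> are found behind those of
  \<open>outs p ss\<close>, not behind those of \<open>p\<close>.\<close>

lemma rep_hcomp:
  assumes y: "rep_cell y w' q tt" and x: "rep_cell x w p ss" and w: "w' = pcod w p"
  shows "rep_cell (y \<star> x) w (p @ q) (ss @ shift (length (outs p ss)) [] [] tt)"
proof -
  have p: "wf_path w p" "wf_path w' q" using x y wf_movie_wf_path by (auto simp: rep_cell_def)
  have d: "wf_movie w p ss" using x rep_cell_def by blast
  note o = eval_movie_facts[OF d]
  have r1: "rep_cell (eval_path w' q \<cdot>\<^sub>l x) w (p @ q) ss"
    by (rule rep_lwhisk) (use x p w in \<open>auto simp: rep_path_def\<close>)
  have r2: "rep_cell (y \<cdot>\<^sub>r eval_path w (outs p ss)) w (outs p ss @ q)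
    (shift (length (outs p ss)) [] [] tt)"
    by (rule rep_rwhisk) (use y o w in \<open>auto simp: rep_path_def\<close>)
  have s: "shift 0 [] [] ss = ss" by (auto simp: shift_def)
  have "outs (p @ q) ss = outs p ss @ q"
    using shift_facts(2)[OF d, of w "[]" "[]" "[]" q] p w s by (simp add: wf_path_wf_word)
  then have "rep_cell ((y \<cdot>\<^sub>r eval_path w (outs p ss)) \<bullet> (eval_path w' q \<cdot>\<^sub>l x)) w (p @ q)
    (ss @ shift (length (outs p ss)) [] [] tt)"
    by (intro rep_vcomp[OF r1 r2]) auto
  then show ?thesis
    using hcomp_whisk(1)[OF eval_path_hom[OF p(1)] eval_path_hom[OF p(2), unfolded w]
      rep_cells[OF x] rep_cells[OF y, unfolded w]] w by simp
qed

section \<open>Inverses of generators and movies\<close>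

fun invg :: "('o, 'm, 'c) gen2 \<Rightarrow> ('o, 'm, 'c) gen2" where
  "invg (Gen2 x w p q) = Gen2 (inv2 V x) w q p"

lemma invg_simps [simp]: "gword (invg g) = gword g" "gsrc (invg g) = gtrg g"
  "gtrg (invg g) = gsrc g"
  by (cases g; simp)+

lemma wf_gen2_invg [simp]: "wf_gen2 g \<Longrightarrow> wf_gen2 (invg g)"
  by (cases g) (auto intro: inv2_iso)

lemma rep_gen:
  assumes "wf_gen2 (Gen2 x w p q)" shows "rep_cell x w p [(0, [], Gen2 x w p q, [])]"
proof -
  have *: "wf_path w p" "wf_path w q" "pcod w p = pcod w q"
    "x \<in> iso_cells V (eval_path w p) (eval_path w q)"
    using assms by auto
  have d: "wf_movie w p [(0, [], Gen2 x w p q, [])]"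
    using assms * wf_path_wf_word[OF *(1)] by (auto simp: wf_step.simps out.simps)
  have "eval_step w p (0, [], Gen2 x w p q, []) = whisk (eval_path (pcod w p) []) \<one> \<one>
    (eval_path w []) x"
    by (simp add: eval_step.simps)
  also have "\<dots> = eval_path (pcod w p) [] \<cdot>\<^sub>l x"
    using whisk_lwhisk[OF iso_cellsD[OF *(4)] eval_path_hom[OF *(1)]] eval_path_hom[of "pcod w p"
      "[]"] wf_path_wf_word[OF *(1)] by simp
  also have "\<dots> = x" using lwhisk_id1[OF iso_cellsD[OF *(4)] eval_path_hom[OF *(1)]] by simp
  finally show ?thesis using d eval_movie_single[OF d] by (simp add: rep_cell_def)
qed

lemma rep_gen2: "wf_gen2 g \<Longrightarrow> rep_cell (cell2 g) (gword g) (gsrc g) [(0, [], g, [])]"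
  by (cases g) (use rep_gen in auto)

lemma movie_eq_inv_gen: "wf_gen2 g \<Longrightarrow> movie_eq (gword g) (gsrc g)
  [(0, [], g, []), (0, [], invg g, [])] []"
proof (cases g)
  case (Gen2 x w p q)
  assume g: "wf_gen2 g"
  have *: "x \<in> iso_cells V (eval_path w p) (eval_path w q)" "wf_path w p" using g Gen2 by auto
  have o: "out p (0, [], g, []) = q" using Gen2 by (simp add: out.simps)
  have "rep_cell (inv2 V x \<bullet> x) w p ([(0, [], g, [])] @ [(0, [], invg g, [])])"
    using rep_vcomp[OF rep_gen2[OF g] rep_gen2[OF wf_gen2_invg[OF g]]] Gen2 o by simp
  moreover have "rep_cell (inv2 V x \<bullet> x) w p []"
    using inv2_vcomp(1)[OF *(1)] rep_id2[of "eval_path w p" w p] *(2) by (simp add: rep_path_def)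
  ultimately show ?thesis using Gen2 by (simp add: rep_cell_def movie_eq_def out.simps)
qed

lemma movie_eq_inv_gen': "wf_gen2 g \<Longrightarrow> movie_eq (gword g) (gtrg g) [(0, [], invg g, []),
  (0, [], g, [])] []"
proof (cases g)
  case (Gen2 x w p q)
  assume g: "wf_gen2 g"
  have *: "x \<in> iso_cells V (eval_path w p) (eval_path w q)" "wf_path w q" using g Gen2 by auto
  have o: "out q (0, [], invg g, []) = p" using Gen2 by (simp add: out.simps)
  have "rep_cell (x \<bullet> inv2 V x) w q ([(0, [], invg g, [])] @ [(0, [], g, [])])"
    using rep_vcomp[OF rep_gen2[OF wf_gen2_invg[OF g]] rep_gen2[OF g]] Gen2 o by simp
  moreover have "rep_cell (x \<bullet> inv2 V x) w q []"
    using inv2_vcomp(2)[OF *(1)] rep_id2[of "eval_path w q" w q] *(2) by (simp add: rep_path_def)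
  ultimately show ?thesis using Gen2 by (simp add: rep_cell_def movie_eq_def out.simps)
qed

fun invs :: "('o, 'm, 'c) step list \<Rightarrow> ('o, 'm, 'c) step list" where
  "invs [] = []"
| "invs ((i, A, g, B) # ss) = invs ss @ [(i, A, invg g, B)]"

lemma invs_facts:
  assumes "wf_movie w p ss"
  shows "wf_movie w (outs p ss) (invs ss) \<and> outs (outs p ss) (invs ss) = p
    \<and> movie_eq w p (ss @ invs ss) []"
  using assms
proof (induction ss arbitrary: p)
  case Nil
  then show ?case by (simp add: movie_eq_refl)
next
  case (Cons s ss)
  obtain i A g B where s: "s = (i, A, g, B)" by (cases s)
  have p: "wf_path w p" "wf_step w p s" "wf_movie w (out p s) ss" using Cons by auto
  obtain pre post where *: "p = pre @ ptens A (gsrc g) B @ post" "length pre = i"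
    "pcod w pre = A @ gword g @ B" "wf_gen2 g" "wf_word A" "wf_word B"
    using p(2) s wf_step_E by metis
  have o: "out p s = pre @ ptens A (gtrg g) B @ post" using out_iff[of pre A g B post] * s by simp
  have o': "out (out p s) (i, A, invg g, B) = p"
    unfolding o using out_iff[of pre A "invg g" B post] * by simp
  have e: "movie_eq w p [s, (i, A, invg g, B)] []"
    using movie_eq_shift[OF movie_eq_inv_gen[OF *(4)], of w pre A B post] * p(1) s by simp
  have st: "wf_step w (out p s) (i, A, invg g, B)"
    unfolding o using wf_step_iff[of w pre A "invg g" B post] * by simp
  note IH = Cons.IH[OF p(3)]
  have "movie_eq w p ([s] @ (ss @ invs ss) @ [(i, A, invg g, B)]) ([s] @ [] @ [(i, A, invg g, B)])"
    by (rule movie_eq_append) (use p IH st o' step_facts[OF p(1,2)] in \<open>auto simp: movie_eq_def\<close>)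
  then have "movie_eq w p ((s # ss) @ invs (s # ss)) []" using e s by (auto simp: movie_eq_def)
  then show ?case using IH st o' p step_facts[OF p(1,2)] by (auto simp: s)
qed

lemma movie_eq_invs: "wf_movie w p ss \<Longrightarrow> movie_eq w p (ss @ invs ss) []"
  using invs_facts by blast

text \<open>The backward movie is a left inverse by \<open>invs_facts\<close>, and a left inverse of
  an invertible cell agrees with \<open>inv2\<close>.\<close>

lemma rep_inv: assumes x: "rep_cell x w p ss" shows "rep_cell (inv2 V x) w (outs p ss) (invs ss)"
proof -
  have d: "wf_movie w p ss" "x = eval_movie w p ss" using x by (auto simp: rep_cell_def)
  note i = invs_facts[OF d(1)]
  note f = eval_movie_facts[OF d(1)] and f' = eval_movie_facts[OF conjunct1[OF i]]
  have c: "eval_movie w p ss \<in> iso_cells V (eval_path w p) (eval_path w (outs p ss))"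
    "eval_movie w (outs p ss) (invs ss) \<in> iso_cells V (eval_path w (outs p ss)) (eval_path w p)"
      using f f' i by auto
  have e: "eval_movie w (outs p ss) (invs ss) \<bullet> eval_movie w p ss = id2 V (eval_path w p)"
    using i eval_movie_append[of w p ss "invs ss"] by (auto simp: movie_eq_def)
  have "inv2 V (eval_movie w p ss) = (eval_movie w (outs p ss) (invs ss) \<bullet> eval_movie w p ss)
    \<bullet> inv2 V (eval_movie w p ss)"
    using e vcomp_id_left[OF iso_cellsD[OF inv2_iso[OF c(1)]]] by simp
  also have "\<dots> = eval_movie w (outs p ss) (invs ss)"
    using vcomp_assoc[OF iso_cellsD[OF inv2_iso[OF c(1)]] iso_cellsD[OF c(1)] iso_cellsD[OF c(2)]]
      inv2_vcomp(2)[OF c(1)] vcomp_id_right[OF iso_cellsD[OF c(2)]] by simp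
  finally show ?thesis using i d by (simp add: rep_cell_def)
qed

lemma rep_movie_eq: "x = y \<Longrightarrow> rep_cell x w p ss \<Longrightarrow> rep_cell y w p tt \<Longrightarrow> outs p ss = outs p tt \<Longrightarrow>
  movie_eq w p ss tt"
  by (simp add: rep_cell_def movie_eq_def)

lemma eq_of_movie_eq: "movie_eq w p ss tt \<Longrightarrow> rep_cell x w p ss \<Longrightarrow> rep_cell y w p tt \<Longrightarrow> x = y"
  by (simp add: rep_cell_def movie_eq_def)

text \<open>Leaves \<open>w'\<close>, \<open>p'\<close> and \<open>ss'\<close> open for the
  translation rules to fill in; the comparison with the expected lists comes afterwards.\<close>

lemma rep_conv: "rep_cell x w' p' ss' \<Longrightarrow> w' = w \<Longrightarrow> p' = p \<Longrightarrow> ss' = ss \<Longrightarrow> rep_cell x w p ss"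
  by simp

lemma rep_path_conv: "rep_path f w' p' \<Longrightarrow> w' = w \<Longrightarrow> p' = p \<Longrightarrow> rep_path f w p"
  by simp

text \<open>The word \<open>C\<close> is the gap between \<open>f\<close> and \<open>g\<close>. By
  the associativity axioms of the interchanger, objects in the gap can be moved to the side of
  \<open>g\<close> and outer objects can be tensored on, so this form covers the interchanger of any
  two layers (\<open>rep_Sigma\<close>).\<close>

definition Sig where
  "Sig f C g = Gen2 (\<Sigma> (arr1 f) (word_obj C \<lhd> arr1 g)) (gdom f @ C @ gdom g)
     [(gdom f @ C, g, []), ([], f, C @ gcod g)] [([], f, C @ gdom g), (gcod f @ C, g, [])]"

lemma Sig_simps [simp]: "gword (Sig f C g) = gdom f @ C @ gdom g"
  "gsrc (Sig f C g) = [(gdom f @ C, g, []), ([], f, C @ gcod g)]"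
  "gtrg (Sig f C g) = [([], f, C @ gdom g), (gcod f @ C, g, [])]"
  by (auto simp: Sig_def)

lemma wf_gen2_Sig [simp]:
  assumes f: "wf_gen1 f" and g: "wf_gen1 g" and C: "wf_word C" shows "wf_gen2 (Sig f C g)"
proof -
  have fh: "arr1 f \<in> hom V (word_obj (gdom f)) (word_obj (gcod f))" "wf_word (gdom f)"
    "wf_word (gcod f)"
    and gh: "arr1 g \<in> hom V (word_obj (gdom g)) (word_obj (gcod g))" "wf_word (gdom g)"
      "wf_word (gcod g)"
    using f g by (auto simp: wf_gen1_def)
  have G: "word_obj C \<lhd> arr1 g \<in> hom V (word_obj (C @ gdom g)) (word_obj (C @ gcod g))"
    using two_endofunctor.F1_hom[OF ltens_functor[of "word_obj C"] gh(1)] C gh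
      by (simp add: word_obj_Obj word_obj_append)
  have gl: "rep_layer (word_obj C \<lhd> arr1 g) (C, g, [])"
    using rep_layer_ltens[OF rep_obj_word_obj[OF C] rep_layer_arr[OF g]] by simp
  have fl: "rep_layer (arr1 f) ([], f, [])" using rep_layer_arr[OF f] .
  have 1: "rep_path ((arr1 f \<rhd> word_obj (C @ gcod g)) \<cdot> (word_obj (gdom f) \<lhd> (word_obj C \<lhd> arr1 g)))
    (gdom f @ C @ gdom g) [(gdom f @ C, g, []), ([], f, C @ gcod g)]"
    using rep_path_comp[OF rep_path_layer[OF rep_layer_ltens[OF rep_obj_word_obj gl]]
      rep_path_layer[OF rep_layer_rtens[OF fl rep_obj_word_obj]], of "gdom f" "C @ gcod g"] fh gh C
      by simp
  have 2: "rep_path ((word_obj (gcod f) \<lhd> (word_obj C \<lhd> arr1 g)) \<cdot> (arr1 f \<rhd> word_obj (C @ gdom g)))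
    (gdom f @ C @ gdom g) [([], f, C @ gdom g), (gcod f @ C, g, [])]"
    using rep_path_comp[OF rep_path_layer[OF rep_layer_rtens[OF fl rep_obj_word_obj]]
      rep_path_layer[OF rep_layer_ltens[OF rep_obj_word_obj gl]], of "C @ gdom g" "gcod f"] fh gh C
      by simp
  show ?thesis using interch_cells[OF fh(1) G] 1 2 by (simp add: Sig_def rep_path_def)
qed

lemma Arr_ltens: "f \<in> Arr V \<Longrightarrow> A \<in> Obj V \<Longrightarrow> A \<lhd> f \<in> Arr V"
  using two_endofunctor.F1_hom[OF ltens_functor, of A f "dom1 V f" "cod1 V f"]
    by (auto simp: hom_def)

lemma rep_Sigma:
  assumes F: "rep_layer F (A, f, C)" and G: "rep_layer G (D, g, E)"
  shows "rep_cell (\<Sigma> F G) (A @ gdom f @ C @ D @ gdom g @ E)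
    [(A @ gdom f @ C @ D, g, E), (A, f, C @ D @ gcod g @ E)] [(0, A, Sig f (C @ D) g, E)]"
proof -
  have w: "wf_word A" "wf_word C" "wf_word D" "wf_word E" "wf_gen1 f" "wf_gen1 g"
    and fg: "F = word_obj A \<lhd> (arr1 f \<rhd> word_obj C)" "G = word_obj D \<lhd> (arr1 g \<rhd> word_obj E)"
    using F G by (auto simp: rep_layer_def tn1_def)
  have O: "word_obj A \<in> Obj V" "word_obj C \<in> Obj V" "word_obj D \<in> Obj V" "word_obj E \<in> Obj V"
    using w word_obj_Obj by auto
  have a: "arr1 f \<in> Arr V" "arr1 g \<in> Arr V" using w by (auto simp: wf_gen1_def hom_def)
  have "\<Sigma> F G = word_obj A \<unlhd> \<Sigma> (arr1 f \<rhd> word_obj C) (word_obj D \<lhd> (arr1 g \<rhd> word_obj E))"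
    unfolding fg using interch_assoc_left a O by (simp add: rtens_Arr Arr_ltens)
  also have "\<Sigma> (arr1 f \<rhd> word_obj C) (word_obj D \<lhd> (arr1 g \<rhd> word_obj E))
    = \<Sigma> (arr1 f) ((word_obj (C @ D) \<lhd> arr1 g) \<rhd> word_obj E)"
    using interch_assoc_mid a O w
      by (simp add: rtens_Arr Arr_ltens word_obj_append assoc1_mid assoc1_right)
  also have "\<dots> = \<Sigma> (arr1 f) (word_obj (C @ D) \<lhd> arr1 g) \<unrhd> word_obj E"
    using interch_assoc_right a O w by (simp add: word_obj_Obj Arr_ltens)
  also have "\<Sigma> (arr1 f) (word_obj (C @ D) \<lhd> arr1 g) = cell2 (Sig f (C @ D) g)"
    by (simp add: Sig_def)
  finally have e: "\<Sigma> F G = word_obj A \<unlhd> (cell2 (Sig f (C @ D) g) \<unrhd> word_obj E)" .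
  have "wf_gen2 (Sig f (C @ D) g)" using w by simp
  from rep_ltens[OF rep_obj_word_obj rep_rtens[OF rep_gen2[OF this] rep_obj_word_obj], of A E] w
    show ?thesis unfolding e by simp
qed

text \<open>\<open>invg\<close> acts on the actual cell, so this is uniqueness of inverses rather
  than a formal identity. It lets \<open>arc\<close> return the original generators when it reverses
  a relation that contains inverses.\<close>

lemma invg_invg [simp]: "wf_gen2 g \<Longrightarrow> invg (invg g) = g"
proof (cases g)
  case (Gen2 x w p q)
  assume "wf_gen2 g"
  then have x: "x \<in> iso_cells V (eval_path w p) (eval_path w q)" using Gen2 by simp
  have "is_inverse2 V (inv2 V x) x"
    using inv2_is_inverse[OF x] is_inverse2_cells[OF iso_cellsD[OF x]]
      is_inverse2_cells[OF iso_cellsD[OF inv2_iso[OF x]]] iso_cellsD[OF x] by simp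
  then show ?thesis using Gen2 inv2_eqI by simp
qed

section \<open>Relations read as loops\<close>

fun flip :: "('o, 'm, 'c) relation \<Rightarrow> ('o, 'm, 'c) relation" where
  "flip (w, p, l, r) = (w, p, r, l)"

text \<open>
  A relation \<open>l = r\<close> of invertible cells is a loop \<open>l r\<^sup>-\<^sup>1\<close>; the first \<open>k\<close> steps of this loop
  rotated by \<open>n\<close> equal the inverse of the remaining ones.
\<close>

fun arc :: "('o, 'm, 'c) relation \<Rightarrow> nat \<Rightarrow> nat \<Rightarrow> ('o, 'm, 'c) relation" where
  "arc (w, p, l, r) n k =
    (let c = l @ invs r; d = drop n c @ take n c in (w, outs p (take n c), take k d,
      invs (drop k d)))"

lemma valid_flip [simp]: "valid (flip r) = valid r"
  by (cases r) (auto intro: movie_eq_sym)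

lemma movie_eq_append_left: "movie_eq w (outs p ss) l r \<Longrightarrow> wf_movie w p ss \<Longrightarrow> movie_eq w p (ss @ l)
  (ss @ r)"
  using movie_eq_append[of w p ss l r "[]"] eval_movie_facts(1) by (auto simp: movie_eq_def)

lemma movie_eq_append_right: "movie_eq w p l r \<Longrightarrow> wf_movie w (outs p l) tt \<Longrightarrow> movie_eq w p (l @ tt)
  (r @ tt)"
  using movie_eq_append[of w p "[]" l r tt] wf_movie_wf_path by (auto simp: movie_eq_def)

text \<open>Append \<open>invs b\<close>: it cancels against \<open>b\<close> on one reading, and on
  the other the whole loop disappears and only \<open>invs b\<close> is left.\<close>

lemma movie_eq_loop:
  assumes "movie_eq w p (a @ b) []" shows "movie_eq w p a (invs b)"
proof -
  have w: "wf_movie w p a" "wf_movie w (outs p a) b" "outs (outs p a) b = p" using assms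
    by (auto simp: movie_eq_def)
  have i: "wf_movie w p (invs b)" "outs p (invs b) = outs p a" using invs_facts[OF w(2)] w(3)
    by auto
  have "movie_eq w p (a @ b @ invs b) (a @ [])"
    by (rule movie_eq_append_left[OF movie_eq_invs[OF w(2)] w(1)])
  moreover have "movie_eq w p ((a @ b) @ invs b) ([] @ invs b)"
    by (rule movie_eq_append_right[OF assms]) (use w i in auto)
  ultimately show ?thesis by (auto simp: movie_eq_def)
qed

text \<open>If the loop \<open>a @ b\<close> is trivial, then \<open>a\<close> equals
  \<open>invs b\<close>, so the rotated loop \<open>b @ a\<close> is trivial too. Cutting it after
  \<open>k\<close> steps is \<open>movie_eq_loop\<close>.\<close>

lemma valid_arc: "valid r \<Longrightarrow> valid (arc r n k)"
proof (cases r)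
  case (fields w p l r')
  assume r: "valid r"
  define c where "c = l @ invs r'"
  have e: "movie_eq w p l r'" using r fields by simp
  have "wf_movie w p r'" "outs p l = outs p r'" using e by (auto simp: movie_eq_def)
  then have "movie_eq w p c (r' @ invs r')" "movie_eq w p (r' @ invs r') []"
    unfolding c_def using movie_eq_append_right[OF e] invs_facts[of w p r'] by auto
  then have c: "movie_eq w p (take n c @ drop n c) []" by (auto intro: movie_eq_trans)
  define a b where "a = take n c" and "b = drop n c"
  have ab: "movie_eq w p (a @ b) []" using c a_def b_def by simp
  then have w: "wf_movie w p a" "wf_movie w (outs p a) b" "outs (outs p a) b = p"
    by (auto simp: movie_eq_def)
  have "movie_eq w (outs p a) (b @ a) (b @ invs b)"
    by (rule movie_eq_append_left) (use movie_eq_loop[OF ab] w in auto)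
  then have "movie_eq w (outs p a) (b @ a) []" using movie_eq_invs[OF w(2)] by (rule movie_eq_trans)
  then have "movie_eq w (outs p a) (take k (b @ a) @ drop k (b @ a)) []"
    by (simp only: append_take_drop_id)
  from movie_eq_loop[OF this] show ?thesis by (simp add: fields c_def[symmetric] a_def b_def
    Let_def)
qed

fun cancel :: "('o, 'm, 'c) gen2 \<Rightarrow> ('o, 'm, 'c) relation" where
  "cancel g = (gword g, gsrc g, [(0, [], g, []), (0, [], invg g, [])], [])"
fun cancel' :: "('o, 'm, 'c) gen2 \<Rightarrow> ('o, 'm, 'c) relation" where
  "cancel' g = (gword g, gtrg g, [(0, [], invg g, []), (0, [], g, [])], [])"

lemma valid_cancel: "wf_gen2 g \<Longrightarrow> valid (cancel g)" "wf_gen2 g \<Longrightarrow> valid (cancel' g)"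
  using movie_eq_inv_gen movie_eq_inv_gen' by auto

text \<open>Taken out of the simplifier when the relations of a certificate are checked, so that
  these functions stay folded and the validity lemmas match.\<close>

lemmas relation_simps = valid.simps arc.simps flip.simps cancel.simps cancel'.simps
lemmas movie_simps = out.simps eval_nat_numeral Let_def

end

context semistrict_braided_monoidal_bicategory
begin

section \<open>Generators and relations of the braiding\<close>

text \<open>Indexed by words, so that \<beta> at a tensor product is a single layer; splitting it is
  always an explicit \<open>Rcell\<close> or \<open>Scell\<close>.\<close>

definition Beta where "Beta A B = Gen1 (braid V (word_obj A) (word_obj B)) (A @ B) (B @ A)"

lemma Beta_simps [simp]: "gdom (Beta A B) = A @ B" "gcod (Beta A B) = B @ A"
  by (auto simp: Beta_def)

lemma wf_gen1_Beta [simp]: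
  assumes "wf_word A" "wf_word B" shows "wf_gen1 (Beta A B)"
  using pseudonatural_transformation.comp_hom[OF braid1_pseudonatural, of "word_obj B" "word_obj A"]
    assms
  by (simp add: wf_gen1_def Beta_def word_obj_Obj word_obj_append)

text \<open>What is carried through \<beta> is a layer, including the objects beside
  \<open>f\<close>. The cell for a tensored \<open>f\<close> is thus a generator of its own, which
  the modification axioms for \<open>R\<close> and \<open>S\<close> relate to the cell for
  \<open>f\<close> alone.\<close>

fun Beta1 where "Beta1 (A, f, C) Z = Gen2 (braid1 V (eval_layer (A, f, C)) (word_obj Z))
  (A @ gdom f @ C @ Z)
  [(A, f, C @ Z), ([], Beta (A @ gcod f @ C) Z, [])] [([], Beta (A @ gdom f @ C) Z, []),
    (Z @ A, f, C)]"
fun Beta2 where "Beta2 X (A, f, C) = Gen2 (braid2 V (word_obj X) (eval_layer (A, f, C)))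
  (X @ A @ gdom f @ C)
  [(X @ A, f, C), ([], Beta X (A @ gcod f @ C), [])] [([], Beta X (A @ gdom f @ C), []),
    (A, f, C @ X)]"
definition Rcell where "Rcell A B C = Gen2 (braidR V (word_obj A) (word_obj B) (word_obj C))
  (A @ B @ C)
  [([], Beta A (B @ C), [])] [([], Beta A B, C), (B, Beta A C, [])]"
definition Scell where "Scell A B C = Gen2 (braidS V (word_obj A) (word_obj B) (word_obj C))
  (A @ B @ C)
  [([], Beta (A @ B) C, [])] [(A, Beta B C, []), ([], Beta A C, B)]"

lemma gen_simps [simp]:
  "gword (Beta1 (A, f, C) Z) = A @ gdom f @ C @ Z"
  "gsrc (Beta1 (A, f, C) Z) = [(A, f, C @ Z), ([], Beta (A @ gcod f @ C) Z, [])]"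
  "gtrg (Beta1 (A, f, C) Z) = [([], Beta (A @ gdom f @ C) Z, []), (Z @ A, f, C)]"
  "gword (Beta2 X (A, f, C)) = X @ A @ gdom f @ C"
  "gsrc (Beta2 X (A, f, C)) = [(X @ A, f, C), ([], Beta X (A @ gcod f @ C), [])]"
  "gtrg (Beta2 X (A, f, C)) = [([], Beta X (A @ gdom f @ C), []), (A, f, C @ X)]"
  "gword (Rcell A B C) = A @ B @ C"
  "gsrc (Rcell A B C) = [([], Beta A (B @ C), [])]"
  "gtrg (Rcell A B C) = [([], Beta A B, C), (B, Beta A C, [])]"
  "gword (Scell A B C) = A @ B @ C"
  "gsrc (Scell A B C) = [([], Beta (A @ B) C, [])]"
  "gtrg (Scell A B C) = [(A, Beta B C, []), ([], Beta A C, B)]"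
  by (auto simp: Rcell_def Scell_def)

declare Beta1.simps [simp del] Beta2.simps [simp del]

lemma rep_layer_Beta: "rep_obj A v \<Longrightarrow> rep_obj B w \<Longrightarrow> rep_layer (braid V A B) ([], Beta v w, [])"
  using rep_layer_arr[of "Beta v w"] by (simp add: rep_obj_def) (simp add: Beta_def)

lemma rep_path_arr: "wf_gen1 f \<Longrightarrow> rep_path (arr1 f) (gdom f) [([], f, [])]"
  using rep_path_layer[OF rep_layer_arr] by simp
lemma rep_path_Beta: "rep_obj A v \<Longrightarrow> rep_obj B w \<Longrightarrow> rep_path (braid V A B) (v @ w)
  [([], Beta v w, [])]"
  using rep_path_layer[OF rep_layer_Beta] by simp
lemma wf_gen2_Beta1 [simp]:
  assumes "wf_word A" "wf_word C" "wf_gen1 f" "wf_word Z" shows "wf_gen2 (Beta1 (A, f, C) Z)"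
proof -
  let ?l = "(A, f, C)"
  have w: "wf_layer ?l" "wf_word (gdom f)" "wf_word (gcod f)" using assms
    by (auto simp: wf_gen1_def)
  have 1: "braid1 V (eval_layer ?l) (word_obj Z)
    \<in> iso_cells V (braid V (word_obj (lcod ?l)) (word_obj Z) \<cdot> (eval_layer ?l \<rhd> word_obj Z))
     ((word_obj Z \<lhd> eval_layer ?l) \<cdot> braid V (word_obj (ldom ?l)) (word_obj Z))"
    using pseudonatural_transformation.comp_cells[OF braid1_pseudonatural eval_layer_hom[OF w(1)],
      of "word_obj Z"] assms word_obj_Obj
    by simp
  have 2: "rep_path (braid V (word_obj (lcod ?l)) (word_obj Z) \<cdot> (eval_layer ?l \<rhd> word_obj Z))
    (A @ gdom f @ C @ Z)
      [(A, f, C @ Z), ([], Beta (A @ gcod f @ C) Z, [])]"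
    using rep_path_comp[OF rep_path_layer[OF rep_layer_rtens[OF rep_layer_eval_layer[OF w(1)]
      rep_obj_word_obj]] rep_path_Beta[OF rep_obj_word_obj rep_obj_word_obj], of Z "lcod ?l" Z]
      assms w by simp
  have 3: "rep_path ((word_obj Z \<lhd> eval_layer ?l) \<cdot> braid V (word_obj (ldom ?l)) (word_obj Z))
    (A @ gdom f @ C @ Z)
      [([], Beta (A @ gdom f @ C) Z, []), (Z @ A, f, C)]"
    using rep_path_comp[OF rep_path_Beta[OF rep_obj_word_obj rep_obj_word_obj]
      rep_path_layer[OF rep_layer_ltens[OF rep_obj_word_obj rep_layer_eval_layer[OF w(1)]]],
      of "ldom ?l" Z Z]
      assms w by simp
  show ?thesis using 1 2 3 by (simp add: Beta1.simps rep_path_def)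
qed

lemma wf_gen2_Beta2 [simp]:
  assumes "wf_word A" "wf_word C" "wf_gen1 f" "wf_word Z" shows "wf_gen2 (Beta2 Z (A, f, C))"
proof -
  let ?l = "(A, f, C)"
  have w: "wf_layer ?l" "wf_word (gdom f)" "wf_word (gcod f)" using assms
    by (auto simp: wf_gen1_def)
  have 1: "braid2 V (word_obj Z) (eval_layer ?l)
    \<in> iso_cells V (braid V (word_obj Z) (word_obj (lcod ?l)) \<cdot> (word_obj Z \<lhd> eval_layer ?l))
     ((eval_layer ?l \<rhd> word_obj Z) \<cdot> braid V (word_obj Z) (word_obj (ldom ?l)))"
    using pseudonatural_transformation.comp_cells[OF braid2_pseudonatural eval_layer_hom[OF w(1)],
      of "word_obj Z"] assms word_obj_Obj
    by simp
  have 2: "rep_path (braid V (word_obj Z) (word_obj (lcod ?l)) \<cdot> (word_obj Z \<lhd> eval_layer ?l))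
    (Z @ A @ gdom f @ C)
      [(Z @ A, f, C), ([], Beta Z (A @ gcod f @ C), [])]"
    using rep_path_comp[OF rep_path_layer[OF rep_layer_ltens[OF rep_obj_word_obj
      rep_layer_eval_layer[OF w(1)]]] rep_path_Beta[OF rep_obj_word_obj rep_obj_word_obj],
      of Z Z "lcod ?l"]
      assms w by simp
  have 3: "rep_path ((eval_layer ?l \<rhd> word_obj Z) \<cdot> braid V (word_obj Z) (word_obj (ldom ?l)))
    (Z @ A @ gdom f @ C)
      [([], Beta Z (A @ gdom f @ C), []), (A, f, C @ Z)]"
    using rep_path_comp[OF rep_path_Beta[OF rep_obj_word_obj rep_obj_word_obj]
      rep_path_layer[OF rep_layer_rtens[OF rep_layer_eval_layer[OF w(1)] rep_obj_word_obj]],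
      of Z "ldom ?l" Z]
      assms w by simp
  show ?thesis using 1 2 3 by (simp add: Beta2.simps rep_path_def)
qed

lemma wf_gen2_Rcell [simp]:
  assumes w: "wf_word A" "wf_word B" "wf_word C" shows "wf_gen2 (Rcell A B C)"
proof -
  have 1: "rep_path (braid V (word_obj A) (word_obj B \<otimes> word_obj C)) (A @ B @ C)
    [([], Beta A (B @ C), [])]"
    using rep_path_Beta[OF rep_obj_word_obj rep_obj_tens[OF rep_obj_word_obj rep_obj_word_obj]] w
      by simp
  have 2: "rep_path ((word_obj B \<lhd> braid V (word_obj A) (word_obj C)) \<cdot>
    (braid V (word_obj A) (word_obj B) \<rhd> word_obj C)) (A @ B @ C) [([], Beta A B, C),
    (B, Beta A C, [])]"
    using rep_path_comp[OF rep_path_rtens[OF rep_path_Beta[OF rep_obj_word_obj rep_obj_word_obj]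
      rep_obj_word_obj]
      rep_path_ltens[OF rep_obj_word_obj rep_path_Beta[OF rep_obj_word_obj rep_obj_word_obj]],
      of A B C B A C] w
    by simp
  show ?thesis using R_iso[of "word_obj A" "word_obj B" "word_obj C"] 1 2 w
    by (simp add: Rcell_def rep_path_def word_obj_Obj)
qed

lemma wf_gen2_Scell [simp]:
  assumes w: "wf_word A" "wf_word B" "wf_word C" shows "wf_gen2 (Scell A B C)"
proof -
  have 1: "rep_path (braid V (word_obj A \<otimes> word_obj B) (word_obj C)) (A @ B @ C)
    [([], Beta (A @ B) C, [])]"
    using rep_path_Beta[OF rep_obj_tens[OF rep_obj_word_obj rep_obj_word_obj] rep_obj_word_obj] w
      by simp
  have 2: "rep_path ((braid V (word_obj A) (word_obj C) \<rhd> word_obj B) \<cdot>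
    (word_obj A \<lhd> braid V (word_obj B) (word_obj C))) (A @ B @ C) [(A, Beta B C, []),
    ([], Beta A C, B)]"
    using rep_path_comp[OF rep_path_ltens[OF rep_obj_word_obj
      rep_path_Beta[OF rep_obj_word_obj rep_obj_word_obj]]
      rep_path_rtens[OF rep_path_Beta[OF rep_obj_word_obj rep_obj_word_obj] rep_obj_word_obj],
      of A B C A C B] w
    by simp
  show ?thesis using S_iso[of "word_obj A" "word_obj B" "word_obj C"] 1 2 w
    by (simp add: Scell_def rep_path_def word_obj_Obj)
qed

lemma rep_braid1:
  assumes "rep_layer F (A, f, C)" "rep_obj B Z"
  shows "rep_cell (braid1 V F B) (A @ gdom f @ C @ Z)
    [(A, f, C @ Z), ([], Beta (A @ gcod f @ C) Z, [])] [(0, [], Beta1 (A, f, C) Z, [])]"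
  using rep_gen2[OF wf_gen2_Beta1[of A C f Z]] assms
    by (simp add: rep_layer_def rep_obj_def) (simp add: Beta1.simps)

lemma rep_braid2:
  assumes "rep_obj B Z" "rep_layer F (A, f, C)"
  shows "rep_cell (braid2 V B F) (Z @ A @ gdom f @ C)
    [(Z @ A, f, C), ([], Beta Z (A @ gcod f @ C), [])] [(0, [], Beta2 Z (A, f, C), [])]"
  using rep_gen2[OF wf_gen2_Beta2[of A C f Z]] assms
    by (simp add: rep_layer_def rep_obj_def) (simp add: Beta2.simps)

lemma rep_braidR:
  "rep_obj A a \<Longrightarrow> rep_obj B b \<Longrightarrow> rep_obj C c \<Longrightarrow>
    rep_cell (braidR V A B C) (a @ b @ c) [([], Beta a (b @ c), [])] [(0, [], Rcell a b c, [])]"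
  using rep_gen2[OF wf_gen2_Rcell[of a b c]] by (simp add: rep_obj_def) (simp add: Rcell_def)

lemma rep_braidS:
  "rep_obj A a \<Longrightarrow> rep_obj B b \<Longrightarrow> rep_obj C c \<Longrightarrow>
    rep_cell (braidS V A B C) (a @ b @ c) [([], Beta (a @ b) c, [])] [(0, [], Scell a b c, [])]"
  using rep_gen2[OF wf_gen2_Scell[of a b c]] by (simp add: rep_obj_def) (simp add: Scell_def)

lemmas rep_rules =
  rep_vcomp rep_lwhisk rep_rwhisk rep_hcomp rep_ltens rep_rtens rep_inv rep_id2
  rep_Sigma rep_braid1 rep_braid2 rep_braidR rep_braidS
  rep_path_comp rep_path_ltens rep_path_rtens rep_path_Beta rep_path_arr rep_path_id
  rep_layer_ltens rep_layer_rtens rep_layer_Beta rep_layer_arr rep_layer_eval_layer rep_obj_tens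
    rep_obj_word_obj rep_obj_unit

lemma wf_gen1_words: "wf_gen1 f \<Longrightarrow> wf_word (gdom f)" "wf_gen1 f \<Longrightarrow> wf_word (gcod f)"
  "wf_gen1 f \<Longrightarrow> arr1 f \<in> hom V (word_obj (gdom f)) (word_obj (gcod f))"
  by (auto simp: wf_gen1_def)

section \<open>Naturality of \<open>R\<close>, \<open>S\<close> and \<beta> as relations between
  movies\<close>

definition R_nat1 where "R_nat1 f B C =
  (gdom f @ B @ C, [([], f, B @ C), ([], Beta (gcod f) (B @ C), [])],
   [(0, [], Beta1 ([], f, []) (B @ C), []),
     (0, [], Rcell (gdom f) (B) (C), [])],
   [(1, [], Rcell (gcod f) (B) (C), []),
     (0, [], Beta1 ([], f, []) (B), C),
     (1, B, Beta1 ([], f, []) (C), [])])"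

lemma valid_R_nat1:
  assumes f: "wf_gen1 f" and w: "wf_word B" "wf_word C"
  shows "valid (R_nat1 f B C)"
proof -
  note facts = f wf_gen1_words[OF f] w word_obj_Obj[OF w(1)] word_obj_Obj[OF w(2)]
  have d: "dom1 V (arr1 f) = word_obj (gdom f)" "cod1 V (arr1 f) = word_obj (gcod f)"
    using wf_gen1_words(3)[OF f] by (auto simp: hom_def)
  note ax = R_modification_1[OF word_obj_Obj[OF w(1)] word_obj_Obj[OF w(2)],
    unfolded modification_def, THEN conjunct2, rule_format,
    OF wf_gen1_words(3)[OF f], unfolded d]
  show ?thesis unfolding R_nat1_def valid.simps
    \<comment> \<open>Each round opens one side of the axiom with \<open>rep_conv\<close> and
      rebuilds it as a movie; \<open>simp; fail\<close> counts only if \<open>simp\<close> closes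
      the side condition or comparison completely.\<close>
    by (rule rep_movie_eq[OF ax],
      (rule rep_conv, (rule rep_rules | (simp add: facts out.simps; fail))+)+)
qed

definition R_nat2 where "R_nat2 A f C =
  (A @ gdom f @ C, [(A, f, C), ([], Beta (A) (gcod f @ C), [])],
   [(0, [], Beta2 (A) ([], f, C), []),
     (0, [], Rcell (A) (gdom f) (C), [])],
   [(1, [], Rcell (A) (gcod f) (C), []),
     (0, [], Beta2 (A) ([], f, []), C),
     (1, [], invg (Sig (f) ([]) (Beta (A) (C))), [])])"

lemma valid_R_nat2:
  assumes f: "wf_gen1 f" and w: "wf_word A" "wf_word C"
  shows "valid (R_nat2 A f C)"
proof -
  note facts = f wf_gen1_words[OF f] w word_obj_Obj[OF w(1)] word_obj_Obj[OF w(2)]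
  have d: "dom1 V (arr1 f) = word_obj (gdom f)" "cod1 V (arr1 f) = word_obj (gcod f)"
    using wf_gen1_words(3)[OF f] by (auto simp: hom_def)
  note ax = R_modification_2[OF word_obj_Obj[OF w(1)] word_obj_Obj[OF w(2)],
    unfolded modification_def, THEN conjunct2, rule_format,
    OF wf_gen1_words(3)[OF f], unfolded d]
  show ?thesis unfolding R_nat2_def valid.simps
    by (rule rep_movie_eq[OF ax],
      (rule rep_conv, (rule rep_rules | (simp add: facts out.simps; fail))+)+)
qed

definition R_nat3 where "R_nat3 A B f =
  (A @ B @ gdom f, [(A @ B, f, []), ([], Beta (A) (B @ gcod f), [])],
   [(0, [], Beta2 (A) (B, f, []), []),
     (0, [], Rcell (A) (B) (gdom f), [])],
   [(1, [], Rcell (A) (B) (gcod f), []),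
     (0, [], Sig (Beta (A) (B)) ([]) (f), []),
     (1, B, Beta2 (A) ([], f, []), [])])"

lemma valid_R_nat3:
  assumes f: "wf_gen1 f" and w: "wf_word A" "wf_word B"
  shows "valid (R_nat3 A B f)"
proof -
  note facts = f wf_gen1_words[OF f] w word_obj_Obj[OF w(1)] word_obj_Obj[OF w(2)]
  have d: "dom1 V (arr1 f) = word_obj (gdom f)" "cod1 V (arr1 f) = word_obj (gcod f)"
    using wf_gen1_words(3)[OF f] by (auto simp: hom_def)
  note ax = R_modification_3[OF word_obj_Obj[OF w(1)] word_obj_Obj[OF w(2)],
    unfolded modification_def, THEN conjunct2, rule_format,
    OF wf_gen1_words(3)[OF f], unfolded d]
  show ?thesis unfolding R_nat3_def valid.simps
    by (rule rep_movie_eq[OF ax],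
      (rule rep_conv, (rule rep_rules | (simp add: facts out.simps; fail))+)+)
qed

definition S_nat1 where "S_nat1 f B C =
  (gdom f @ B @ C, [([], f, B @ C), ([], Beta (gcod f @ B) (C), [])],
   [(0, [], Beta1 ([], f, B) (C), []),
     (0, [], Scell (gdom f) (B) (C), [])],
   [(1, [], Scell (gcod f) (B) (C), []),
     (0, [], invg (Sig (f) ([]) (Beta (B) (C))), []),
     (1, [], Beta1 ([], f, []) (C), B)])"

lemma valid_S_nat1:
  assumes f: "wf_gen1 f" and w: "wf_word B" "wf_word C"
  shows "valid (S_nat1 f B C)"
proof -
  note facts = f wf_gen1_words[OF f] w word_obj_Obj[OF w(1)] word_obj_Obj[OF w(2)]
  have d: "dom1 V (arr1 f) = word_obj (gdom f)" "cod1 V (arr1 f) = word_obj (gcod f)"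
    using wf_gen1_words(3)[OF f] by (auto simp: hom_def)
  note ax = S_modification_1[OF word_obj_Obj[OF w(1)] word_obj_Obj[OF w(2)],
    unfolded modification_def, THEN conjunct2, rule_format,
    OF wf_gen1_words(3)[OF f], unfolded d]
  show ?thesis unfolding S_nat1_def valid.simps
    by (rule rep_movie_eq[OF ax],
      (rule rep_conv, (rule rep_rules | (simp add: facts out.simps; fail))+)+)
qed

definition S_nat2 where "S_nat2 A f C =
  (A @ gdom f @ C, [(A, f, C), ([], Beta (A @ gcod f) (C), [])],
   [(0, [], Beta1 (A, f, []) (C), []),
     (0, [], Scell (A) (gdom f) (C), [])],
   [(1, [], Scell (A) (gcod f) (C), []),
     (0, A, Beta1 ([], f, []) (C), []),
     (1, [], Sig (Beta (A) (C)) ([]) (f), [])])"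

lemma valid_S_nat2:
  assumes f: "wf_gen1 f" and w: "wf_word A" "wf_word C"
  shows "valid (S_nat2 A f C)"
proof -
  note facts = f wf_gen1_words[OF f] w word_obj_Obj[OF w(1)] word_obj_Obj[OF w(2)]
  have d: "dom1 V (arr1 f) = word_obj (gdom f)" "cod1 V (arr1 f) = word_obj (gcod f)"
    using wf_gen1_words(3)[OF f] by (auto simp: hom_def)
  note ax = S_modification_2[OF word_obj_Obj[OF w(1)] word_obj_Obj[OF w(2)],
    unfolded modification_def, THEN conjunct2, rule_format,
    OF wf_gen1_words(3)[OF f], unfolded d]
  show ?thesis unfolding S_nat2_def valid.simps
    by (rule rep_movie_eq[OF ax],
      (rule rep_conv, (rule rep_rules | (simp add: facts out.simps; fail))+)+)
qed

definition S_nat3 where "S_nat3 A B f =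
  (A @ B @ gdom f, [(A @ B, f, []), ([], Beta (A @ B) (gcod f), [])],
   [(0, [], Beta2 (A @ B) ([], f, []), []),
     (0, [], Scell (A) (B) (gdom f), [])],
   [(1, [], Scell (A) (B) (gcod f), []),
     (0, A, Beta2 (B) ([], f, []), []),
     (1, [], Beta2 (A) ([], f, []), B)])"

lemma valid_S_nat3:
  assumes f: "wf_gen1 f" and w: "wf_word A" "wf_word B"
  shows "valid (S_nat3 A B f)"
proof -
  note facts = f wf_gen1_words[OF f] w word_obj_Obj[OF w(1)] word_obj_Obj[OF w(2)]
  have d: "dom1 V (arr1 f) = word_obj (gdom f)" "cod1 V (arr1 f) = word_obj (gcod f)"
    using wf_gen1_words(3)[OF f] by (auto simp: hom_def)
  note ax = S_modification_3[OF word_obj_Obj[OF w(1)] word_obj_Obj[OF w(2)],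
    unfolded modification_def, THEN conjunct2, rule_format,
    OF wf_gen1_words(3)[OF f], unfolded d]
  show ?thesis unfolding S_nat3_def valid.simps
    by (rule rep_movie_eq[OF ax],
      (rule rep_conv, (rule rep_rules | (simp add: facts out.simps; fail))+)+)
qed

text \<open>Naturality of \<beta> at the interchanger of \<open>f\<close> and \<open>g\<close>.
  Behind the braiding the two 1-cells have changed sides, whence the inverse interchanger of
  \<open>g\<close> and \<open>f\<close>.\<close>

definition interch_rel where "interch_rel f g =
  (gdom f @ gdom g, [(gdom f, g, []), ([], f, gcod g), ([], Beta (gcod f) (gcod g), [])],
   [(1, [], Beta1 ([], f, []) (gcod g), []),
     (0, [], Beta2 (gdom f) ([], g, []), []),
     (1, [], invg (Sig (g) ([]) (f)), [])],
   [(0, [], Sig (f) ([]) (g), []),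
     (1, [], Beta2 (gcod f) ([], g, []), []),
     (0, [], Beta1 ([], f, []) (gdom g), [])])"

lemma valid_interch_rel:
  assumes f: "wf_gen1 f" and g: "wf_gen1 g"
  shows "valid (interch_rel f g)"
proof -
  note facts = f wf_gen1_words[OF f] g wf_gen1_words[OF g]
  note ax = braid_interch[OF wf_gen1_words(3)[OF f] wf_gen1_words(3)[OF g]]
  show ?thesis unfolding interch_rel_def valid.simps
    by (rule rep_movie_eq[OF ax],
      (rule rep_conv, (rule rep_rules | (simp add: facts out.simps; fail))+)+)
qed

section \<open>The braiding axioms for four letters\<close>

definition RR_rel where "RR_rel A B C D =
  (A @ B @ C @ D, [([], Beta (A) (B @ C @ D), [])],
   [(0, [], Rcell (A) (B @ C) (D), []),
     (0, [], Rcell (A) (B) (C), D)],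
   [(0, [], Rcell (A) (B) (C @ D), []),
     (1, B, Rcell (A) (C) (D), [])])"

lemma valid_RR_rel:
  assumes w: "wf_word A" "wf_word B" "wf_word C" "wf_word D"
  shows "valid (RR_rel A B C D)"
proof -
  note facts = w word_obj_Obj[OF w(1)] word_obj_Obj[OF w(2)] word_obj_Obj[OF w(3)]
    word_obj_Obj[OF w(4)]
  note ax = braiding_R[OF word_obj_Obj[OF w(1)] word_obj_Obj[OF w(2)] word_obj_Obj[OF w(3)]
    word_obj_Obj[OF w(4)]]
  show ?thesis unfolding RR_rel_def valid.simps
    by (rule rep_movie_eq[OF ax],
      (rule rep_conv, (rule rep_rules | (simp add: facts out.simps; fail))+)+)
qed

definition SS_rel where "SS_rel A B C D =
  (A @ B @ C @ D, [([], Beta (A @ B @ C) (D), [])],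
   [(0, [], Scell (A @ B) (C) (D), []),
     (1, [], Scell (A) (B) (D), C)],
   [(0, [], Scell (A) (B @ C) (D), []),
     (0, A, Scell (B) (C) (D), [])])"

lemma valid_SS_rel:
  assumes w: "wf_word A" "wf_word B" "wf_word C" "wf_word D"
  shows "valid (SS_rel A B C D)"
proof -
  note facts = w word_obj_Obj[OF w(1)] word_obj_Obj[OF w(2)] word_obj_Obj[OF w(3)]
    word_obj_Obj[OF w(4)]
  note ax = braiding_S[OF word_obj_Obj[OF w(1)] word_obj_Obj[OF w(2)] word_obj_Obj[OF w(3)]
    word_obj_Obj[OF w(4)]]
  show ?thesis unfolding SS_rel_def valid.simps
    by (rule rep_movie_eq[OF ax],
      (rule rep_conv, (rule rep_rules | (simp add: facts out.simps; fail))+)+)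
qed

definition RS_rel where "RS_rel A B C D =
  (A @ B @ C @ D, [([], Beta (A @ B) (C @ D), [])],
   [(0, [], Rcell (A @ B) (C) (D), []),
     (0, [], Scell (A) (B) (C), D),
     (2, C, Scell (A) (B) (D), [])],
   [(0, [], Scell (A) (B) (C @ D), []),
     (0, A, Rcell (B) (C) (D), []),
     (2, [], Rcell (A) (C) (D), B),
     (1, [], Sig (Beta (A) (C)) ([]) (Beta (B) (D)), [])])"

lemma valid_RS_rel:
  assumes w: "wf_word A" "wf_word B" "wf_word C" "wf_word D"
  shows "valid (RS_rel A B C D)"
proof -
  note facts = w word_obj_Obj[OF w(1)] word_obj_Obj[OF w(2)] word_obj_Obj[OF w(3)]
    word_obj_Obj[OF w(4)]
  note ax = braiding_RS[OF word_obj_Obj[OF w(1)] word_obj_Obj[OF w(2)] word_obj_Obj[OF w(3)]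
    word_obj_Obj[OF w(4)]]
  show ?thesis unfolding RS_rel_def valid.simps
    by (rule rep_movie_eq[OF ax],
      (rule rep_conv, (rule rep_rules | (simp add: facts out.simps; fail))+)+)
qed

text \<open>The braiding stands behind the path and meets its last layer first; therefore the
  recursive call precedes the step for \<open>l\<close>, and the positions run downwards to
  \<open>i\<close>.\<close>

fun braid1_path where
  "braid1_path i [] Z = []"
| "braid1_path i (l # p) Z = braid1_path (Suc i) p Z @ [(i, [], Beta1 l Z, [])]"

fun braid2_path where
  "braid2_path i X [] = []"
| "braid2_path i X (l # p) = braid2_path (Suc i) X p @ [(i, [], Beta2 X l, [])]"

lemma shift_append [simp]: "shift i A B (ss @ tt) = shift i A B ss @ shift i A B tt"
  by (simp add: shift_def)

lemma shift_shift [simp]: "shift i A B (shift j A' B' ss) = shift (i + j) (A @ A') (B' @ B) ss"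
  by (auto simp: shift_def)

lemma shift_braid1_path: "shift j [] [] (braid1_path i p Z) = braid1_path (j + i) p Z"
  by (induction p arbitrary: i) auto

lemma shift_braid2_path: "shift j [] [] (braid2_path i X p) = braid2_path (j + i) X p"
  by (induction p arbitrary: i) auto

lemma shift_Nil: "shift 0 [] [] ss = ss"
  by (auto simp: shift_def)

lemma outs_shift:
  assumes "wf_movie w' p' l" "wf_path w (pre @ p' @ post)" "pcod w pre = w'"
  shows "outs (pre @ p' @ post) (shift (length pre) [] [] l) = pre @ outs p' l @ post"
  using shift_facts(2)[of w' p' l w pre "[]" "[]" post] assms by simp

text \<open>\<open>comp_comp1\<close> splits the cell of \<beta> at a composite, and
  \<open>comp_id1\<close> treats the empty path. The final path belongs to the induction claim
  because the step for \<open>l\<close> starts from it.\<close>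

lemma rep_braid1_path:
  assumes Z: "wf_word Z" and p: "wf_path w p"
  shows "rep_cell (braid1 V (eval_path w p) (word_obj Z)) (w @ Z)
    (ptens [] p Z @ [([], Beta (pcod w p) Z, [])]) (braid1_path 0 p Z)
    \<and> outs (ptens [] p Z @ [([], Beta (pcod w p) Z, [])]) (braid1_path 0 p Z)
      = ([], Beta w Z, []) # ptens Z p []"
  using p
proof (induction p arbitrary: w)
  case Nil
  then have "braid1 V (id1 V (word_obj w)) (word_obj Z) = id2 V (braid V (word_obj w) (word_obj Z))"
    using pseudonatural_transformation.comp_id1[OF braid1_pseudonatural] Z
      by (simp add: word_obj_Obj)
  then show ?case using rep_id2[OF rep_path_Beta[OF rep_obj_word_obj rep_obj_word_obj], of w Z] Nil
    Z by simp
next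
  case (Cons l p)
  obtain A f C where l: "l = (A, f, C)" by (cases l)
  have w: "wf_layer l" "w = A @ gdom f @ C" "wf_path (lcod l) p" "wf_word A" "wf_word C" "wf_gen1 f"
    using Cons l by auto
  note IH = Cons.IH[OF w(3)]
  let ?q = "ptens [] p Z @ [([], Beta (pcod (lcod l) p) Z, [])]"
  have r1: "rep_cell (braid1 V (eval_path (lcod l) p) (word_obj Z) \<cdot>\<^sub>r (eval_layer l \<rhd> word_obj Z))
    (w @ Z) ((A, f, C @ Z) # ?q) (braid1_path 1 p Z)"
    using rep_rwhisk[OF IH[THEN conjunct1]
      rep_path_layer[OF rep_layer_rtens[OF rep_layer_eval_layer rep_obj_word_obj, of A f C Z]]] w l
      Z
    by (simp add: shift_braid1_path)
  have o1: "outs ((A, f, C @ Z) # ?q) (braid1_path 1 p Z) = (A, f, C @ Z) # ([], Beta (lcod l) Z,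
    []) # ptens Z p []"
    using outs_shift[of "lcod l @ Z" ?q "braid1_path 0 p Z" "w @ Z" "[(A, f, C @ Z)]" "[]"] IH r1 l
    by (auto simp: rep_cell_def shift_braid1_path dest: wf_movie_wf_path)
  have wp: "wf_path (Z @ lcod l) (ptens Z p [])" using wf_path_ptens[OF Z _ w(3), of "[]"] by simp
  have r2: "rep_cell ((word_obj Z \<lhd> eval_path (lcod l) p) \<cdot>\<^sub>l braid1 V (eval_layer l) (word_obj Z))
    (w @ Z)
      ((A, f, C @ Z) # ([], Beta (lcod l) Z, []) # ptens Z p []) [(0, [], Beta1 l Z, [])]"
    using rep_lwhisk[OF rep_path_ltens[OF rep_obj_word_obj, of Z "eval_path (lcod l) p" "lcod l" p]
      rep_braid1[OF rep_layer_eval_layer rep_obj_word_obj, of A f C Z]] w l Z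
    by (simp add: rep_path_def)
  have "braid1 V (eval_path w (l # p)) (word_obj Z)
      = ((word_obj Z \<lhd> eval_path (lcod l) p) \<cdot>\<^sub>l braid1 V (eval_layer l) (word_obj Z))
        \<bullet> (braid1 V (eval_path (lcod l) p) (word_obj Z) \<cdot>\<^sub>r (eval_layer l \<rhd> word_obj Z))"
    using pseudonatural_transformation.comp_comp1[OF braid1_pseudonatural eval_layer_hom[OF w(1)]
      eval_path_hom[OF w(3)]] Z
    by (simp add: word_obj_Obj)
  moreover have "outs ((A, f, C @ Z) # ([], Beta (lcod l) Z, []) # ptens Z p [])
    [(0, [], Beta1 l Z, [])]
      = ([], Beta w Z, []) # (Z @ A, f, C) # ptens Z p []"
    using w by (simp add: out.simps l)
  ultimately show ?case using rep_vcomp[OF r1 r2] o1 by (simp add: l)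
qed

lemma rep_braid2_path:
  assumes Z: "wf_word Z" and p: "wf_path w p"
  shows "rep_cell (braid2 V (word_obj Z) (eval_path w p)) (Z @ w)
    (ptens Z p [] @ [([], Beta Z (pcod w p), [])]) (braid2_path 0 Z p)
    \<and> outs (ptens Z p [] @ [([], Beta Z (pcod w p), [])]) (braid2_path 0 Z p)
      = ([], Beta Z w, []) # ptens [] p Z"
  using p
proof (induction p arbitrary: w)
  case Nil
  then have "braid2 V (word_obj Z) (id1 V (word_obj w)) = id2 V (braid V (word_obj Z) (word_obj w))"
    using pseudonatural_transformation.comp_id1[OF braid2_pseudonatural] Z
      by (simp add: word_obj_Obj)
  then show ?case using rep_id2[OF rep_path_Beta[OF rep_obj_word_obj rep_obj_word_obj], of Z w] Nil
    Z by simp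
next
  case (Cons l p)
  obtain A f C where l: "l = (A, f, C)" by (cases l)
  have w: "wf_layer l" "w = A @ gdom f @ C" "wf_path (lcod l) p" "wf_word A" "wf_word C" "wf_gen1 f"
    using Cons l by auto
  note IH = Cons.IH[OF w(3)]
  let ?q = "ptens Z p [] @ [([], Beta Z (pcod (lcod l) p), [])]"
  have r1: "rep_cell (braid2 V (word_obj Z) (eval_path (lcod l) p) \<cdot>\<^sub>r (word_obj Z \<lhd> eval_layer l))
    (Z @ w) ((Z @ A, f, C) # ?q) (braid2_path 1 Z p)"
    using rep_rwhisk[OF IH[THEN conjunct1]
      rep_path_layer[OF rep_layer_ltens[OF rep_obj_word_obj rep_layer_eval_layer, of Z A f C]]] w l
      Z
    by (simp add: shift_braid2_path)
  have o1: "outs ((Z @ A, f, C) # ?q) (braid2_path 1 Z p) = (Z @ A, f, C) # ([], Beta Z (lcod l),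
    []) # ptens [] p Z"
    using outs_shift[of "Z @ lcod l" ?q "braid2_path 0 Z p" "Z @ w" "[(Z @ A, f, C)]" "[]"] IH r1 l
    by (auto simp: rep_cell_def shift_braid2_path dest: wf_movie_wf_path)
  have r2: "rep_cell ((eval_path (lcod l) p \<rhd> word_obj Z) \<cdot>\<^sub>l braid2 V (word_obj Z) (eval_layer l))
    (Z @ w)
      ((Z @ A, f, C) # ([], Beta Z (lcod l), []) # ptens [] p Z) [(0, [], Beta2 Z l, [])]"
    using rep_lwhisk[OF rep_path_rtens[OF _ rep_obj_word_obj, of "eval_path (lcod l) p" "lcod l"
      p Z] rep_braid2[OF rep_obj_word_obj rep_layer_eval_layer, of Z A f C]] w l Z
    by (simp add: rep_path_def)
  have "braid2 V (word_obj Z) (eval_path w (l # p))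
      = ((eval_path (lcod l) p \<rhd> word_obj Z) \<cdot>\<^sub>l braid2 V (word_obj Z) (eval_layer l))
        \<bullet> (braid2 V (word_obj Z) (eval_path (lcod l) p) \<cdot>\<^sub>r (word_obj Z \<lhd> eval_layer l))"
    using pseudonatural_transformation.comp_comp1[OF braid2_pseudonatural eval_layer_hom[OF w(1)]
      eval_path_hom[OF w(3)]] Z
    by (simp add: word_obj_Obj)
  moreover have "outs ((Z @ A, f, C) # ([], Beta Z (lcod l), []) # ptens [] p Z)
    [(0, [], Beta2 Z l, [])]
      = ([], Beta Z w, []) # (A, f, C @ Z) # ptens [] p Z"
    using w by (simp add: out.simps l)
  ultimately show ?case using rep_vcomp[OF r1 r2] o1 by (simp add: l)
qed

definition braid1_nat
  where "braid1_nat w p ss Z = (w @ Z, ptens [] p Z @ [([], Beta (pcod w p) Z, [])],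
  braid1_path 0 p Z @ shift 1 Z [] ss, shift 0 [] Z ss @ braid1_path 0 (outs p ss) Z)"

definition braid2_nat
  where "braid2_nat X w p ss = (X @ w, ptens X p [] @ [([], Beta X (pcod w p), [])],
  braid2_path 0 X p @ shift 1 [] X ss, shift 0 X [] ss @ braid2_path 0 X (outs p ss))"

text \<open>\<open>comp_natural\<close> is applied to the value of the whole movie, which is one
  2-cell. So naturality at any composite is available as a single relation;
  \<open>braid2_nat\<close> is used in this way for an entire \<theta>.\<close>

lemma valid_braid1_nat:
  assumes Z: "wf_word Z" and d: "wf_movie w p ss"
  shows "valid (braid1_nat w p ss Z)"
proof -
  have p: "wf_path w p" "wf_path w (outs p ss)" "pcod w (outs p ss) = pcod w p"
    using d eval_movie_facts[OF d] wf_movie_wf_path by auto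
  let ?q = "ptens [] p Z @ [([], Beta (pcod w p) Z, [])]" and ?x = "eval_movie w p ss"
  note P = rep_braid1_path[OF Z p(1)] and Q = rep_braid1_path[OF Z p(2), unfolded p(3)]
  have x: "rep_cell ?x w p ss" using d by (simp add: rep_cell_def)
  note xc = iso_cellsD[OF eval_movie_facts(3)[OF d]]
  have ww: "wf_word w" "wf_word (pcod w p)" using wf_path_wf_word[OF p(1)] by auto
  have b: "rep_path (braid V (word_obj w) (word_obj Z)) (w @ Z) [([], Beta w Z, [])]"
    "rep_path (braid V (word_obj (pcod w p)) (word_obj Z)) (pcod w p @ Z)
      [([], Beta (pcod w p) Z, [])]"
    using rep_path_Beta[OF rep_obj_word_obj rep_obj_word_obj] ww Z by auto
  have r1: "rep_cell ((word_obj Z \<unlhd> ?x) \<cdot>\<^sub>r braid V (word_obj w) (word_obj Z)) (w @ Z)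
    (([], Beta w Z, []) # ptens Z p []) (shift 1 Z [] ss)"
    using rep_rwhisk[OF rep_ltens[OF rep_obj_word_obj[OF Z] x] b(1)] ww
    by simp
  have r2: "rep_cell (braid V (word_obj (pcod w p)) (word_obj Z) \<cdot>\<^sub>l (?x \<unrhd> word_obj Z)) (w @ Z) ?q
    (shift 0 [] Z ss)"
    using rep_lwhisk[OF b(2) rep_rtens[OF x rep_obj_word_obj[OF Z]]] pcod_ptens[of "[]" w Z p]
      by simp
  have e: "((word_obj Z \<unlhd> ?x) \<cdot>\<^sub>r braid V (word_obj w) (word_obj Z)) \<bullet> braid1 V (eval_path w p)
    (word_obj Z)
      = braid1 V (eval_path w (outs p ss)) (word_obj Z)
        \<bullet> (braid V (word_obj (pcod w p)) (word_obj Z) \<cdot>\<^sub>l (?x \<unrhd> word_obj Z))"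
    using pseudonatural_transformation.comp_natural[OF braid1_pseudonatural eval_path_hom[OF p(1)]
      xc] Z word_obj_Obj by blast
  have L: "rep_cell (((word_obj Z \<unlhd> ?x) \<cdot>\<^sub>r braid V (word_obj w) (word_obj Z))
    \<bullet> braid1 V (eval_path w p) (word_obj Z)) (w @ Z) ?q (braid1_path 0 p Z @ shift 1 Z [] ss)"
    using rep_vcomp[OF P[THEN conjunct1] r1] P by simp
  have x0: "wf_movie (w @ Z) (ptens [] p Z) (shift 0 [] Z ss)"
    "outs (ptens [] p Z) (shift 0 [] Z ss) = ptens [] (outs p ss) Z"
    using shift_facts(1,2)[OF d, of "w @ Z" "[]" "[]" Z "[]"] p Z wf_path_ptens[of "[]" Z w p]
      by auto
  have o: "outs ?q (shift 0 [] Z ss) = ptens [] (outs p ss) Z @ [([], Beta (pcod w p) Z, [])]"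
    using outs_shift[OF x0(1), of "w @ Z" "[]" "[([], Beta (pcod w p) Z, [])]"] x0(2)
      wf_movie_wf_path[of "w @ Z" ?q] L
    by (auto simp: rep_cell_def shift_Nil dest: wf_movie_wf_path)
  have R: "rep_cell (braid1 V (eval_path w (outs p ss)) (word_obj Z)
    \<bullet> (braid V (word_obj (pcod w p)) (word_obj Z) \<cdot>\<^sub>l (?x \<unrhd> word_obj Z)))
      (w @ Z) ?q (shift 0 [] Z ss @ braid1_path 0 (outs p ss) Z)"
    by (rule rep_vcomp[OF r2 Q[THEN conjunct1]]) (use o in auto)
  have "outs (([], Beta w Z, []) # ptens Z p []) (shift 1 Z [] ss) = ([], Beta w Z, []) # ptens Z
    (outs p ss) []"
    using shift_facts(2)[OF d, of "w @ Z" "[([], Beta w Z, [])]" Z "[]" "[]"] r1 Z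
    by (auto simp: rep_cell_def dest: wf_movie_wf_path)
  then have "outs ?q (braid1_path 0 p Z @ shift 1 Z [] ss)
    = outs ?q (shift 0 [] Z ss @ braid1_path 0 (outs p ss) Z)"
    using o P Q by simp
  then show ?thesis unfolding braid1_nat_def valid.simps using rep_movie_eq[OF e L R] by simp
qed

lemma valid_braid2_nat:
  assumes Z: "wf_word Z" and d: "wf_movie w p ss"
  shows "valid (braid2_nat Z w p ss)"
proof -
  have p: "wf_path w p" "wf_path w (outs p ss)" "pcod w (outs p ss) = pcod w p"
    using d eval_movie_facts[OF d] wf_movie_wf_path by auto
  let ?q = "ptens Z p [] @ [([], Beta Z (pcod w p), [])]" and ?x = "eval_movie w p ss"
  note P = rep_braid2_path[OF Z p(1)] and Q = rep_braid2_path[OF Z p(2), unfolded p(3)]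
  have x: "rep_cell ?x w p ss" using d by (simp add: rep_cell_def)
  note xc = iso_cellsD[OF eval_movie_facts(3)[OF d]]
  have ww: "wf_word w" "wf_word (pcod w p)" using wf_path_wf_word[OF p(1)] by auto
  have b: "rep_path (braid V (word_obj Z) (word_obj w)) (Z @ w) [([], Beta Z w, [])]"
    "rep_path (braid V (word_obj Z) (word_obj (pcod w p))) (Z @ pcod w p)
      [([], Beta Z (pcod w p), [])]"
    using rep_path_Beta[OF rep_obj_word_obj rep_obj_word_obj] ww Z by auto
  have r1: "rep_cell ((?x \<unrhd> word_obj Z) \<cdot>\<^sub>r braid V (word_obj Z) (word_obj w)) (Z @ w)
    (([], Beta Z w, []) # ptens [] p Z) (shift 1 [] Z ss)"
    using rep_rwhisk[OF rep_rtens[OF x rep_obj_word_obj[OF Z]] b(1)] ww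
    by simp
  have r2: "rep_cell (braid V (word_obj Z) (word_obj (pcod w p)) \<cdot>\<^sub>l (word_obj Z \<unlhd> ?x)) (Z @ w) ?q
    (shift 0 Z [] ss)"
    using rep_lwhisk[OF b(2) rep_ltens[OF rep_obj_word_obj[OF Z] x]] pcod_ptens[of Z w "[]" p]
      by simp
  have e: "((?x \<unrhd> word_obj Z) \<cdot>\<^sub>r braid V (word_obj Z) (word_obj w)) \<bullet> braid2 V (word_obj Z)
    (eval_path w p)
      = braid2 V (word_obj Z) (eval_path w (outs p ss))
        \<bullet> (braid V (word_obj Z) (word_obj (pcod w p)) \<cdot>\<^sub>l (word_obj Z \<unlhd> ?x))"
    using pseudonatural_transformation.comp_natural[OF braid2_pseudonatural eval_path_hom[OF p(1)]
      xc] Z word_obj_Obj by blast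
  have L: "rep_cell (((?x \<unrhd> word_obj Z) \<cdot>\<^sub>r braid V (word_obj Z) (word_obj w))
    \<bullet> braid2 V (word_obj Z) (eval_path w p)) (Z @ w) ?q (braid2_path 0 Z p @ shift 1 [] Z ss)"
    using rep_vcomp[OF P[THEN conjunct1] r1] P by simp
  have x0: "wf_movie (Z @ w) (ptens Z p []) (shift 0 Z [] ss)"
    "outs (ptens Z p []) (shift 0 Z [] ss) = ptens Z (outs p ss) []"
    using shift_facts(1,2)[OF d, of "Z @ w" "[]" Z "[]" "[]"] p Z wf_path_ptens[of Z "[]" w p]
      by auto
  have o: "outs ?q (shift 0 Z [] ss) = ptens Z (outs p ss) [] @ [([], Beta Z (pcod w p), [])]"
    using outs_shift[OF x0(1), of "Z @ w" "[]" "[([], Beta Z (pcod w p), [])]"] x0(2)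
      wf_movie_wf_path[of "Z @ w" ?q] L
    by (auto simp: rep_cell_def shift_Nil dest: wf_movie_wf_path)
  have R: "rep_cell (braid2 V (word_obj Z) (eval_path w (outs p ss))
    \<bullet> (braid V (word_obj Z) (word_obj (pcod w p)) \<cdot>\<^sub>l (word_obj Z \<unlhd> ?x)))
      (Z @ w) ?q (shift 0 Z [] ss @ braid2_path 0 Z (outs p ss))"
    by (rule rep_vcomp[OF r2 Q[THEN conjunct1]]) (use o in auto)
  have "outs (([], Beta Z w, []) # ptens [] p Z) (shift 1 [] Z ss) = ([], Beta Z w, []) # ptens []
    (outs p ss) Z"
    using shift_facts(2)[OF d, of "Z @ w" "[([], Beta Z w, [])]" "[]" Z "[]"] r1 Z
    by (auto simp: rep_cell_def dest: wf_movie_wf_path)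
  then have "outs ?q (braid2_path 0 Z p @ shift 1 [] Z ss)
    = outs ?q (shift 0 Z [] ss @ braid2_path 0 Z (outs p ss))"
    using o P Q by simp
  then show ?thesis unfolding braid2_nat_def valid.simps using rep_movie_eq[OF e L R] by simp
qed

definition braid1_nat_gen where "braid1_nat_gen g Z = braid1_nat (gword g) (gsrc g) [(0, [], g, [])]
  Z"
definition braid2_nat_gen where "braid2_nat_gen X g = braid2_nat X (gword g) (gsrc g)
  [(0, [], g, [])]"

lemma valid_braid_nat_gen: assumes "wf_gen2 g" "wf_word Z" shows "valid (braid1_nat_gen g Z)"
  "valid (braid2_nat_gen Z g)"
  using valid_braid1_nat[of Z] valid_braid2_nat[of Z] assms rep_gen2[of g]
    by (auto simp: braid1_nat_gen_def braid2_nat_gen_def rep_cell_def)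

text \<open>
  In a movie, \<open>\<beta>\<^bsub>X,\<one>\<^esub>\<close> is still a layer, which has to be removed by an explicit identity cell.
\<close>

definition UnitR where "UnitR X = Gen2 (id2 V (id1 V (word_obj X))) X [([], Beta X [], [])] []"
definition UnitL where "UnitL X = Gen2 (id2 V (id1 V (word_obj X))) X [([], Beta [] X, [])] []"

lemma Unit_simps [simp]:
  "gword (UnitR X) = X" "gsrc (UnitR X) = [([], Beta X [], [])]" "gtrg (UnitR X) = []"
  "gword (UnitL X) = X" "gsrc (UnitL X) = [([], Beta [] X, [])]" "gtrg (UnitL X) = []"
  by (auto simp: UnitR_def UnitL_def)

lemma eval_layer_Beta_unit: "wf_word X \<Longrightarrow> eval_layer ([], Beta X [], []) = id1 V (word_obj X)"
  "wf_word X \<Longrightarrow> eval_layer ([], Beta [] X, []) = id1 V (word_obj X)"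
  using braid_unit_right[of "word_obj X"] braid_unit_left[of "word_obj X"]
    tn1_unit[of "id1 V (word_obj X)"] id1_hom[of "word_obj X"] homD
  by (auto simp: Beta_def word_obj_Obj)

lemma wf_gen2_Unit [simp]: "wf_word X \<Longrightarrow> wf_gen2 (UnitR X)" "wf_word X \<Longrightarrow> wf_gen2 (UnitL X)"
  using eval_layer_Beta_unit[of X] id1_hom[of "word_obj X"]
    comp1_id_left[OF id1_hom[of "word_obj X"]] word_obj_Obj[of X]
  by (auto simp: UnitR_def UnitL_def simp del: eval_layer.simps intro!: id2_iso dest: homD)

text \<open>At a unit letter \<open>R\<close> and \<open>S\<close> are identity cells, but the paths
  differ: \<open>Rcell X [] Z\<close> creates the layer \<open>Beta X []\<close> in front, and
  \<open>Scell [] X Z\<close> creates \<open>Beta [] Z\<close> behind, at layer 1. Each creation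
  undoes a \<open>UnitR\<close> or \<open>UnitL\<close>.\<close>

definition R_unit_rel where "R_unit_rel X Z = (X @ Z, [([], Beta X Z, [])],
  [(0, [], Rcell X [] Z, [])], [(0, [], invg (UnitR X), Z)])"
definition S_unit_rel where "S_unit_rel X Z = (X @ Z, [([], Beta X Z, [])],
  [(0, [], Scell [] X Z, [])], [(1, [], invg (UnitL Z), X)])"
text \<open>\<open>Beta [] Z\<close> is an identity 1-cell, so pseudonaturality at it is trivial by
  \<open>comp_id1\<close>. As a movie, that trivial cell deletes the layer before the braiding of
  \<open>X\<close> and \<open>Z\<close> and creates it again behind.\<close>

definition braid2_unit_rel
  where "braid2_unit_rel X Z = (X @ Z, [(X, Beta [] Z, []), ([], Beta X Z, [])],
  [(0, [], Beta2 X ([], Beta [] Z, []), [])], [(0, X, UnitL Z, []), (1, [], invg (UnitL Z), X)])"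

lemma inv2_id2: "f \<in> Arr V \<Longrightarrow> inv2 V (id2 V f) = id2 V f"
  using id2_cells[of f] vcomp_id_left[OF id2_cells[of f]]
    by (intro inv2_eqI) (simp add: is_inverse2_cells)

text \<open>All these movies have the identity of one braiding as value, and so have the cells with
  a unit letter; \<open>valid_units\<close> compares them through this common value.\<close>

lemma unit_cells:
  assumes X: "wf_word X" and Z: "wf_word Z"
  shows "rep_cell (id2 V (braid V (word_obj X) (word_obj Z))) (X @ Z) [([], Beta X Z, [])]
    [(0, [], invg (UnitR X), Z)]"
    "rep_cell (id2 V (braid V (word_obj X) (word_obj Z))) (X @ Z) [([], Beta X Z, [])]
      [(1, [], invg (UnitL Z), X)]"
    "rep_cell (id2 V (braid V (word_obj X) (word_obj Z))) (X @ Z) [(X, Beta [] Z, []),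
      ([], Beta X Z, [])] [(0, X, UnitL Z, [])]"
proof -
  have O: "word_obj X \<in> Obj V" "word_obj Z \<in> Obj V" using assms word_obj_Obj by auto
  have b: "braid V (word_obj X) (word_obj Z) \<in> hom V (word_obj X \<otimes> word_obj Z)
    (word_obj Z \<otimes> word_obj X)"
    using wf_gen1_words(3)[OF wf_gen1_Beta[OF X Z]] X Z by (simp add: Beta_def word_obj_append)
  have i: "id1 V A \<in> Arr V" if "A \<in> Obj V" for A using id1_hom[OF that] homD by blast
  note t = two_endofunctor.F2_id2[OF rtens_functor] two_endofunctor.F1_id1[OF rtens_functor]
    two_endofunctor.F2_id2[OF ltens_functor] two_endofunctor.F1_id1[OF ltens_functor]
  have l: "braid V (word_obj X) (word_obj Z) \<cdot>\<^sub>l id2 V (id1 V (word_obj X \<otimes> word_obj Z))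
    = id2 V (braid V (word_obj X) (word_obj Z))"
    using lwhisk_id2[OF id1_hom b] comp1_id_right[OF b] O by (simp add: tens_Obj)
  have r: "id2 V (id1 V (word_obj Z \<otimes> word_obj X)) \<cdot>\<^sub>r braid V (word_obj X) (word_obj Z)
    = id2 V (braid V (word_obj X) (word_obj Z))"
    using rwhisk_id2[OF b id1_hom] comp1_id_left[OF b] O by (simp add: tens_Obj)
  have j: "rep_cell (id2 V (id1 V (word_obj X))) X [([], Beta X [], [])] [(0, [], UnitR X, [])]"
    "rep_cell (id2 V (id1 V (word_obj Z))) Z [([], Beta [] Z, [])] [(0, [], UnitL Z, [])]"
    using rep_gen2[OF wf_gen2_Unit(1)[OF X]] rep_gen2[OF wf_gen2_Unit(2)[OF Z]]
      by simp_all (simp_all add: UnitR_def UnitL_def)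
  have j': "rep_cell (id2 V (id1 V (word_obj X))) X [] [(0, [], invg (UnitR X), [])]"
    "rep_cell (id2 V (id1 V (word_obj Z))) Z [] [(0, [], invg (UnitL Z), [])]"
    using rep_inv[OF j(1)] rep_inv[OF j(2)] inv2_id2 i O by (simp_all add: out.simps)
  show "rep_cell (id2 V (braid V (word_obj X) (word_obj Z))) (X @ Z) [([], Beta X Z, [])]
    [(0, [], invg (UnitR X), Z)]"
    using rep_lwhisk[OF rep_path_Beta[OF rep_obj_word_obj rep_obj_word_obj]
      rep_rtens[OF j'(1) rep_obj_word_obj], of X Z Z] t i O X Z l by simp
  show "rep_cell (id2 V (braid V (word_obj X) (word_obj Z))) (X @ Z) [([], Beta X Z, [])]
    [(1, [], invg (UnitL Z), X)]"
    using rep_rwhisk[OF rep_rtens[OF j'(2) rep_obj_word_obj]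
      rep_path_Beta[OF rep_obj_word_obj rep_obj_word_obj], of X X Z] t i O X Z r by simp
  show "rep_cell (id2 V (braid V (word_obj X) (word_obj Z))) (X @ Z) [(X, Beta [] Z, []),
    ([], Beta X Z, [])] [(0, X, UnitL Z, [])]"
    using rep_lwhisk[OF rep_path_Beta[OF rep_obj_word_obj rep_obj_word_obj]
      rep_ltens[OF rep_obj_word_obj j(2)], of X Z X] t i O X Z l by simp
qed

lemma valid_units:
  assumes X: "wf_word X" and Z: "wf_word Z"
  shows "valid (R_unit_rel X Z)" "valid (S_unit_rel X Z)" "valid (braid2_unit_rel X Z)"
proof -
  have O: "word_obj X \<in> Obj V" "word_obj Z \<in> Obj V" using assms word_obj_Obj by auto
  note u = unit_cells[OF X Z]
  have "rep_cell (id2 V (braid V (word_obj X) (word_obj Z))) (X @ Z) [([], Beta X Z, [])]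
    [(0, [], Rcell X [] Z, [])]"
    using rep_braidR[OF rep_obj_word_obj[OF X] rep_obj_unit rep_obj_word_obj[OF Z]]
      R_unit[of "word_obj X" "\<one>" "word_obj Z"] O
    by (simp add: unit_Obj unit_left0)
  from rep_movie_eq[OF refl this u(1)] show "valid (R_unit_rel X Z)"
    by (simp add: R_unit_rel_def out.simps)
  have "rep_cell (id2 V (braid V (word_obj X) (word_obj Z))) (X @ Z) [([], Beta X Z, [])]
    [(0, [], Scell [] X Z, [])]"
    using rep_braidS[OF rep_obj_unit rep_obj_word_obj[OF X] rep_obj_word_obj[OF Z]] S_unit[of "\<one>"
      "word_obj X" "word_obj Z"] O
    by (simp add: unit_Obj unit_left0)
  from rep_movie_eq[OF refl this u(2)] show "valid (S_unit_rel X Z)"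
    by (simp add: S_unit_rel_def out.simps)
  have "rep_layer (id1 V (word_obj Z)) ([], Beta [] Z, [])"
    using eval_layer_Beta_unit(2)[OF Z] Z by (simp add: rep_layer_def)
  from rep_braid2[OF rep_obj_word_obj[OF X] this]
  have 1: "rep_cell (id2 V (braid V (word_obj X) (word_obj Z))) (X @ Z) [(X, Beta [] Z, []),
    ([], Beta X Z, [])] [(0, [], Beta2 X ([], Beta [] Z, []), [])]"
    using pseudonatural_transformation.comp_id1[OF braid2_pseudonatural] O by simp
  have "braid V (word_obj X) (word_obj Z) \<in> Arr V"
    using homD(1)[OF wf_gen1_words(3)[OF wf_gen1_Beta[OF X Z]]] by (simp add: Beta_def)
  then have "id2 V (braid V (word_obj X) (word_obj Z)) \<bullet> id2 V (braid V (word_obj X) (word_obj Z))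
    = id2 V (braid V (word_obj X) (word_obj Z))"
    using vcomp_id_left[OF id2_cells] by blast
  then have 2: "rep_cell (id2 V (braid V (word_obj X) (word_obj Z))) (X @ Z) [(X, Beta [] Z, []),
    ([], Beta X Z, [])] [(0, X, UnitL Z, []), (1, [], invg (UnitL Z), X)]"
    using rep_vcomp[OF u(3,2)] by (simp add: out.simps)
  from rep_movie_eq[OF refl 1 2] show "valid (braid2_unit_rel X Z)"
    by (simp add: braid2_unit_rel_def out.simps)
qed

section \<open>Comparison of the two half twists\<close>

text \<open>\<open>S\<close> splits the second braiding, at layer 1. Layers 0 and 1 then take
  \<open>X\<close> past \<open>Y\<close> and past \<open>Z\<close>, so \<open>R\<close> inverse
  joins them to \<open>Beta X (Y @ Z)\<close>, and the last step moves this past the braiding of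
  \<open>Y\<close> and \<open>Z\<close>.\<close>

definition theta where "theta X Y Z =
  [(1, [], Scell Y X Z, []), (0, [], invg (Rcell X Y Z), []),
    (0, [], invg (Beta2 X ([], Beta Y Z, [])), [])]"

definition theta_unit where "theta_unit X Z = (X @ Z, [([], Beta X [], Z), ([], Beta X Z, [])],
  theta X [] Z, [(0, [], UnitR X, Z), (0, X, invg (UnitL Z), [])])"

lemma valid_run:
  "wf_movie w p ss \<Longrightarrow> run w p ss ms = Some tt \<Longrightarrow> list_all move_ok ms \<Longrightarrow> valid (w, p, ss, tt)"
  using run_sound by simp

text \<open>With an empty middle word \<open>R\<close> and \<open>S\<close> only create or delete
  unit braidings, and naturality at a unit braiding is trivial. What survives is the deletion of
  \<open>Beta X []\<close> and the creation of \<open>Beta [] Z\<close>.\<close>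

lemma valid_theta_unit:
  assumes w: "wf_word X" "wf_word Z"
  shows "valid (theta_unit X Z)"
  unfolding theta_unit_def theta_def
  apply (rule valid_run[where ms = "[Rel 1 0 [] [] (arc (flip (R_unit_rel X Z)) 1 1),
    Rel 0 1 [] [] (arc (S_unit_rel X Z) 0 1),
    Rel 0 1 [] [] (arc (flip (braid2_unit_rel X Z)) 1 1),
    Swap 1,
    Rel 2 0 [] [] (cancel (Beta2 X ([], Beta [] Z, []))),
    Swap 0]"])
    \<comment> \<open>The three goals are, in order: the movie is well-formed, the certificate runs
      to the stated result, and the relations in it are valid.\<close>
    apply (simp add: w wf_step.simps out.simps)
   apply (simp add: w out.simps R_unit_rel_def S_unit_rel_def braid2_unit_rel_def eval_nat_numeral
     Let_def)
  apply (simp add: w valid_arc valid_units valid_cancel del: valid.simps arc.simps flip.simps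
    cancel.simps)
  done

text \<open>The common movie \<open>uu\<close> never has to be written down: running the first
  certificate determines it, and running the second one confirms it.\<close>

lemma valid_run2:
  "wf_movie w p ss \<Longrightarrow> wf_movie w p tt \<Longrightarrow> run w p ss ms = Some uu \<Longrightarrow> run w p tt ns = Some uu
    \<Longrightarrow> list_all move_ok ms \<Longrightarrow> list_all move_ok ns \<Longrightarrow> valid (w, p, ss, tt)"
  using movie_eq_trans[OF run_sound movie_eq_sym[OF run_sound]] by simp

definition theta_nat1 where "theta_nat1 f Y Z =
  (gdom f @ Y @ Z, [([], f, Y @ Z), ([], Beta (gcod f) Y, Z), ([], Beta (Y @ gcod f) Z, [])],
   [(0, [], Beta1 ([], f, []) Y, Z), (1, [], Beta1 (Y, f, []) Z, [])] @ theta (gdom f) Y Z,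
   shift 1 [] [] (theta (gcod f) Y Z)
     @ [(0, [], invg (Sig f [] (Beta Y Z)), []), (1, [], Beta1 ([], f, []) (Z @ Y), [])])"

text \<open>\<open>f\<close> is the middle variable of \<open>S\<close> and the first of
  \<open>R\<close>. It is independent of the braiding of \<open>Y\<close> and \<open>Z\<close>, so
  the last cell of \<theta> needs naturality of \<beta> at an interchanger.\<close>

lemma valid_theta_nat1:
  assumes f: "wf_gen1 f" and w: "wf_word Y" "wf_word Z"
  shows "valid (theta_nat1 f Y Z)"
  unfolding theta_nat1_def
  apply (rule valid_run[where ms = "[Rel 1 1 [] [] (arc (S_nat2 Y f Z) 0 2)] @
    map Swap [0, 3] @
    [Rel 1 0 [] [] (arc (flip (R_nat1 f Y Z)) 1 3),
      Rel 2 0 [] [] (arc (flip (interch_rel f (Beta Y Z))) 2 2),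
      Rel 5 0 [] [] (cancel (Beta2 (gdom f) ([], Beta Y Z, [])))]"])
    apply (simp add: f wf_gen1_words[OF f] w theta_def wf_step.simps out.simps)
   apply (simp add: f wf_gen1_words[OF f] w theta_def movie_simps S_nat2_def R_nat1_def
     interch_rel_def)
  apply (simp add: f wf_gen1_words[OF f] w valid_arc valid_cancel valid_S_nat2 valid_R_nat1
    valid_interch_rel del: relation_simps)
  done

definition theta_nat2 where "theta_nat2 X f Z =
  (X @ gdom f @ Z, [(X, f, Z), ([], Beta X (gcod f), Z), ([], Beta (gcod f @ X) Z, [])],
   [(0, [], Beta2 X ([], f, []), Z), (1, [], Beta1 ([], f, X) Z, [])] @ theta X (gdom f) Z,
   shift 1 [] [] (theta X (gcod f) Z)
     @ [(0, X, Beta1 ([], f, []) Z, []), (1, [], Beta2 X (Z, f, []), [])])"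

text \<open>\<open>f\<close> is the first variable of \<open>S\<close> and the middle one of
  \<open>R\<close>. It also enters the braiding of the last two letters, so the last cell of
  \<theta> needs naturality of \<beta> at the 2-cell \<open>Beta1 ([], f, []) Z\<close>.\<close>

lemma valid_theta_nat2:
  assumes f: "wf_gen1 f" and w: "wf_word X" "wf_word Z"
  shows "valid (theta_nat2 X f Z)"
  unfolding theta_nat2_def
  apply (rule valid_run[where ms = "[Rel 1 1 [] [] (arc (S_nat1 f X Z) 0 2)] @
    map Swap [0, 3] @
    [Rel 1 0 [] [] (arc (flip (R_nat2 X f Z)) 1 3),
      Rel 2 0 [] [] (arc (braid2_nat_gen X (Beta1 ([], f, []) Z)) 1 2),
      Rel 5 0 [] [] (cancel (Beta2 X ([], Beta (gdom f) Z, [])))]"])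
    apply (simp add: f wf_gen1_words[OF f] w theta_def wf_step.simps out.simps)
   apply (simp add: f wf_gen1_words[OF f] w theta_def movie_simps S_nat1_def R_nat2_def
     braid2_nat_gen_def braid2_nat_def)
  apply (simp add: f wf_gen1_words[OF f] w valid_arc valid_cancel valid_S_nat1 valid_R_nat2
    valid_braid_nat_gen del: relation_simps)
  done

definition theta_nat3 where "theta_nat3 X Y f =
  (X @ Y @ gdom f, [(X @ Y, f, []), ([], Beta X Y, gcod f), ([], Beta (Y @ X) (gcod f), [])],
   [(0, [], Sig (Beta X Y) [] f, []), (1, [], Beta2 (Y @ X) ([], f, []), [])] @ theta X Y (gdom f),
   shift 1 [] [] (theta X Y (gcod f))
     @ [(0, X, Beta2 Y ([], f, []), []), (1, [], Beta2 X ([], f, Y), [])])"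

text \<open>\<open>f\<close> is the last variable of both \<open>S\<close> and \<open>R\<close>, and
  the 2-cell at which \<beta> is natural is now \<open>Beta2 Y ([], f, [])\<close>.\<close>

lemma valid_theta_nat3:
  assumes f: "wf_gen1 f" and w: "wf_word X" "wf_word Y"
  shows "valid (theta_nat3 X Y f)"
  unfolding theta_nat3_def
  apply (rule valid_run[where ms = "[Rel 1 1 [] [] (arc (S_nat3 Y X f) 0 2)] @
    map Swap [0, 3] @
    [Rel 1 0 [] [] (arc (flip (R_nat3 X Y f)) 1 3),
      Rel 2 0 [] [] (arc (braid2_nat_gen X (Beta2 Y ([], f, []))) 1 2),
      Rel 5 0 [] [] (cancel (Beta2 X ([], Beta Y (gdom f), [])))]"])
    apply (simp add: f wf_gen1_words[OF f] w theta_def wf_step.simps out.simps)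
   apply (simp add: f wf_gen1_words[OF f] w theta_def movie_simps S_nat3_def R_nat3_def
     braid2_nat_gen_def braid2_nat_def)
  apply (simp add: f wf_gen1_words[OF f] w valid_arc valid_cancel valid_S_nat3 valid_R_nat3
    valid_braid_nat_gen del: relation_simps)
  done

text \<open>Both sides lead from \<open>((WX)Y)Z\<close> to \<open>W(X(YZ))\<close>, through \<open>W((XY)Z)\<close> and through \<open>(WX)(YZ)\<close>.\<close>

definition pentagon where "pentagon W X Y Z =
  (W @ X @ Y @ Z, [([], Beta W X, Y @ Z), ([], Beta (X @ W) Y, Z), ([], Beta (Y @ X @ W) Z, [])],
   shift 0 [] Z (theta W X Y) @ shift 1 [] [] (theta W (Y @ X) Z) @ shift 0 W [] (theta X Y Z),
   shift 1 [] [] (theta (X @ W) Y Z) @ [(0, [], invg (Sig (Beta W X) [] (Beta Y Z)), [])]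
     @ shift 1 [] [] (theta W X (Z @ Y)))"

text \<open>On the left, naturality of the braiding of \<open>W\<close> at \<theta> and of
  \<open>R\<close> at the braiding of \<open>X\<close> and \<open>Y\<close> prepares the three
  braiding axioms. Each is used once, at the letters W X Y Z for \<open>R\<close>, Y X W Z for
  \<open>S\<close> and X W Y Z for both, which are orders met during the reversal. The right side
  only needs naturality of \<open>S\<close> and \<open>R\<close> at the braiding of \<open>Y\<close>
  and \<open>Z\<close>.\<close>

lemma valid_pentagon:
  assumes w: "wf_word W" "wf_word X" "wf_word Y" "wf_word Z"
  shows "valid (pentagon W X Y Z)"
  unfolding pentagon_def
  apply (rule valid_run2[where ms
    = "[Rel 6 0 [] []
    (arc (flip (braid2_nat W (X @ Y @ Z) ([([], Beta X Y, Z), ([], Beta (Y @ X) Z, [])])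
    (theta X Y Z))) 0 3),
      Rel 5 1 [] [] (cancel' (Beta2 W ([], Beta (Y @ X) Z, [])))] @
    map Swap [2] @
    [Rel 3 0 [] [] (arc (R_nat2 W (Beta X Y) Z) 3 3)] @
    map Swap [1, 2] @
    [Rel 3 0 [] [] (arc (flip (RR_rel W X Y Z)) 2 2)] @
    map Swap [4, 3, 2] @
    [Rel 1 3 [] [] (arc (SS_rel Y X W Z) 0 2)] @
    map Swap [0, 5, 4] @
    [Rel 1 1 [] [] (arc (RS_rel X W Y Z) 1 5)] @
    map Swap [3]"
    and ns = "map Swap [3] @
    [Rel 2 1 [] [] (arc (flip (S_nat3 X W (Beta Y Z))) 4 2),
      Rel 4 0 [] [] (arc (R_nat3 W X (Beta Y Z)) 2 3)]"])
       apply (simp add: w theta_def wf_step.simps out.simps)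
      apply (simp add: w theta_def wf_step.simps out.simps)
     apply (simp add: w theta_def movie_simps braid2_nat_def R_nat2_def RR_rel_def SS_rel_def
       RS_rel_def S_nat3_def R_nat3_def)
    apply (simp add: w theta_def movie_simps braid2_nat_def R_nat2_def RR_rel_def SS_rel_def
      RS_rel_def S_nat3_def R_nat3_def)
   apply (simp add: w valid_arc valid_cancel valid_braid2_nat valid_R_nat2 valid_RR_rel valid_SS_rel
     valid_RS_rel valid_S_nat3 valid_R_nat3 theta_def wf_step.simps out.simps del: relation_simps)
  apply (simp add: w valid_arc valid_cancel valid_braid2_nat valid_R_nat2 valid_RR_rel valid_SS_rel
    valid_RS_rel valid_S_nat3 valid_R_nat3 theta_def wf_step.simps out.simps del: relation_simps)
  done

end

section \<open>The opposite of an enriched bicategory\<close>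

locale enriched = semistrict_braided_monoidal_bicategory V + v_bicategory V C
  for V :: "('o, 'm, 'c, 'z) braided_gray_scheme" (structure)
    and C :: "('a, 'o, 'm, 'c) v_bicat"
begin

abbreviation H where "H \<equiv> homobj C"

section \<open>Generators and axioms of the enriched bicategory\<close>

definition mult1 where "mult1 c d e = Gen1 (mult C c d e) [H d e, H c d] [H c e]"
definition unit1 where "unit1 c = Gen1 (unit C c) [] [H c c]"
definition assoc2 where "assoc2 c d e f = Gen2 (assoc C c d e f) [H e f, H d e, H c d]
  [([], mult1 d e f, [H c d]), ([], mult1 c d f, [])] [([H e f], mult1 c d e, []),
    ([], mult1 c e f, [])]"
definition lunitor2 where "lunitor2 c d = Gen2 (lunitor C c d) [H c d] [([], unit1 d, [H c d]),
  ([], mult1 c d d, [])] []"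
definition runitor2 where "runitor2 c d = Gen2 (runitor C c d) [H c d] [([H c d], unit1 c, []),
  ([], mult1 c c d, [])] []"

lemma enriched_gen_simps [simp]:
  "gdom (mult1 c d e) = [H d e, H c d]" "gcod (mult1 c d e) = [H c e]" "gdom (unit1 c) = []"
    "gcod (unit1 c) = [H c c]"
  "gword (assoc2 c d e f) = [H e f, H d e, H c d]"
  "gsrc (assoc2 c d e f) = [([], mult1 d e f, [H c d]), ([], mult1 c d f, [])]"
  "gtrg (assoc2 c d e f) = [([H e f], mult1 c d e, []), ([], mult1 c e f, [])]"
  "gword (lunitor2 c d) = [H c d]" "gsrc (lunitor2 c d)
    = [([], unit1 d, [H c d]), ([], mult1 c d d, [])]" "gtrg (lunitor2 c d) = []"
  "gword (runitor2 c d) = [H c d]" "gsrc (runitor2 c d)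
    = [([H c d], unit1 c, []), ([], mult1 c c d, [])]" "gtrg (runitor2 c d) = []"
  by (auto simp: mult1_def unit1_def assoc2_def lunitor2_def runitor2_def)

lemma wf_gen1_g [simp]:
  "c \<in> objs C \<Longrightarrow> d \<in> objs C \<Longrightarrow> e \<in> objs C \<Longrightarrow> wf_gen1 (mult1 c d e)"
  "c \<in> objs C \<Longrightarrow> wf_gen1 (unit1 c)"
  using mult_hom unit_hom by (auto simp: mult1_def unit1_def wf_gen1_def homobj_Obj unit_right0)

lemma rep_obj_H: "c \<in> objs C \<Longrightarrow> d \<in> objs C \<Longrightarrow> rep_obj (H c d) [H c d]"
  by (simp add: rep_obj_single homobj_Obj)

lemma rep_layer_mult: "c \<in> objs C \<Longrightarrow> d \<in> objs C \<Longrightarrow> e \<in> objs C \<Longrightarrow> rep_layer (mult C c d e)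
  ([], mult1 c d e, [])"
  using rep_layer_arr[of "mult1 c d e"] by (simp del: enriched_gen_simps) (simp add: mult1_def)

lemma rep_layer_unit: "c \<in> objs C \<Longrightarrow> rep_layer (unit C c) ([], unit1 c, [])"
  using rep_layer_arr[of "unit1 c"] by (simp del: enriched_gen_simps) (simp add: unit1_def)

lemma rep_path_mult: "c \<in> objs C \<Longrightarrow> d \<in> objs C \<Longrightarrow> e \<in> objs C \<Longrightarrow> rep_path (mult C c d e) [H d e, H c d]
  [([], mult1 c d e, [])]"
  using rep_path_layer[OF rep_layer_mult] by simp

lemma rep_path_unit: "c \<in> objs C \<Longrightarrow> rep_path (unit C c) [] [([], unit1 c, [])]"
  using rep_path_layer[OF rep_layer_unit] by simp

lemmas rep_rules_C = rep_rules rep_obj_H rep_layer_mult rep_layer_unit rep_path_mult rep_path_unit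

lemma wf2I:
  "x \<in> iso_cells V f g \<Longrightarrow> rep_path f w p \<Longrightarrow> rep_path g w q \<Longrightarrow> pcod w p = pcod w q \<Longrightarrow>
    wf_gen2 (Gen2 x w p q)"
  by (simp add: rep_path_def)

lemma wf_gen2_assoc2 [simp]:
  assumes o: "c \<in> objs C" "d \<in> objs C" "e \<in> objs C" "f \<in> objs C"
  shows "wf_gen2 (assoc2 c d e f)"
  unfolding assoc2_def
  by (rule wf2I[OF assoc_iso[OF o]],
    (rule rep_path_conv, (rule rep_rules_C | (simp add: o homobj_Obj; fail))+)+)

lemma wf_gen2_lunitor2 [simp]:
  assumes o: "c \<in> objs C" "d \<in> objs C"
  shows "wf_gen2 (lunitor2 c d)" "wf_gen2 (runitor2 c d)"
  unfolding lunitor2_def runitor2_def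
  by (rule wf2I[OF lunitor_iso[OF o]] wf2I[OF runitor_iso[OF o]],
      (rule rep_path_conv, (rule rep_rules_C | (simp add: o homobj_Obj; fail))+)+)+

lemma rep_assoc:
  "c \<in> objs C \<Longrightarrow> d \<in> objs C \<Longrightarrow> e \<in> objs C \<Longrightarrow> f \<in> objs C \<Longrightarrow>
    rep_cell (assoc C c d e f) [H e f, H d e, H c d] [([], mult1 d e f, [H c d]),
      ([], mult1 c d f, [])] [(0, [], assoc2 c d e f, [])]"
  using rep_gen2[OF wf_gen2_assoc2[of c d e f]] by simp (simp add: assoc2_def)

lemma rep_lunitor:
  "c \<in> objs C \<Longrightarrow> d \<in> objs C \<Longrightarrow>
    rep_cell (lunitor C c d) [H c d] [([], unit1 d, [H c d]), ([], mult1 c d d, [])]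
      [(0, [], lunitor2 c d, [])]"
  using rep_gen2[OF wf_gen2_lunitor2(1)[of c d]] by simp (simp add: lunitor2_def)

lemma rep_runitor:
  "c \<in> objs C \<Longrightarrow> d \<in> objs C \<Longrightarrow>
    rep_cell (runitor C c d) [H c d] [([H c d], unit1 c, []), ([], mult1 c c d, [])]
      [(0, [], runitor2 c d, [])]"
  using rep_gen2[OF wf_gen2_lunitor2(2)[of c d]] by simp (simp add: runitor2_def)

lemmas rep_rules_C_cells = rep_rules_C rep_assoc rep_lunitor rep_runitor

text \<open>This is (AC) of \<open>C\<close> at \<open>f\<close>, \<open>e\<close>,
  \<open>d\<close>, \<open>c\<close>, \<open>b\<close>. The letters of the opposite start in the
  order \<open>H f e\<close>, \<open>H e d\<close>, \<open>H d c\<close>, \<open>H c b\<close>; only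
  after complete reversal do they stand as \<open>C\<close> multiplies them.\<close>

definition AC_rel where "AC_rel b c d e f =
  ([H c b, H d c, H e d, H f e], [([], mult1 d c b, [H e d, H f e]), ([], mult1 e d b, [H f e]),
    ([], mult1 f e b, [])],
   [(0, [], assoc2 e d c b, [H f e]),
     (1, [], assoc2 f e c b, []),
     (0, [H c b], assoc2 f e d c, [])],
   [(1, [], assoc2 f e d b, []),
     (0, [], invg (Sig (mult1 d c b) [] (mult1 f e d)), []),
     (1, [], assoc2 f d c b, [])])"

lemma valid_AC_rel:
  assumes o: "b \<in> objs C" "c \<in> objs C" "d \<in> objs C" "e \<in> objs C" "f \<in> objs C"
  shows "valid (AC_rel b c d e f)"
  unfolding AC_rel_def valid.simps
  by (rule rep_movie_eq[OF AC[OF o(5,4,3,2,1)]],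
    (rule rep_conv, (rule rep_rules_C_cells | (simp add: o homobj_Obj out.simps; fail))+)+)

definition IC_rel where "IC_rel c d e =
  ([H d c, H e d], [([H d c], unit1 d, [H e d]), ([], mult1 d d c, [H e d]), ([], mult1 e d c, [])],
   [(1, [], assoc2 e d d c, []),
     (0, [H d c], lunitor2 e d, [])],
   [(0, [], runitor2 d c, [H e d])])"

lemma valid_IC_rel:
  assumes o: "c \<in> objs C" "d \<in> objs C" "e \<in> objs C"
  shows "valid (IC_rel c d e)"
  unfolding IC_rel_def valid.simps
  by (rule rep_movie_eq[OF IC[of e d c]], (simp add: o)+,
    (rule rep_conv, (rule rep_rules_C_cells | (simp add: o homobj_Obj out.simps; fail))+)+)

definition op_path
  where "op_path c d e f = [([], Beta [H f e] [H e d], [H d c]), ([], mult1 f e d, [H d c]),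
  ([], Beta [H f d] [H d c], []), ([], mult1 f d c, [])]"

text \<open>The cells \<open>S\<close>, \<open>R\<close> inverse and naturality at a braiding
  occurring in the opposite associator are exactly \<open>theta\<close>. It acts at the start of the
  path because the first step has moved the multiplication away from between the two
  braidings.\<close>

definition op_movie where "op_movie c d e f =
  [(1, [], Beta1 ([], mult1 f e d, []) [H d c], []), (2, [], invg (assoc2 f e d c), [])]
  @ theta [H f e] [H e d] [H d c]
  @ [(1, [], invg (Beta2 [H f e] ([], mult1 e d c, [])), [])]"

lemma rep_op_assoc:
  assumes o: "c \<in> objs C" "d \<in> objs C" "e \<in> objs C" "f \<in> objs C"
  shows "rep_cell (op_assoc V C c d e f) [H f e, H e d, H d c] (op_path c d e f) (op_movie c d e f)"
  unfolding op_assoc_def Let_def op_path_def op_movie_def theta_def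
  by (rule rep_conv, (rule rep_rules_C_cells | (simp add: o homobj_Obj out.simps; fail))+)

text \<open>The four inverse interchangers on the right are those of \<open>op_Sigma\<close> in
  reverse order: together they invert the interchanger of two composites of \<beta> and
  multiplication.\<close>

definition AC_op where "AC_op b c d e f =
  ([H f e, H e d, H d c, H c b],
   [([], Beta [H f e] [H e d], [H d c, H c b]), ([], mult1 f e d, [H d c, H c b]),
    ([], Beta [H f d] [H d c], [H c b]), ([], mult1 f d c, [H c b]),
    ([], Beta [H f c] [H c b], []), ([], mult1 f c b, [])],
   shift 0 [] [H c b] (op_movie c d e f) @ shift 2 [] [] (op_movie b c e f)
     @ shift 0 [H f e] [] (op_movie b c d e),
   shift 2 [] [] (op_movie b c d f) @
   [(1, [], invg (Sig (mult1 f e d) [] (Beta [H d c] [H c b])), []),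
    (2, [], invg (Sig (mult1 f e d) [] (mult1 d c b)), []),
    (0, [], invg (Sig (Beta [H f e] [H e d]) [] (Beta [H d c] [H c b])), []),
    (1, [], invg (Sig (Beta [H f e] [H e d]) [] (mult1 d c b)), [])] @
   shift 2 [] [] (op_movie b d e f))"

text \<open>
  The first certificate transports the left-hand side by the naturality of \<open>\<beta>\<close> at associators and of
  \<open>\<theta>\<close> in its middle variable, and then applies (AC) for \<open>C\<close> and the pentagon. The second one brings
  the right-hand side to the same form by the naturality of \<open>\<theta>\<close> in its outer variables.
\<close>

lemma valid_AC_op:
  assumes obs: "b \<in> objs C" "c \<in> objs C" "d \<in> objs C" "e \<in> objs C" "f \<in> objs C"
  shows "valid (AC_op b c d e f)"
proof -
  note facts = obs homobj_Obj
  show ?thesis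
    unfolding AC_op_def
    \<comment> \<open>When (AC) and the pentagon are applied, the path consists of three braidings
      followed by three multiplications; hence layer 3 for (AC) and layer 0 for the
      pentagon.\<close>
    apply (rule valid_run2[where ms = "map Swap [1, 2, 3, 5] @
    [Rel 4 2 [] [] (arc (braid1_nat_gen (assoc2 f e d c) [H c b]) 5 2)] @
    map Swap [8, 7, 13] @
    [Rel 8 1 [] [] (arc (flip (theta_nat2 [H f e] (mult1 e d c) [H c b])) 8 6),
      Rel 11 2 [] [] (arc (braid2_nat_gen [H f e] (assoc2 e d c b)) 3 3)] @
    map Swap [7, 6, 8, 7, 9, 8] @
    [Rel 9 3 [] [] (arc (flip (AC_rel b c d e f)) 3 3)] @
    map Swap [3, 2, 1, 4, 3, 2, 8, 7, 6, 5, 4, 3, 9, 8, 7, 6, 5, 4, 10, 9, 8, 7, 6, 5, 13, 14, 15,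
      12, 13, 14] @
    [Rel 6 0 [] [] (arc (pentagon [H f e] [H e d] [H d c] [H c b]) 0 9)] @
    map Swap [0, 2, 1, 5, 4, 6, 5, 7, 6, 8, 7, 14]"
      and ns = "map Swap [5] @
    [Rel 2 1 [] [] (arc (flip (theta_nat1 (mult1 f e d) [H d c] [H c b])) 0 4)] @
    map Swap [9, 8, 7, 11] @
    [Rel 8 2 [] [] (arc (interch_rel (mult1 f e d) (mult1 d c b)) 3 4)] @
    map Swap [10, 9] @
    [Rel 10 1 [] [] (arc (flip (theta_nat3 [H f e] [H e d] (mult1 d c b))) 8 5)]"])
         apply (simp add: facts op_movie_def theta_def wf_step.simps out.simps)
        apply (simp add: facts op_movie_def theta_def wf_step.simps out.simps)
       apply (simp add: facts movie_simps braid1_nat_gen_def braid1_nat_def braid2_nat_gen_def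
         braid2_nat_def theta_nat1_def theta_nat2_def theta_nat3_def pentagon_def interch_rel_def
         AC_rel_def op_movie_def theta_def)
      apply (simp add: facts movie_simps braid1_nat_gen_def braid1_nat_def braid2_nat_gen_def
        braid2_nat_def theta_nat1_def theta_nat2_def theta_nat3_def pentagon_def interch_rel_def
        AC_rel_def op_movie_def theta_def)
     apply (simp add: facts valid_arc valid_cancel valid_braid_nat_gen valid_theta_nat1
       valid_theta_nat2 valid_theta_nat3 valid_pentagon valid_interch_rel valid_AC_rel
       del: relation_simps)
    apply (simp add: facts valid_arc valid_cancel valid_braid_nat_gen valid_theta_nat1
      valid_theta_nat2 valid_theta_nat3 valid_pentagon valid_interch_rel valid_AC_rel
      del: relation_simps)
    done
qed

definition IC_op where "IC_op c d e =
  ([H e d, H d c], [([H e d], unit1 d, [H d c]), ([], Beta [H e d] [H d d], [H d c]),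
    ([], mult1 e d d, [H d c]),
    ([], Beta [H e d] [H d c], []), ([], mult1 e d c, [])],
   shift 1 [] [] (op_movie c d d e) @
   [(0, [H e d], Beta1 ([], unit1 d, []) [H d c], []),
    (0, [H e d], UnitL [H d c], []),
    (0, [H e d], runitor2 d c, [])],
   [(0, [], Beta2 [H e d] ([], unit1 d, []), [H d c]),
    (0, [], UnitR [H e d], [H d c]),
    (0, [], lunitor2 e d, [H d c])])"

text \<open>Moving the unit through \<theta> in its middle variable leaves \<theta> at an empty
  word, which \<open>theta_unit\<close> trivialises. The opposite interchanges the two unitors, so
  naturality of \<beta> is needed at \<open>runitor2 d c\<close> before (IC) of \<open>C\<close> and
  at \<open>lunitor2 e d\<close> after it.\<close>

lemma valid_IC_op:
  assumes obs: "c \<in> objs C" "d \<in> objs C" "e \<in> objs C"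
  shows "valid (IC_op c d e)"
proof -
  note facts = obs homobj_Obj
  show ?thesis
    unfolding IC_op_def
    apply (rule valid_run[where ms = "map Swap [5] @
    [Rel 2 0 [] [] (arc (flip (theta_nat2 [H e d] (unit1 d) [H d c])) 0 4)] @
    map Swap [8, 7] @
    [Rel 8 0 [] [] (arc (flip (braid2_nat_gen [H e d] (runitor2 d c))) 2 3)] @
    map Swap [1, 2, 3, 4, 5, 6] @
    [Rel 7 1 [] [] (arc (flip (IC_rel c d e)) 2 2)] @
    map Swap [0, 6, 5, 4, 3] @
    [Rel 1 1 [] [] (arc (braid1_nat_gen (lunitor2 e d) [H d c]) 0 3),
      Rel 2 0 [] [] (arc (theta_unit [H e d] [H d c]) 0 3),
      Rel 3 0 [H e d] [] (cancel' (UnitL [H d c]))] @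
    map Swap [1]"])
      apply (simp add: facts op_movie_def theta_def wf_step.simps out.simps)
     apply (simp add: facts movie_simps braid1_nat_gen_def braid1_nat_def braid2_nat_gen_def
       braid2_nat_def theta_nat2_def theta_unit_def IC_rel_def op_movie_def theta_def)
    apply (simp add: facts valid_arc valid_cancel valid_braid_nat_gen valid_theta_nat2
      valid_theta_unit valid_IC_rel del: relation_simps)
    done
qed

section \<open>The structure of the opposite as paths and movies\<close>

lemma op_mult_hom:
  assumes o: "c \<in> objs C" "d \<in> objs C" "e \<in> objs C"
  shows "op_mult V C c d e \<in> hom V (H e d \<otimes> H d c) (H e c)"
    "rep_path (op_mult V C c d e) [H e d, H d c] [([], Beta [H e d] [H d c], []),
      ([], mult1 e d c, [])]"
proof -
  show r: "rep_path (op_mult V C c d e) [H e d, H d c] [([], Beta [H e d] [H d c], []),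
    ([], mult1 e d c, [])]"
    unfolding op_mult_def
    by (rule rep_path_conv, (rule rep_rules_C_cells | (simp add: o homobj_Obj; fail))+)
  then show "op_mult V C c d e \<in> hom V (H e d \<otimes> H d c) (H e c)"
    using eval_path_hom[of "[H e d, H d c]"
      "[([], Beta [H e d] [H d c], []), ([], mult1 e d c, [])]"] o
    by (simp add: rep_path_def unit_right0 homobj_Obj del: eval_path.simps)
qed

lemma rep_iso: "rep_cell x w p ss \<Longrightarrow> rep_path f w p \<Longrightarrow> rep_path g w q \<Longrightarrow> q = outs p ss \<Longrightarrow> x
  \<in> iso_cells V f g"
  using eval_movie_facts(3)[of w p ss] by (simp add: rep_cell_def rep_path_def)

lemmas rep_rules_op = op_mult_hom(2) rep_op_assoc rep_rules_C_cells

text \<open>\<open>op_lunitor\<close> omits the braiding with \<one>, whereas the target of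
  \<open>Beta1\<close> shows it as a layer; the step \<open>UnitL\<close> deletes it before \<rho>
  can act.\<close>

lemma rep_op_lunitor:
  assumes o: "c \<in> objs C" "d \<in> objs C"
  shows "rep_cell (op_lunitor V C c d) [H d c] [([], unit1 d, [H d c]),
    ([], Beta [H d d] [H d c], []), ([], mult1 d d c, [])]
    [(0, [], Beta1 ([], unit1 d, []) [H d c], []), (0, [], UnitL [H d c], []),
      (0, [], runitor2 d c, [])]"
proof -
  note facts = o homobj_Obj out.simps
  have J: "rep_cell (id2 V (id1 V (word_obj [H d c]))) [H d c] [([], Beta [] [H d c], [])]
    [(0, [], UnitL [H d c], [])]"
    using rep_gen2[OF wf_gen2_Unit(2), of "[H d c]"] facts by simp (simp add: UnitL_def)
  have u: "H d c \<lhd> unit C d \<in> hom V (H d c) (H d c \<otimes> H d d)"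
    using two_endofunctor.F1_hom[OF ltens_functor unit_hom] facts by (metis unit_right0)
  have b: "braid1 V (unit C d) (H d c) \<in> cells V (braid V (H d d) (H d c) \<cdot> (unit C d \<rhd> H d c))
    (H d c \<lhd> unit C d)"
    using iso_cellsD[OF pseudonatural_transformation.comp_cells[OF braid1_pseudonatural unit_hom]]
      comp1_id_right[OF u] facts
    by (metis braid_unit_left)
  have "(H d c \<lhd> unit C d) \<cdot>\<^sub>l id2 V (id1 V (word_obj [H d c])) = id2 V (H d c \<lhd> unit C d)"
    using lwhisk_id2[OF id1_hom u] comp1_id_right[OF u] facts by (simp add: unit_right0)
  \<comment> \<open>The inserted identity 2-cell does not change the value, but gives the
    translation a term from which to produce the step \<open>UnitL\<close>.\<close>
  then have e: "braid1 V (unit C d) (H d c)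
      = ((H d c \<lhd> unit C d) \<cdot>\<^sub>l id2 V (id1 V (word_obj [H d c]))) \<bullet> braid1 V (unit C d) (H d c)"
    using vcomp_id_left[OF b] by simp
  have 1: "rep_cell (((H d c \<lhd> unit C d) \<cdot>\<^sub>l id2 V (id1 V (word_obj [H d c]))) \<bullet> braid1 V (unit C d)
    (H d c)) [H d c]
      [([], unit1 d, [H d c]), ([], Beta [H d d] [H d c], [])]
        [(0, [], Beta1 ([], unit1 d, []) [H d c], []), (0, [], UnitL [H d c], [])]"
    by (rule rep_conv, (rule J rep_rules_op | (simp add: facts; fail))+)
  show ?thesis
    unfolding op_lunitor_def
    by (rule rep_conv, (rule 1[folded e] rep_rules_op | (simp add: facts; fail))+)
qed

lemma rep_op_runitor:
  assumes o: "c \<in> objs C" "d \<in> objs C"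
  shows "rep_cell (op_runitor V C c d) [H d c] [([H d c], unit1 c, []),
    ([], Beta [H d c] [H c c], []), ([], mult1 d c c, [])]
    [(0, [], Beta2 [H d c] ([], unit1 c, []), []), (0, [], UnitR [H d c], []),
      (0, [], lunitor2 d c, [])]"
proof -
  note facts = o homobj_Obj out.simps
  have J: "rep_cell (id2 V (id1 V (word_obj [H d c]))) [H d c] [([], Beta [H d c] [], [])]
    [(0, [], UnitR [H d c], [])]"
    using rep_gen2[OF wf_gen2_Unit(1), of "[H d c]"] facts by simp (simp add: UnitR_def)
  have u: "unit C c \<rhd> H d c \<in> hom V (H d c) (H c c \<otimes> H d c)"
    using two_endofunctor.F1_hom[OF rtens_functor unit_hom] facts by (metis unit_left0)
  have b: "braid2 V (H d c) (unit C c) \<in> cells V (braid V (H d c) (H c c) \<cdot> (H d c \<lhd> unit C c))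
    (unit C c \<rhd> H d c)"
    using iso_cellsD[OF pseudonatural_transformation.comp_cells[OF braid2_pseudonatural unit_hom]]
      comp1_id_right[OF u] facts
    by (metis braid_unit_right)
  have "(unit C c \<rhd> H d c) \<cdot>\<^sub>l id2 V (id1 V (word_obj [H d c])) = id2 V (unit C c \<rhd> H d c)"
    using lwhisk_id2[OF id1_hom u] comp1_id_right[OF u] facts by (simp add: unit_right0)
  then have e: "braid2 V (H d c) (unit C c)
      = ((unit C c \<rhd> H d c) \<cdot>\<^sub>l id2 V (id1 V (word_obj [H d c]))) \<bullet> braid2 V (H d c) (unit C c)"
    using vcomp_id_left[OF b] by simp
  have 1: "rep_cell (((unit C c \<rhd> H d c) \<cdot>\<^sub>l id2 V (id1 V (word_obj [H d c]))) \<bullet> braid2 V (H d c)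
    (unit C c)) [H d c]
      [([H d c], unit1 c, []), ([], Beta [H d c] [H c c], [])]
        [(0, [], Beta2 [H d c] ([], unit1 c, []), []), (0, [], UnitR [H d c], [])]"
    by (rule rep_conv, (rule J rep_rules_op | (simp add: facts; fail))+)
  show ?thesis
    unfolding op_runitor_def
    by (rule rep_conv, (rule 1[folded e] rep_rules_op | (simp add: facts; fail))+)
qed

text \<open>\<open>rep_Sigma\<close> handles single layers only, so the interchanger of the two
  composites is first split by \<open>interch_comp_left\<close> and
  \<open>interch_comp_right\<close>, into one piece for each pair of factors.\<close>

lemma op_Sigma:
  assumes o: "b \<in> objs C" "c \<in> objs C" "d \<in> objs C" "e \<in> objs C" "f \<in> objs C"
  shows "rep_cell (\<Sigma> (op_mult V C d e f) (op_mult V C b c d)) [H f e, H e d, H d c, H c b]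
    [([H f e, H e d], Beta [H d c] [H c b], []), ([H f e, H e d], mult1 d c b, []),
     ([], Beta [H f e] [H e d], [H d b]), ([], mult1 f e d, [H d b])]
    [(1, [], Sig (Beta [H f e] [H e d]) [] (mult1 d c b), []),
     (0, [], Sig (Beta [H f e] [H e d]) [] (Beta [H d c] [H c b]), []),
     (2, [], Sig (mult1 f e d) [] (mult1 d c b), []),
     (1, [], Sig (mult1 f e d) [] (Beta [H d c] [H c b]), [])]"
proof -
  note facts = o homobj_Obj out.simps
  have h: "braid V (H x y) (H z w) \<in> hom V (H x y \<otimes> H z w) (H z w \<otimes> H x y)"
    if "x \<in> objs C" "y \<in> objs C" "z \<in> objs C" "w \<in> objs C" for x y z w
    using pseudonatural_transformation.comp_hom[OF braid1_pseudonatural] that homobj_Obj by blast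
  note F = h[OF o(5,4,4,3)] mult_hom[OF o(5,4,3)] and G = h[OF o(3,2,2,1)] mult_hom[OF o(3,2,1)]
  show ?thesis
    unfolding op_mult_def interch_comp_left[OF F comp1_hom[OF G]] interch_comp_right[OF F(1) G]
      interch_comp_right[OF F(2) G]
    by (rule rep_conv, (rule rep_rules_op | (simp add: facts; fail))+)
qed

lemma v_bicategory_op: "v_bicategory V (op_bicat V C)"
proof
  fix c d assume o: "c \<in> objs (op_bicat V C)" "d \<in> objs (op_bicat V C)"
  then have o': "c \<in> objs C" "d \<in> objs C" by (auto simp: op_bicat_def)
  show "homobj (op_bicat V C) c d \<in> Obj V" using o' homobj_Obj by (simp add: op_bicat_def)
  show "lunitor (op_bicat V C) c d
    \<in> iso_cells V (mult (op_bicat V C) c d d \<cdot> (unit (op_bicat V C) d \<rhd> homobj (op_bicat V C) c d))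
      (id1 V (homobj (op_bicat V C) c d))"
    unfolding op_bicat_def v_bicat.simps
    by (rule rep_iso[OF rep_op_lunitor[OF o']],
      (rule rep_path_conv, (rule rep_rules_op | (simp add: o' homobj_Obj out.simps; fail))+)+)
  show "runitor (op_bicat V C) c d
    \<in> iso_cells V (mult (op_bicat V C) c c d \<cdot> (homobj (op_bicat V C) c d \<lhd> unit (op_bicat V C) c))
      (id1 V (homobj (op_bicat V C) c d))"
    unfolding op_bicat_def v_bicat.simps
    by (rule rep_iso[OF rep_op_runitor[OF o']],
      (rule rep_path_conv, (rule rep_rules_op | (simp add: o' homobj_Obj out.simps; fail))+)+)
next
  fix c assume "c \<in> objs (op_bicat V C)"
  then show "unit (op_bicat V C) c \<in> hom V \<one> (homobj (op_bicat V C) c c)" using unit_hom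
    by (simp add: op_bicat_def)
next
  fix c d e assume "c \<in> objs (op_bicat V C)" "d \<in> objs (op_bicat V C)" "e \<in> objs (op_bicat V C)"
  then have o: "c \<in> objs C" "d \<in> objs C" "e \<in> objs C" by (auto simp: op_bicat_def)
  show "mult (op_bicat V C) c d e \<in> hom V (homobj (op_bicat V C) d e \<otimes> homobj (op_bicat V C) c d)
    (homobj (op_bicat V C) c e)"
    using op_mult_hom(1)[OF o] by (simp add: op_bicat_def)
  \<comment> \<open>Unfolding yields \<open>movie_eq\<close> between explicit lists of steps;
    translating the two sides of the axiom produces these same lists.\<close>
  note eq = valid_IC_op[OF o, unfolded IC_op_def valid.simps op_movie_def theta_def shift_append
    shift_simps append.simps]
  show "(mult (op_bicat V C) c d e \<cdot>\<^sub>l (homobj (op_bicat V C) d e \<unlhd> lunitor (op_bicat V C) c d))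
      \<bullet> (assoc (op_bicat V C) c d d e \<cdot>\<^sub>r
        (homobj (op_bicat V C) d e \<lhd> (unit (op_bicat V C) d \<rhd> homobj (op_bicat V C) c d)))
    = mult (op_bicat V C) c d e \<cdot>\<^sub>l (runitor (op_bicat V C) d e \<unrhd> homobj (op_bicat V C) c d)"
    unfolding op_bicat_def v_bicat.simps
    by (rule eq_of_movie_eq[OF eq], (rule rep_conv, (rule rep_op_lunitor rep_op_runitor rep_rules_op
      | (simp add: o homobj_Obj out.simps op_path_def op_movie_def theta_def; fail))+)+)
next
  fix c d e f assume "c \<in> objs (op_bicat V C)" "d \<in> objs (op_bicat V C)" "e \<in> objs (op_bicat V C)"
    "f \<in> objs (op_bicat V C)"
  then have o: "c \<in> objs C" "d \<in> objs C" "e \<in> objs C" "f \<in> objs C" by (auto simp: op_bicat_def)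
  show "assoc (op_bicat V C) c d e f \<in> iso_cells V
      (mult (op_bicat V C) c d f \<cdot> (mult (op_bicat V C) d e f \<rhd> homobj (op_bicat V C) c d))
      (mult (op_bicat V C) c e f \<cdot> (homobj (op_bicat V C) e f \<lhd> mult (op_bicat V C) c d e))"
    unfolding op_bicat_def v_bicat.simps
    by (rule rep_iso[OF rep_op_assoc[OF o]], (rule rep_path_conv, (rule rep_rules_op
      | (simp add: o homobj_Obj out.simps op_path_def op_movie_def theta_def; fail))+)+)
next
  fix b c d e f assume "b \<in> objs (op_bicat V C)" "c \<in> objs (op_bicat V C)" "d \<in> objs (op_bicat V C)"
    "e \<in> objs (op_bicat V C)" "f \<in> objs (op_bicat V C)"
  then have o: "b \<in> objs C" "c \<in> objs C" "d \<in> objs C" "e \<in> objs C" "f \<in> objs C"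
    by (auto simp: op_bicat_def)
  note eq = valid_AC_op[OF o, unfolded AC_op_def valid.simps op_movie_def theta_def shift_append
    shift_simps append.simps]
  show "(mult (op_bicat V C) b e f \<cdot>\<^sub>l (homobj (op_bicat V C) e f \<unlhd> assoc (op_bicat V C) b c d e))
      \<bullet> (assoc (op_bicat V C) b c e f \<cdot>\<^sub>r
        (homobj (op_bicat V C) e f \<lhd> (mult (op_bicat V C) c d e \<rhd> homobj (op_bicat V C) b c)))
      \<bullet> (mult (op_bicat V C) b c f \<cdot>\<^sub>l (assoc (op_bicat V C) c d e f \<unrhd> homobj (op_bicat V C) b c))
    = (assoc (op_bicat V C) b d e f \<cdot>\<^sub>r ((homobj (op_bicat V C) e f \<otimes> homobj (op_bicat V C) d e) \<lhd>
      mult (op_bicat V C) b c d))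
      \<bullet> (mult (op_bicat V C) b d f \<cdot>\<^sub>l inv2 V
        (\<Sigma> (mult (op_bicat V C) d e f) (mult (op_bicat V C) b c d)))
      \<bullet> (assoc (op_bicat V C) b c d f \<cdot>\<^sub>r
        (mult (op_bicat V C) d e f \<rhd> (homobj (op_bicat V C) c d \<otimes> homobj (op_bicat V C) b c)))"
    unfolding op_bicat_def v_bicat.simps
    by (rule eq_of_movie_eq[OF eq], (rule rep_conv, (rule op_Sigma rep_rules_op
      | (simp add: o homobj_Obj out.simps op_path_def op_movie_def theta_def; fail))+)+)
qed

end

theorem theorem4p15:
  fixes V :: "('o, 'm, 'c, 'z) braided_gray_scheme"
    and C :: "('a, 'o, 'm, 'c) v_bicat"
  assumes "semistrict_braided_monoidal_bicategory V"
    and "v_bicategory V C"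
  shows "v_bicategory V (op_bicat V C)"
  using assms by (intro enriched.v_bicategory_op enriched.intro)

end
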